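(* Let $r,s\in(0,\infty)$. \begin{itemize} \item If $r\le s\le 2$, then $\Lambda(L_s(L_r))=[r,2]$. \item If $r\le 2\le s$, then $\Lambda(L_s(L_r))=[r,2]\cup\{s\}$. \item If $2\le r\le s$, then $\Lambda(L_s(L_r))=\{2,r,s\}$. \item If $s\le\min\{2,r\}$, then $\Lambda(L_s(L_r))=[s,\max\{2,r\}]$. \item If $2<s\le r$, then $\Lambda(L_s(L_r))=\{2\}\cup[s,r]$. \end{itemize}
   Context: Spaces are over the real or complex field. For a quasi-Banach space $X$, $\Lambda(X)=\{p\in(0,\infty] : \ell_p \text{ isomorphically embeds into } X\}$, with the convention that for $p=\infty$ the symbol $\ell_\infty$ means $c_0$. "Isomorphically embeds" means that there is a linear homeomorphism onto a closed subspace. $L_s(L_r)$ is the mixed-norm quasi-Banach space of (classes of) measurable functions $f$ on $[0,1]\times[0,1]$ (Lebesgue measure) with quasi-norm $\left(\int_0^1\left(\int_0^1|f(x,y)|^r\,dy\right)^{s/r}dx\right)^{1/s}<\infty$. *)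

theory Defs
  imports "HOL-Analysis.Analysis"
begin

text \<open>
  The spaces depend on real parameters, so a quasi-normed space is an explicit structure with a
  carrier \<open>vecs\<close>, over the scalars \<open>'k\<close> (used below for the real and the complex numbers).
\<close>

record ('k, 'v) qn_space =
  vecs :: "'v set"
  vadd :: "'v \<Rightarrow> 'v \<Rightarrow> 'v"
  vscale :: "'k \<Rightarrow> 'v \<Rightarrow> 'v"
  qnorm :: "'v \<Rightarrow> real"

definition qn_dist :: "('k::real_normed_field, 'v) qn_space \<Rightarrow> 'v \<Rightarrow> 'v \<Rightarrow> real" where
  "qn_dist X x y = qnorm X (vadd X y (vscale X (-1) x))"

text \<open>
  For a quasi-norm, balls need not be open; they are only neighbourhoods of their centre. So the
  topology is defined by requiring an open set to contain a ball around each of its points.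
\<close>

definition qn_topology :: "('k::real_normed_field, 'v) qn_space \<Rightarrow> 'v topology" where
  "qn_topology X = topology (\<lambda>U. U \<subseteq> vecs X \<and>
     (\<forall>x\<in>U. \<exists>e>0. \<forall>y\<in>vecs X. qn_dist X x y < e \<longrightarrow> y \<in> U))"

lemma openin_qn_topology:
  "openin (qn_topology X) U \<longleftrightarrow> U \<subseteq> vecs X \<and>
     (\<forall>x\<in>U. \<exists>e>0. \<forall>y\<in>vecs X. qn_dist X x y < e \<longrightarrow> y \<in> U)"
proof -
  let ?P = "\<lambda>U. U \<subseteq> vecs X \<and> (\<forall>x\<in>U. \<exists>e>0. \<forall>y\<in>vecs X. qn_dist X x y < e \<longrightarrow> y \<in> U)"
  have "istopology ?P"
    unfolding istopology_def
  proof (intro conjI allI impI)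
    fix S T assume S: "?P S" and T: "?P T"
    show "S \<inter> T \<subseteq> vecs X" using S by blast
    show "\<forall>x\<in>S \<inter> T. \<exists>e>0. \<forall>y\<in>vecs X. qn_dist X x y < e \<longrightarrow> y \<in> S \<inter> T"
    proof
      fix x assume x: "x \<in> S \<inter> T"
      obtain d where d: "d > 0" "\<forall>y\<in>vecs X. qn_dist X x y < d \<longrightarrow> y \<in> S" using S x by blast
      obtain e where e: "e > 0" "\<forall>y\<in>vecs X. qn_dist X x y < e \<longrightarrow> y \<in> T" using T x by blast
      show "\<exists>e>0. \<forall>y\<in>vecs X. qn_dist X x y < e \<longrightarrow> y \<in> S \<inter> T"
        using d e by (intro exI[of _ "min d e"]) auto
    qed
  next
    fix \<K> assume K: "\<forall>K\<in>\<K>. ?P K"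
    show "\<Union>\<K> \<subseteq> vecs X" using K by blast
    show "\<forall>x\<in>\<Union>\<K>. \<exists>e>0. \<forall>y\<in>vecs X. qn_dist X x y < e \<longrightarrow> y \<in> \<Union>\<K>"
      using K by (meson UnionE UnionI)
  qed
  then show ?thesis
    unfolding qn_topology_def by (simp add: topology_inverse')
qed

lemma topspace_qn_topology: "topspace (qn_topology X) = vecs X"
proof -
  have "openin (qn_topology X) (vecs X)"
    unfolding openin_qn_topology using zero_less_one by blast
  then show ?thesis
    by (meson openin_qn_topology openin_subset openin_topspace subset_antisym)
qed

definition qn_linear ::
  "('k::real_normed_field, 'v) qn_space \<Rightarrow> ('k, 'w) qn_space \<Rightarrow> ('v \<Rightarrow> 'w) \<Rightarrow> bool" where
  "qn_linear X Y T \<longleftrightarrow>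
     (\<forall>x\<in>vecs X. T x \<in> vecs Y) \<and>
     (\<forall>x\<in>vecs X. \<forall>y\<in>vecs X. T (vadd X x y) = vadd Y (T x) (T y)) \<and>
     (\<forall>c. \<forall>x\<in>vecs X. T (vscale X c x) = vscale Y c (T x))"

definition embeds_isomorphically ::
  "('k::real_normed_field, 'v) qn_space \<Rightarrow> ('k, 'w) qn_space \<Rightarrow> bool" where
  "embeds_isomorphically X Y \<longleftrightarrow>
     (\<exists>T. qn_linear X Y T \<and>
          closedin (qn_topology Y) (T ` vecs X) \<and>
          homeomorphic_map (qn_topology X) (subtopology (qn_topology Y) (T ` vecs X)) T)"

definition ell_space :: "real \<Rightarrow> ('k::real_normed_field, nat \<Rightarrow> 'k) qn_space" where
  "ell_space p =
     \<lparr>vecs = {x. summable (\<lambda>n. norm (x n) powr p)},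
      vadd = (\<lambda>x y n. x n + y n),
      vscale = (\<lambda>c x n. c * x n),
      qnorm = (\<lambda>x. (\<Sum>n. norm (x n) powr p) powr (1 / p))\<rparr>"

definition c0_space :: "('k::real_normed_field, nat \<Rightarrow> 'k) qn_space" where
  "c0_space =
     \<lparr>vecs = {x. x \<longlonglongrightarrow> 0},
      vadd = (\<lambda>x y n. x n + y n),
      vscale = (\<lambda>c x n. c * x n),
      qnorm = (\<lambda>x. SUP n. norm (x n))\<rparr>"

definition ell :: "ereal \<Rightarrow> ('k::real_normed_field, nat \<Rightarrow> 'k) qn_space" where
  "ell p = (if p = \<infinity> then c0_space else ell_space (real_of_ereal p))"

definition Lambda :: "('k::real_normed_field, 'v) qn_space \<Rightarrow> ereal set" where
  "Lambda X = {p. 0 < p \<and> embeds_isomorphically (ell p) X}"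

text \<open>Powers of extended nonnegative reals, for exponents \<open>a > 0\<close>.\<close>

definition enn_powr :: "ennreal \<Rightarrow> real \<Rightarrow> ennreal" where
  "enn_powr t a = (if t = \<infinity> then \<infinity> else ennreal (enn2real t powr a))"

definition unit_sq :: "(real \<times> real) measure" where
  "unit_sq = lebesgue_on ({0..1} \<times> {0..1})"

definition mixed_integral :: "real \<Rightarrow> real \<Rightarrow> (real \<times> real \<Rightarrow> 'k::real_normed_field) \<Rightarrow> ennreal" where
  "mixed_integral s r f =
     (\<integral>\<^sup>+x. enn_powr (\<integral>\<^sup>+y. ennreal (norm (f (x, y)) powr r) \<partial>lebesgue_on {0..1}) (s / r)
        \<partial>lebesgue_on {0..1})"

definition mixed_funs :: "real \<Rightarrow> real \<Rightarrow> (real \<times> real \<Rightarrow> 'k::real_normed_field) set" where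
  "mixed_funs s r = {f \<in> borel_measurable unit_sq. mixed_integral s r f < \<infinity>}"

definition mixed_rel :: "real \<Rightarrow> real \<Rightarrow>
    ((real \<times> real \<Rightarrow> 'k::real_normed_field) \<times> (real \<times> real \<Rightarrow> 'k)) set" where
  "mixed_rel s r = {(f, g). f \<in> mixed_funs s r \<and> g \<in> mixed_funs s r \<and> (AE z in unit_sq. f z = g z)}"

text \<open>
  The space \<open>L\<^sub>s(L\<^sub>r)\<close>, with almost everywhere equality factored out: \<open>r\<close> is the exponent of the
  inner integral (second variable), \<open>s\<close> that of the outer one. The quasi-norm does not depend on
  the representative, so it takes a single value on each class. Functions are total on the plane;
  their values off the unit square are ignored by the integrals and by the equivalence.
\<close>

definition mixed_L ::
  "real \<Rightarrow> real \<Rightarrow> ('k::real_normed_field, (real \<times> real \<Rightarrow> 'k) set) qn_space" where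
  "mixed_L s r =
     \<lparr>vecs = mixed_funs s r // mixed_rel s r,
      vadd = (\<lambda>A B. \<Union>f\<in>A. \<Union>g\<in>B. mixed_rel s r `` {\<lambda>z. f z + g z}),
      vscale = (\<lambda>c A. \<Union>f\<in>A. mixed_rel s r `` {\<lambda>z. c * f z}),
      qnorm = (\<lambda>A. the_elem ((\<lambda>f. enn2real (mixed_integral s r f) powr (1 / s)) ` A))\<rparr>"

abbreviation mixed_L_real :: "real \<Rightarrow> real \<Rightarrow> (real, (real \<times> real \<Rightarrow> real) set) qn_space" where
  "mixed_L_real \<equiv> mixed_L"

abbreviation mixed_L_complex ::
  "real \<Rightarrow> real \<Rightarrow> (complex, (real \<times> real \<Rightarrow> complex) set) qn_space" where
  "mixed_L_complex \<equiv> mixed_L"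

end

theory Submission
  imports Defs
begin

text \<open>
  Write \<open>X\<close> for \<open>L\<^sub>s(L\<^sub>r)\<close>. If \<open>\<ell>\<^sub>p\<close> embeds into \<open>X\<close>, the images \<open>h i\<close> of the unit vectors have the property
  that every signed sum of \<open>n\<close> of them has quasi-norm of order \<open>n powr (1/p)\<close> (of order \<open>1\<close> for \<open>c\<^sub>0\<close>). The
  restrictions on \<open>p\<close> follow from this property. Averaging over the signs, Khinchine's inequality replaces the sums by
  the square function \<open>(\<Sum>|h i|\<^sup>2)\<^sup>1\<^sup>/\<^sup>2\<close>, and Minkowski's inequality, for exponents above or below \<open>1\<close>, compares
  its quasi-norm with \<open>n powr (1/m)\<close> where \<open>m\<close> is the smallest or the largest of \<open>2, r, s\<close>
  (\<open>spreads_type\<close>, \<open>spreads_cotype\<close>). So \<open>p\<close> lies between these.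

  Two gaps remain, and both are excluded by a Kadec--Pelczynski argument. If \<open>2 < p < min s r\<close>, the cotype
  estimate in the larger space \<open>L\<^sub>2\<close> shows that the \<open>h i\<close> tend to zero there; hence sufficiently many of them are almost
  disjoint, and the sum of \<open>n\<close> of those is at most of order \<open>n powr (1 / min s r)\<close>, which is too small
  (\<open>spreads_gap_both\<close>). If \<open>max 2 r < p < s\<close>, the same happens in \<open>L\<^sub>q(L\<^sub>r)\<close> with \<open>q = max 2 r\<close>, where now the
  functions \<open>x \<mapsto> \<parallel>h i (x, \<cdot>)\<parallel>\<^sub>r\<close> become almost disjoint and sums are of order \<open>n powr (1/s)\<close>
  (\<open>spreads_gap_outer\<close>). The common step is the lemma \<open>gliding_hump\<close>.

  In the other direction, \<open>\<ell>\<^sub>r\<close> and \<open>\<ell>\<^sub>s\<close> are spanned by disjoint functions of one variable and \<open>\<ell>\<^sub>2\<close> by the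
  Rademacher functions. For \<open>0 < \<beta> < \<alpha> < 1\<close> there are nonnegative functions \<open>g n\<close> on the unit interval with
  \<open>\<parallel>\<Sum> b n * g n\<parallel>\<^sub>\<beta> \<sim> (\<Sum> b n powr \<alpha>) powr (1/\<alpha>)\<close> for all \<open>b n \<ge> 0\<close>, as for independent positive
  \<open>\<alpha>\<close>-stable variables (\<open>stable_equivalence\<close>). Multiplying roots of the \<open>g n\<close> in one variable by disjoint functions
  in the other gives \<open>\<ell>\<^sub>p\<close> for \<open>s < p < r\<close>, and by Rademacher functions gives \<open>\<ell>\<^sub>p\<close> for \<open>s < p < 2\<close> and, if \<open>r \<le> s\<close>, for
  \<open>r < p < 2\<close>. These are all the exponents that the restrictions allow.

  All quasi-norms are computed as functionals on nonnegative Borel functions with values in \<open>[0, \<infinity>]\<close>; a class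
  in \<open>X\<close> is represented by a Borel function, whose sections are Borel as well.
\<close>

section \<open>Powers of extended nonnegative reals\<close>

lemma enn_powr_top [simp]: "enn_powr top a = top"
  by (simp add: enn_powr_def)

lemma enn_powr_ennreal [simp]: "0 \<le> x \<Longrightarrow> enn_powr (ennreal x) a = ennreal (x powr a)"
  by (simp add: enn_powr_def)

lemma enn_powr_0 [simp]: "enn_powr 0 a = 0"
  by (simp add: enn_powr_def)

lemma enn_powr_1 [simp]: "enn_powr 1 a = 1"
  by (simp add: enn_powr_def)

lemma enn_powr_one_right [simp]: "enn_powr t 1 = t"
  by (cases t) auto

lemma enn_powr_eq_0_iff [simp]: "enn_powr t a = 0 \<longleftrightarrow> t = 0"
  by (cases t) (auto simp: ennreal_eq_0_iff)

lemma enn_powr_eq_top_iff [simp]: "enn_powr t a = top \<longleftrightarrow> t = top"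
  by (cases t) auto

lemma enn_powr_less_top_iff [simp]: "enn_powr t a < top \<longleftrightarrow> t < top"
  by (metis enn_powr_eq_top_iff less_top)

lemma enn_powr_mono: "t \<le> u \<Longrightarrow> 0 \<le> a \<Longrightarrow> enn_powr t a \<le> enn_powr u a"
  by (cases t; cases u) (auto intro!: ennreal_leI powr_mono2 simp: top_unique)

lemma enn_powr_enn_powr: "enn_powr (enn_powr t a) b = enn_powr t (a * b)"
  by (cases t) (auto simp: powr_powr)

lemma enn_powr_mult: "enn_powr (t * u) a = enn_powr t a * enn_powr u a"
proof (cases "t = top \<or> u = top")
  case True
  then show ?thesis by (auto simp: ennreal_mult_top ennreal_top_mult)
next
  case False
  then obtain x y where "t = ennreal x" "0 \<le> x" "u = ennreal y" "0 \<le> y"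
    by (cases t; cases u) auto
  then show ?thesis by (simp add: powr_mult flip: ennreal_mult)
qed

lemma enn_powr_le_iff: "0 < a \<Longrightarrow> enn_powr t a \<le> enn_powr u a \<longleftrightarrow> t \<le> u"
  using enn_powr_mono[of t u a] enn_powr_mono[of "enn_powr t a" "enn_powr u a" "1/a"]
  by (auto simp: enn_powr_enn_powr)

lemma enn_powr_less_iff: "0 < a \<Longrightarrow> enn_powr t a < enn_powr u a \<longleftrightarrow> t < u"
  by (simp add: enn_powr_le_iff flip: not_le)

lemma enn_powr_le_swap: "0 < a \<Longrightarrow> enn_powr t (1/a) \<le> u \<longleftrightarrow> t \<le> enn_powr u a"
  using enn_powr_le_iff[of a "enn_powr t (1/a)" u] by (simp add: enn_powr_enn_powr)

lemma le_enn_powr_swap: "0 < a \<Longrightarrow> u \<le> enn_powr t (1/a) \<longleftrightarrow> enn_powr u a \<le> t"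
  using enn_powr_le_iff[of a u "enn_powr t (1/a)"] by (simp add: enn_powr_enn_powr)

lemma enn_powr_less_swap: "0 < a \<Longrightarrow> enn_powr t a < u \<longleftrightarrow> t < enn_powr u (1/a)"
  using enn_powr_less_iff[of a t "enn_powr u (1/a)"] by (simp add: enn_powr_enn_powr)

lemma less_enn_powr_swap: "0 < a \<Longrightarrow> u < enn_powr t a \<longleftrightarrow> enn_powr u (1/a) < t"
  using enn_powr_less_iff[of a "enn_powr u (1/a)" t] by (simp add: enn_powr_enn_powr)

lemma enn_powr_SUP:
  assumes "0 < a"
  shows "enn_powr (SUP i\<in>I. f i) a = (SUP i\<in>I. enn_powr (f i) a)"
proof (rule antisym)
  show "(SUP i\<in>I. enn_powr (f i) a) \<le> enn_powr (SUP i\<in>I. f i) a"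
    using assms by (intro SUP_least enn_powr_mono SUP_upper) auto
  have "f i \<le> enn_powr (SUP i\<in>I. enn_powr (f i) a) (1/a)" if "i \<in> I" for i
    using assms that by (simp add: le_enn_powr_swap) (rule SUP_upper)
  then have "(SUP i\<in>I. f i) \<le> enn_powr (SUP i\<in>I. enn_powr (f i) a) (1/a)"
    by (rule SUP_least)
  then show "enn_powr (SUP i\<in>I. f i) a \<le> (SUP i\<in>I. enn_powr (f i) a)"
    using assms by (simp add: le_enn_powr_swap)
qed

lemma tendsto_enn_powr_0:
  assumes "(f \<longlongrightarrow> 0) F" "0 < a"
  shows "((\<lambda>i. enn_powr (f i) a) \<longlongrightarrow> 0) F"
proof (rule order_tendstoI)
  fix u :: ennreal assume "0 < u"
  then have "0 < enn_powr u (1/a)" by (simp add: zero_less_iff_neq_zero)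
  then have "\<forall>\<^sub>F i in F. f i < enn_powr u (1/a)" using assms(1) by (rule order_tendstoD(2)[rotated])
  then show "\<forall>\<^sub>F i in F. enn_powr (f i) a < u"
    using assms(2) by (simp add: enn_powr_less_swap)
qed auto

lemma borel_measurable_enn_powr [measurable (raw)]:
  assumes "f \<in> borel_measurable M" "0 < a"
  shows "(\<lambda>x. enn_powr (f x) a) \<in> borel_measurable M"
proof (rule borel_measurableI_greater)
  fix y :: ennreal
  have "{x \<in> space M. y < enn_powr (f x) a} = {x \<in> space M. enn_powr y (1/a) < f x}"
    using assms(2) by (simp add: less_enn_powr_swap)
  also have "\<dots> \<in> sets M" using assms(1) by measurable
  finally show "{x \<in> space M. y < enn_powr (f x) a} \<in> sets M" .
qed

text \<open>The endpoint \<open>0\<close> is added to the convexity of powers on the open half-line.\<close>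

lemma convex_on_powr_nonneg: "1 \<le> k \<Longrightarrow> convex_on {0..} (\<lambda>x::real. x powr k)"
proof (intro convex_onI)
  fix t x y :: real assume k: "1 \<le> k" and t: "0 < t" "t < 1" and x: "x \<in> {0..}" "y \<in> {0..}"
  have p: "u powr k \<le> u" if "0 < u" "u < 1" for u :: real
    using powr_mono'[of 1 k u] that k by auto
  show "((1 - t) *\<^sub>R x + t *\<^sub>R y) powr k \<le> (1 - t) * x powr k + t * y powr k"
  proof (cases "x = 0 \<or> y = 0")
    case True
    then show ?thesis
    proof
      assume "x = 0"
      then show ?thesis using t x p[of t] by (simp add: powr_mult mult_right_mono)
    next
      assume "y = 0"
      then show ?thesis using t x p[of "1-t"] by (simp add: powr_mult mult_right_mono)
    qed
  next
    case False
    then show ?thesis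
      using convex_onD[OF powr_convex[OF k], of t x y] t x by auto
  qed
qed auto

lemma powr_weight_eq:
  fixes a c k x :: real
  assumes "0 < a" "0 < c" "0 \<le> x"
  shows "c powr k * (a / c * (x / a) powr k) = c powr (k - 1) * (a powr (1 - k) * x powr k)"
  using assms by (simp add: powr_diff powr_divide)

text \<open>A weighted form of the convexity of \<open>x powr k\<close>; its integrated version with \<open>a\<close> and \<open>b\<close> the
  norms of two functions is Minkowski's inequality.\<close>

lemma powr_add_le_weighted:
  fixes k a b :: real and t u :: ennreal
  assumes k: "1 \<le> k" and a: "0 < a" and b: "0 < b"
  shows "enn_powr (t + u) k \<le> ennreal ((a + b) powr (k - 1)) *
           (ennreal (a powr (1 - k)) * enn_powr t k + ennreal (b powr (1 - k)) * enn_powr u k)"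
proof (cases "t = top \<or> u = top")
  case True
  then show ?thesis using a b by (auto simp: ennreal_mult_top)
next
  case False
  then obtain x y where xy: "t = ennreal x" "0 \<le> x" "u = ennreal y" "0 \<le> y"
    by (cases t; cases u) auto
  have "((1 - b/(a+b)) *\<^sub>R (x/a) + (b/(a+b)) *\<^sub>R (y/b)) powr k
      \<le> (1 - b/(a+b)) * (x/a) powr k + (b/(a+b)) * (y/b) powr k"
    using xy a b by (intro convex_onD[OF convex_on_powr_nonneg[OF k]]) auto
  moreover have "1 - b/(a+b) = a/(a+b)" using a b by (simp add: field_simps)
  ultimately have "((x + y)/(a+b)) powr k \<le> a/(a+b) * (x/a) powr k + b/(a+b) * (y/b) powr k"
    using a b by (simp add: add_divide_distrib)
  then have "(a+b) powr k * ((x + y)/(a+b)) powr k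
      \<le> (a+b) powr k * (a/(a+b) * (x/a) powr k + b/(a+b) * (y/b) powr k)"
    by (rule mult_left_mono) simp
  moreover have "(a+b) powr k * ((x + y)/(a+b)) powr k = (x+y) powr k"
    using a b xy by (simp flip: powr_mult)
  moreover have "(a+b) powr k * (a/(a+b) * (x/a) powr k + b/(a+b) * (y/b) powr k)
      = (a+b) powr (k-1) * (a powr (1-k) * x powr k + b powr (1-k) * y powr k)"
    using powr_weight_eq[of a "a+b" x k] powr_weight_eq[of b "a+b" y k] a b xy
    by (simp add: distrib_left)
  ultimately show ?thesis
    using a b xy by (simp flip: ennreal_plus ennreal_mult)
qed

text \<open>The concave counterpart is the convex inequality with exponent \<open>1/k\<close>, read backwards.\<close>

lemma powr_add_ge_weighted:
  fixes k a b :: real and t u :: ennreal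
  assumes k: "0 < k" "k \<le> 1" and a: "0 < a" and b: "0 < b"
  shows "ennreal ((a + b) powr (k - 1)) *
           (ennreal (a powr (1 - k)) * enn_powr t k + ennreal (b powr (1 - k)) * enn_powr u k)
         \<le> enn_powr (t + u) k"
proof (cases "t = top \<or> u = top")
  case True
  then show ?thesis by auto
next
  case False
  then obtain x y where xy: "t = ennreal x" "0 \<le> x" "u = ennreal y" "0 \<le> y"
    by (cases t; cases u) auto
  have k': "1 \<le> 1/k" using k by simp
  have "((1 - b/(a+b)) *\<^sub>R ((x/a) powr k) + (b/(a+b)) *\<^sub>R ((y/b) powr k)) powr (1/k)
      \<le> (1 - b/(a+b)) * ((x/a) powr k) powr (1/k) + (b/(a+b)) * ((y/b) powr k) powr (1/k)"
    using xy a b by (intro convex_onD[OF convex_on_powr_nonneg[OF k']]) auto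
  moreover have "1 - b/(a+b) = a/(a+b)" using a b by (simp add: field_simps)
  ultimately have *: "(a/(a+b) * (x/a) powr k + b/(a+b) * (y/b) powr k) powr (1/k)
      \<le> (x + y)/(a+b)" (is "?L powr _ \<le> _")
    using a b xy k by (simp add: powr_powr add_divide_distrib)
  have "?L \<ge> 0" using a b by simp
  then have "?L = (?L powr (1/k)) powr k" using k by (simp add: powr_powr)
  also have "\<dots> \<le> ((x + y)/(a+b)) powr k"
    using * k by (intro powr_mono2) auto
  finally have "(a+b) powr k * ?L \<le> (a+b) powr k * ((x + y)/(a+b)) powr k"
    by (rule mult_left_mono) simp
  moreover have "(a+b) powr k * ((x + y)/(a+b)) powr k = (x+y) powr k"
    using a b xy by (simp flip: powr_mult)
  moreover have "(a+b) powr k * ?L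
      = (a+b) powr (k-1) * (a powr (1-k) * x powr k + b powr (1-k) * y powr k)"
    using powr_weight_eq[of a "a+b" x k] powr_weight_eq[of b "a+b" y k] a b xy
    by (simp add: distrib_left)
  ultimately show ?thesis
    using a b xy by (simp flip: ennreal_plus ennreal_mult)
qed

lemma enn_powr_add_le:
  assumes "0 < k" "k \<le> 1"
  shows "enn_powr (t + u) k \<le> enn_powr t k + enn_powr u k"
proof (cases "t = top \<or> u = top \<or> t + u = 0")
  case True
  then show ?thesis by auto
next
  case False
  then obtain x y where xy: "t = ennreal x" "0 \<le> x" "u = ennreal y" "0 \<le> y"
    by (cases t; cases u) auto
  with False have pos: "0 < x + y" by (auto simp flip: ennreal_plus)
  have "z / (x+y) \<le> (z / (x+y)) powr k" if "0 \<le> z" "z \<le> x + y" for z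
    using powr_mono'[of k 1 "z/(x+y)"] that pos assms by (cases "z = 0") auto
  then have "x/(x+y) + y/(x+y) \<le> (x/(x+y)) powr k + (y/(x+y)) powr k"
    using xy by (intro add_mono) auto
  then have "1 \<le> (x powr k + y powr k) / (x+y) powr k"
    using xy pos by (simp add: powr_divide add_divide_distrib[symmetric])
  then have "(x+y) powr k \<le> x powr k + y powr k"
    using pos by (simp add: field_simps)
  then show ?thesis using xy by (simp flip: ennreal_plus)
qed

lemma enn_powr_sum_le:
  assumes "0 < k" "k \<le> 1"
  shows "enn_powr (\<Sum>i\<in>I. f i) k \<le> (\<Sum>i\<in>I. enn_powr (f i) k)"
proof (induction I rule: infinite_finite_induct)
  case (insert i I)
  then show ?case
    using enn_powr_add_le[OF assms, of "f i" "sum f I"] by (auto intro: order_trans add_left_mono)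
qed auto

lemma sum_enn_powr_le:
  assumes "1 \<le> k"
  shows "(\<Sum>i\<in>I. enn_powr (f i) k) \<le> enn_powr (\<Sum>i\<in>I. f i) k"
  using enn_powr_sum_le[of "1/k" "\<lambda>i. enn_powr (f i) k" I] assms
  by (simp add: enn_powr_enn_powr enn_powr_le_swap)

section \<open>The functionals \<open>L\<^sub>k\<close> and Minkowski's inequalities\<close>

text \<open>With values in \<open>[0, \<infinity>]\<close> the functional is defined for every function. It is a norm for \<open>k \<ge> 1\<close>, and
  superadditive on nonnegative functions for \<open>k \<le> 1\<close>. Both regimes are used: replacing \<open>g\<close> by \<open>g powr t\<close> multiplies the
  exponent by \<open>t\<close> (\<open>Lnorm_enn_powr\<close>), so that every exponent can be moved to the convenient side of \<open>1\<close>.\<close>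

definition Lnorm :: "'a measure \<Rightarrow> real \<Rightarrow> ('a \<Rightarrow> ennreal) \<Rightarrow> ennreal" where
  "Lnorm M k g = enn_powr (\<integral>\<^sup>+z. enn_powr (g z) k \<partial>M) (1 / k)"

lemma enn_powr_Lnorm: "0 < k \<Longrightarrow> enn_powr (Lnorm M k g) k = (\<integral>\<^sup>+z. enn_powr (g z) k \<partial>M)"
  by (simp add: Lnorm_def enn_powr_enn_powr)

lemma Lnorm_le_iff: "0 < k \<Longrightarrow> Lnorm M k g \<le> c \<longleftrightarrow> (\<integral>\<^sup>+z. enn_powr (g z) k \<partial>M) \<le> enn_powr c k"
  by (simp add: Lnorm_def enn_powr_le_swap)

lemma le_Lnorm_iff: "0 < k \<Longrightarrow> c \<le> Lnorm M k g \<longleftrightarrow> enn_powr c k \<le> (\<integral>\<^sup>+z. enn_powr (g z) k \<partial>M)"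
  by (simp add: Lnorm_def le_enn_powr_swap)

lemma Lnorm_mono_AE: "0 < k \<Longrightarrow> AE z in M. g z \<le> h z \<Longrightarrow> Lnorm M k g \<le> Lnorm M k h"
  unfolding Lnorm_def
  by (intro enn_powr_mono nn_integral_mono_AE) (auto elim!: eventually_mono intro: enn_powr_mono)

lemma Lnorm_mono: "0 < k \<Longrightarrow> (\<And>z. g z \<le> h z) \<Longrightarrow> Lnorm M k g \<le> Lnorm M k h"
  by (rule Lnorm_mono_AE) auto

lemma Lnorm_enn_powr:
  "0 < k \<Longrightarrow> 0 < t \<Longrightarrow> Lnorm M k (\<lambda>z. enn_powr (g z) t) = enn_powr (Lnorm M (k * t) g) t"
  by (simp add: Lnorm_def enn_powr_enn_powr mult.commute)

lemma Lnorm_cmult: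
  assumes "0 < k" "g \<in> borel_measurable M"
  shows "Lnorm M k (\<lambda>z. c * g z) = c * Lnorm M k g"
  using assms by (simp add: Lnorm_def enn_powr_mult nn_integral_cmult enn_powr_enn_powr)

lemma Lnorm_const: "0 < k \<Longrightarrow> emeasure M (space M) = 1 \<Longrightarrow> Lnorm M k (\<lambda>z. c) = c"
  by (simp add: Lnorm_def enn_powr_enn_powr)

lemma Lnorm_zero [simp]: "Lnorm M k (\<lambda>z. 0) = 0"
  by (simp add: Lnorm_def)

lemma Lnorm_eq_0_iff:
  assumes "0 < k" "g \<in> borel_measurable M"
  shows "Lnorm M k g = 0 \<longleftrightarrow> (AE z in M. g z = 0)"
  using assms by (simp add: Lnorm_def nn_integral_0_iff_AE)

lemma Lnorm_finite_AE:
  assumes "0 < k" "g \<in> borel_measurable M" "Lnorm M k g < top"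
  shows "AE z in M. g z < top"
proof -
  have "(\<integral>\<^sup>+z. enn_powr (g z) k \<partial>M) \<noteq> \<infinity>" using assms by (simp add: Lnorm_def less_top)
  then have "AE z in M. enn_powr (g z) k \<noteq> \<infinity>"
    using assms by (intro nn_integral_PInf_AE) auto
  then show ?thesis by eventually_elim (simp add: less_top)
qed

lemma Lnorm_SUP:
  fixes g :: "nat \<Rightarrow> 'a \<Rightarrow> ennreal"
  assumes k: "0 < k" and [measurable]: "\<And>i. g i \<in> borel_measurable M" and inc: "incseq g"
  shows "Lnorm M k (\<lambda>z. SUP i. g i z) = (SUP i. Lnorm M k (g i))"
proof -
  have "incseq (\<lambda>i z. enn_powr (g i z) k)"
    using inc k by (auto simp: incseq_def le_fun_def intro: enn_powr_mono)
  then have "(\<integral>\<^sup>+z. (SUP i. enn_powr (g i z) k) \<partial>M) = (SUP i. \<integral>\<^sup>+z. enn_powr (g i z) k \<partial>M)"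
    using k by (intro nn_integral_monotone_convergence_SUP) auto
  then show ?thesis using k by (simp add: Lnorm_def enn_powr_SUP)
qed

lemma Lnorm_dominated_0:
  assumes k: "0 < k" and [measurable]: "\<And>i. w i \<in> borel_measurable M" "g \<in> borel_measurable M"
    and dom: "\<And>i. AE z in M. w i z \<le> g z" and fin: "Lnorm M k g < top"
    and lim: "AE z in M. (\<lambda>i. w i z) \<longlonglongrightarrow> 0"
  shows "(\<lambda>i. Lnorm M k (w i)) \<longlonglongrightarrow> 0"
proof -
  have "(\<lambda>i. \<integral>\<^sup>+z. enn_powr (w i z) k \<partial>M) \<longlonglongrightarrow> (\<integral>\<^sup>+z. 0 \<partial>M)"
  proof (rule nn_integral_dominated_convergence[where w = "\<lambda>z. enn_powr (g z) k"])
    show "AE z in M. enn_powr (w j z) k \<le> enn_powr (g z) k" for j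
      using dom[of j] by eventually_elim (use k in \<open>auto intro: enn_powr_mono\<close>)
    show "(\<integral>\<^sup>+z. enn_powr (g z) k \<partial>M) < \<infinity>" using fin by (simp add: Lnorm_def)
    show "AE z in M. (\<lambda>i. enn_powr (w i z) k) \<longlonglongrightarrow> 0"
      using lim by eventually_elim (use k in \<open>auto intro: tendsto_enn_powr_0\<close>)
  qed (use k in measurable)
  then show ?thesis using k unfolding Lnorm_def by (intro tendsto_enn_powr_0) auto
qed

text \<open>Minkowski's inequality: the weights \<open>a, b\<close> of the pointwise estimate are taken slightly above the two norms,
  which avoids a case distinction for norms equal to zero.\<close>

lemma Lnorm_add_le:
  assumes k: "1 \<le> k" and [measurable]: "f \<in> borel_measurable M" "g \<in> borel_measurable M"
  shows "Lnorm M k (\<lambda>z. f z + g z) \<le> Lnorm M k f + Lnorm M k g"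
proof (rule ennreal_le_epsilon)
  fix e :: real assume e: "0 < e" and "Lnorm M k f + Lnorm M k g < top"
  then obtain x y where x: "Lnorm M k f = ennreal x" "0 \<le> x" and y: "Lnorm M k g = ennreal y" "0 \<le> y"
    by (cases "Lnorm M k f"; cases "Lnorm M k g") auto
  define a b where "a = x + e/2" and "b = y + e/2"
  have a: "0 < a" "Lnorm M k f \<le> ennreal a" and b: "0 < b" "Lnorm M k g \<le> ennreal b"
    using x y e by (auto simp: a_def b_def)
  let ?C = "ennreal ((a+b) powr (k-1))"
  have "(\<integral>\<^sup>+z. enn_powr (f z + g z) k \<partial>M)
      \<le> (\<integral>\<^sup>+z. ?C * (ennreal (a powr (1-k)) * enn_powr (f z) k + ennreal (b powr (1-k)) * enn_powr (g z) k) \<partial>M)"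
    using a b by (intro nn_integral_mono powr_add_le_weighted k)
  also have "\<dots> = ?C * (ennreal (a powr (1-k)) * (\<integral>\<^sup>+z. enn_powr (f z) k \<partial>M)
                 + ennreal (b powr (1-k)) * (\<integral>\<^sup>+z. enn_powr (g z) k \<partial>M))"
    using k by (simp add: nn_integral_cmult nn_integral_add)
  also have "\<dots> \<le> ?C * (ennreal (a powr (1-k)) * ennreal (a powr k) + ennreal (b powr (1-k)) * ennreal (b powr k))"
    using a b k by (intro mult_left_mono add_mono) (auto simp: Lnorm_le_iff)
  also have "\<dots> = enn_powr (ennreal (a + b)) k"
    using a b by (simp add: powr_diff flip: ennreal_mult ennreal_plus powr_add)
  finally have "Lnorm M k (\<lambda>z. f z + g z) \<le> ennreal (a + b)"
    using k by (simp add: Lnorm_le_iff)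
  also have "ennreal (a + b) = Lnorm M k f + Lnorm M k g + ennreal e"
    using x y e by (simp add: a_def b_def flip: ennreal_plus)
  finally show "Lnorm M k (\<lambda>z. f z + g z) \<le> Lnorm M k f + Lnorm M k g + ennreal e" .
qed

text \<open>The reverse inequality for \<open>k \<le> 1\<close> uses the concave estimate with the norms themselves as weights. Norms equal
  to \<open>0\<close> or \<open>\<infinity>\<close> reduce to monotonicity.\<close>

lemma Lnorm_add_ge:
  assumes k: "0 < k" "k \<le> 1" and [measurable]: "f \<in> borel_measurable M" "g \<in> borel_measurable M"
  shows "Lnorm M k f + Lnorm M k g \<le> Lnorm M k (\<lambda>z. f z + g z)"
proof -
  have mono: "Lnorm M k f \<le> Lnorm M k (\<lambda>z. f z + g z)" "Lnorm M k g \<le> Lnorm M k (\<lambda>z. f z + g z)"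
    using k by (auto intro!: Lnorm_mono)
  show ?thesis
  proof (cases "Lnorm M k f \<in> {0, top} \<or> Lnorm M k g \<in> {0, top}")
    case True
    then show ?thesis using mono by (auto simp: top_unique)
  next
    case False
    then obtain a b where a: "Lnorm M k f = ennreal a" "0 < a" and b: "Lnorm M k g = ennreal b" "0 < b"
      by (cases "Lnorm M k f"; cases "Lnorm M k g") (auto simp: less_le)
    let ?C = "ennreal ((a+b) powr (k-1))"
    have "enn_powr (ennreal (a + b)) k
        = ?C * (ennreal (a powr (1-k)) * ennreal (a powr k) + ennreal (b powr (1-k)) * ennreal (b powr k))"
      using a b by (simp add: powr_diff flip: ennreal_mult ennreal_plus powr_add)
    also have "\<dots> = ?C * (ennreal (a powr (1-k)) * (\<integral>\<^sup>+z. enn_powr (f z) k \<partial>M)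
                   + ennreal (b powr (1-k)) * (\<integral>\<^sup>+z. enn_powr (g z) k \<partial>M))"
      using a b k by (simp flip: enn_powr_Lnorm)
    also have "\<dots> = (\<integral>\<^sup>+z. ?C * (ennreal (a powr (1-k)) * enn_powr (f z) k + ennreal (b powr (1-k)) * enn_powr (g z) k) \<partial>M)"
      using k by (simp add: nn_integral_cmult nn_integral_add)
    also have "\<dots> \<le> (\<integral>\<^sup>+z. enn_powr (f z + g z) k \<partial>M)"
      using a b by (intro nn_integral_mono powr_add_ge_weighted k)
    finally have "ennreal (a + b) \<le> Lnorm M k (\<lambda>z. f z + g z)"
      using k by (simp add: le_Lnorm_iff)
    then show ?thesis using a b by (simp flip: ennreal_plus)
  qed
qed

lemma Lnorm_sum_le:
  assumes k: "1 \<le> k" and m: "\<And>i. i \<in> I \<Longrightarrow> f i \<in> borel_measurable M"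
  shows "Lnorm M k (\<lambda>z. \<Sum>i\<in>I. f i z) \<le> (\<Sum>i\<in>I. Lnorm M k (f i))"
  using m
proof (induction I rule: infinite_finite_induct)
  case (insert i I)
  have "Lnorm M k (\<lambda>z. \<Sum>i\<in>insert i I. f i z) = Lnorm M k (\<lambda>z. f i z + (\<Sum>i\<in>I. f i z))"
    using insert by simp
  also have "\<dots> \<le> Lnorm M k (f i) + Lnorm M k (\<lambda>z. \<Sum>i\<in>I. f i z)"
    using insert by (intro Lnorm_add_le k borel_measurable_sum) auto
  finally show ?case using insert by (auto intro: order_trans add_left_mono)
qed auto

lemma Lnorm_sum_ge:
  assumes k: "0 < k" "k \<le> 1" and m: "\<And>i. i \<in> I \<Longrightarrow> f i \<in> borel_measurable M"
  shows "(\<Sum>i\<in>I. Lnorm M k (f i)) \<le> Lnorm M k (\<lambda>z. \<Sum>i\<in>I. f i z)"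
  using m
proof (induction I rule: infinite_finite_induct)
  case (insert i I)
  have "Lnorm M k (f i) + Lnorm M k (\<lambda>z. \<Sum>i\<in>I. f i z) \<le> Lnorm M k (\<lambda>z. f i z + (\<Sum>i\<in>I. f i z))"
    using insert by (intro Lnorm_add_ge k borel_measurable_sum) auto
  then show ?case using insert by (auto intro: order_trans[rotated] add_left_mono)
qed auto

lemma Lnorm_exponent_mono:
  assumes j: "0 < j" "j \<le> k" and M: "emeasure M (space M) = 1" and [measurable]: "g \<in> borel_measurable M"
  shows "Lnorm M j g \<le> Lnorm M k g"
proof -
  have k: "0 < k" using j by simp
  define th where "th = j / k"
  have th: "0 < th" "th \<le> 1" using j by (auto simp: th_def)
  let ?I = "\<integral>\<^sup>+z. enn_powr (g z) k \<partial>M"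
  have "enn_powr (\<integral>\<^sup>+z. enn_powr (g z) j \<partial>M) (1/th) \<le> a" if "?I < a" for a
  proof (cases a)
    case (real b)
    with that have b: "0 < b" by (auto simp: less_le)
    \<comment> \<open>Young's inequality bounds \<open>h powr th\<close> by its tangent at \<open>h = b\<close>.\<close>
    have tangent: "enn_powr t th \<le> ennreal (b powr th * (1 - th)) + ennreal (b powr th * th / b) * t" for t
    proof (cases t)
      case (real x)
      have "x powr th \<le> b powr th * (1 - th) + b powr th * th / b * x"
      proof (cases "x = 0")
        case False
        then have "(x/b) powr th * 1 powr (1 - th) \<le> th * (x/b) + (1 - th) * 1"
          using real b th by (intro Youngs_inequality_0) auto
        then have "b powr th * (x/b) powr th \<le> b powr th * (th * (x/b) + (1 - th))"
          by (intro mult_left_mono) auto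
        moreover have "b powr th * (x/b) powr th = x powr th"
          using b real by (simp flip: powr_mult)
        ultimately show ?thesis by (simp add: algebra_simps)
      qed (use th b in auto)
      then show ?thesis using real b th by (simp flip: ennreal_mult ennreal_plus)
    next
      case top
      then show ?thesis using b th by (simp add: ennreal_mult_top)
    qed
    have "(\<integral>\<^sup>+z. enn_powr (g z) j \<partial>M) = (\<integral>\<^sup>+z. enn_powr (enn_powr (g z) k) th \<partial>M)"
      using k by (simp add: enn_powr_enn_powr th_def)
    also have "\<dots> \<le> (\<integral>\<^sup>+z. ennreal (b powr th * (1 - th)) + ennreal (b powr th * th / b) * enn_powr (g z) k \<partial>M)"
      by (intro nn_integral_mono tangent)
    also have "\<dots> = ennreal (b powr th * (1 - th)) + ennreal (b powr th * th / b) * ?I"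
      using k M by (simp add: nn_integral_add nn_integral_cmult)
    also have "\<dots> \<le> ennreal (b powr th * (1 - th)) + ennreal (b powr th * th / b) * ennreal b"
      using that real by (intro add_mono mult_left_mono) auto
    also have "\<dots> = enn_powr a th"
      using b th real by (simp add: algebra_simps flip: ennreal_mult ennreal_plus)
    finally show ?thesis using th by (simp add: enn_powr_le_swap)
  qed (auto)
  then have "enn_powr (\<integral>\<^sup>+z. enn_powr (g z) j \<partial>M) (1/th) \<le> ?I" by (rule dense_ge)
  then have "enn_powr (enn_powr (\<integral>\<^sup>+z. enn_powr (g z) j \<partial>M) (1/th)) (1/k) \<le> enn_powr ?I (1/k)"
    using k by (intro enn_powr_mono) auto
  then show ?thesis using j k by (simp add: Lnorm_def enn_powr_enn_powr th_def)
qed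

lemma borel_measurable_Lnorm [measurable (raw)]:
  assumes "sigma_finite_measure M" "0 < k" "case_prod g \<in> borel_measurable (N \<Otimes>\<^sub>M M)"
  shows "(\<lambda>x. Lnorm M k (g x)) \<in> borel_measurable N"
proof -
  interpret sigma_finite_measure M by fact
  have "(\<lambda>z. enn_powr (case_prod g z) k) \<in> borel_measurable (N \<Otimes>\<^sub>M M)"
    using assms by measurable
  then have "(\<lambda>x. \<integral>\<^sup>+y. enn_powr (g x y) k \<partial>M) \<in> borel_measurable N"
    by (intro borel_measurable_nn_integral) (simp add: case_prod_beta')
  moreover have "0 < 1 / k" using assms by simp
  ultimately show ?thesis unfolding Lnorm_def by measurable
qed

section \<open>The mixed norm\<close>

text \<open>Lebesgue measure on the unit interval, as a measure on all Borel sets of the line: functions of one or two real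
  variables are then simply Borel functions, and the sections of a Borel function are Borel.\<close>

definition unit_measure :: "real measure" where
  "unit_measure = density lborel (indicator {0..1})"

lemma sets_unit_measure [simp, measurable_cong]: "sets unit_measure = sets borel"
  by (simp add: unit_measure_def)

lemma space_unit_measure [simp]: "space unit_measure = UNIV"
  by (simp add: unit_measure_def)

lemma borel_measurable_unit_measure [simp]: "borel_measurable unit_measure = borel_measurable borel"
  by (rule measurable_cong_sets) simp_all

lemma emeasure_unit_measure [simp]: "emeasure unit_measure UNIV = 1"
  by (simp add: unit_measure_def emeasure_density)

interpretation unit_measure: finite_measure unit_measure
  by standard simp

interpretation unit_square: pair_sigma_finite unit_measure unit_measure ..

lemma nn_integral_unit_measure:
  "f \<in> borel_measurable borel \<Longrightarrow> (\<integral>\<^sup>+x. f x \<partial>unit_measure) = (\<integral>\<^sup>+x. f x * indicator {0..1} x \<partial>lborel)"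
  by (simp add: unit_measure_def nn_integral_density mult.commute)

definition mixed_norm :: "real \<Rightarrow> real \<Rightarrow> (real \<times> real \<Rightarrow> ennreal) \<Rightarrow> ennreal" where
  "mixed_norm s r g = Lnorm unit_measure s (\<lambda>x. Lnorm unit_measure r (\<lambda>y. g (x, y)))"

abbreviation unit_square_measure :: "(real \<times> real) measure" where
  "unit_square_measure \<equiv> unit_measure \<Otimes>\<^sub>M unit_measure"

lemma borel_prod_unit: "borel_measurable unit_square_measure = borel_measurable borel"
  by (intro measurable_cong_sets) (simp_all add: borel_prod[symmetric] cong: sets_pair_measure_cong)

lemma measurable_section [measurable (raw)]:
  "g \<in> borel_measurable borel \<Longrightarrow> (\<lambda>y. g (x, y)) \<in> borel_measurable borel" for x :: real and g :: "real \<times> real \<Rightarrow> _"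
  by (rule measurable_compose[of "Pair x" borel borel]) (auto intro: borel_measurable_continuous_onI continuous_intros)

lemma measurable_inner_norm [measurable (raw), simp]:
  "0 < r \<Longrightarrow> g \<in> borel_measurable borel \<Longrightarrow>
     (\<lambda>x. Lnorm unit_measure r (\<lambda>y. g (x, y))) \<in> borel_measurable borel" for g :: "real \<times> real \<Rightarrow> _"
  using borel_measurable_Lnorm[of unit_measure r "\<lambda>x y. g (x, y)" unit_measure]
  by (simp add: unit_measure.sigma_finite_measure_axioms borel_prod_unit case_prod_beta')

lemma AE_sections: "AE z in unit_square_measure. P z \<Longrightarrow> AE x in unit_measure. AE y in unit_measure. P (x, y)"
  by (rule unit_square.AE_pair)

lemma mixed_norm_mono_AE:
  assumes "0 < s" "0 < r" "AE z in unit_square_measure. g z \<le> h z"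
  shows "mixed_norm s r g \<le> mixed_norm s r h"
  using AE_sections[OF assms(3)] assms(1,2) unfolding mixed_norm_def
  by (intro Lnorm_mono_AE) (auto elim!: eventually_mono intro!: Lnorm_mono_AE)

lemma mixed_norm_mono:
  "0 < s \<Longrightarrow> 0 < r \<Longrightarrow> (\<And>z. g z \<le> h z) \<Longrightarrow> mixed_norm s r g \<le> mixed_norm s r h"
  by (rule mixed_norm_mono_AE) auto

lemma mixed_norm_enn_powr:
  "0 < s \<Longrightarrow> 0 < r \<Longrightarrow> 0 < t \<Longrightarrow>
     mixed_norm s r (\<lambda>z. enn_powr (g z) t) = enn_powr (mixed_norm (s * t) (r * t) g) t"
  by (simp add: mixed_norm_def Lnorm_enn_powr)

lemma mixed_norm_cmult:
  fixes g :: "real \<times> real \<Rightarrow> ennreal"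
  assumes "0 < s" "0 < r" and [measurable]: "g \<in> borel_measurable borel"
  shows "mixed_norm s r (\<lambda>z. c * g z) = c * mixed_norm s r g"
  using assms by (simp add: mixed_norm_def Lnorm_cmult)

lemma mixed_norm_zero [simp]: "mixed_norm s r (\<lambda>z. 0) = 0"
  by (simp add: mixed_norm_def)

lemma mixed_norm_SUP:
  fixes g :: "nat \<Rightarrow> real \<times> real \<Rightarrow> ennreal"
  assumes sr: "0 < s" "0 < r" and [measurable]: "\<And>i. g i \<in> borel_measurable borel" and inc: "incseq g"
  shows "mixed_norm s r (\<lambda>z. SUP i. g i z) = (SUP i. mixed_norm s r (g i))"
proof -
  have "Lnorm unit_measure r (\<lambda>y. SUP i. g i (x, y)) = (SUP i. Lnorm unit_measure r (\<lambda>y. g i (x, y)))" for x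
    using inc sr by (intro Lnorm_SUP) (auto simp: incseq_def le_fun_def)
  moreover have "incseq (\<lambda>i x. Lnorm unit_measure r (\<lambda>y. g i (x, y)))"
    using inc sr by (auto simp: incseq_def le_fun_def intro!: Lnorm_mono)
  ultimately show ?thesis
    using sr unfolding mixed_norm_def by (simp add: Lnorm_SUP)
qed

lemma mixed_norm_sum_le:
  fixes f :: "'i \<Rightarrow> real \<times> real \<Rightarrow> ennreal"
  assumes k: "1 \<le> s" "1 \<le> r" and [measurable]: "\<And>i. f i \<in> borel_measurable borel"
  shows "mixed_norm s r (\<lambda>z. \<Sum>i\<in>I. f i z) \<le> (\<Sum>i\<in>I. mixed_norm s r (f i))"
proof -
  have "mixed_norm s r (\<lambda>z. \<Sum>i\<in>I. f i z)
      \<le> Lnorm unit_measure s (\<lambda>x. \<Sum>i\<in>I. Lnorm unit_measure r (\<lambda>y. f i (x, y)))"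
    using k unfolding mixed_norm_def by (intro Lnorm_mono Lnorm_sum_le) auto
  also have "\<dots> \<le> (\<Sum>i\<in>I. mixed_norm s r (f i))"
    using k unfolding mixed_norm_def by (intro Lnorm_sum_le) auto
  finally show ?thesis .
qed

lemma mixed_norm_sum_ge:
  fixes f :: "'i \<Rightarrow> real \<times> real \<Rightarrow> ennreal"
  assumes k: "0 < s" "s \<le> 1" "0 < r" "r \<le> 1" and [measurable]: "\<And>i. f i \<in> borel_measurable borel"
  shows "(\<Sum>i\<in>I. mixed_norm s r (f i)) \<le> mixed_norm s r (\<lambda>z. \<Sum>i\<in>I. f i z)"
proof -
  have "(\<Sum>i\<in>I. mixed_norm s r (f i))
      \<le> Lnorm unit_measure s (\<lambda>x. \<Sum>i\<in>I. Lnorm unit_measure r (\<lambda>y. f i (x, y)))"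
    using k unfolding mixed_norm_def by (intro Lnorm_sum_ge) auto
  also have "\<dots> \<le> mixed_norm s r (\<lambda>z. \<Sum>i\<in>I. f i z)"
    using k unfolding mixed_norm_def by (intro Lnorm_mono Lnorm_sum_ge) auto
  finally show ?thesis .
qed

lemma mixed_norm_exponent_mono:
  fixes g :: "real \<times> real \<Rightarrow> ennreal"
  assumes "0 < s'" "s' \<le> s" "0 < r'" "r' \<le> r" and [measurable]: "g \<in> borel_measurable borel"
  shows "mixed_norm s' r' g \<le> mixed_norm s r g"
proof -
  have "mixed_norm s' r' g \<le> mixed_norm s' r g"
    using assms unfolding mixed_norm_def by (intro Lnorm_mono Lnorm_exponent_mono) auto
  also have "\<dots> \<le> mixed_norm s r g"
    using assms unfolding mixed_norm_def by (intro Lnorm_exponent_mono) auto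
  finally show ?thesis .
qed

lemma mixed_norm_eq_0_iff:
  fixes g :: "real \<times> real \<Rightarrow> ennreal"
  assumes "0 < s" "0 < r" and [measurable]: "g \<in> borel_measurable borel"
  shows "mixed_norm s r g = 0 \<longleftrightarrow> (AE z in unit_square_measure. g z = 0)"
proof -
  have "mixed_norm s r g = 0 \<longleftrightarrow> (AE x in unit_measure. AE y in unit_measure. g (x, y) = 0)"
    using assms by (simp add: mixed_norm_def Lnorm_eq_0_iff)
  also have "\<dots> \<longleftrightarrow> (AE z in unit_square_measure. g z = 0)"
  proof -
    have "{z \<in> space unit_square_measure. g (fst z, snd z) = 0} \<in> sets unit_square_measure"
      using assms(3)[folded borel_prod_unit] by measurable
    from unit_square.AE_pair_iff[OF this] show ?thesis by simp
  qed
  finally show ?thesis .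
qed

lemma mixed_norm_finite_AE:
  fixes g :: "real \<times> real \<Rightarrow> ennreal"
  assumes "0 < s" "0 < r" and [measurable]: "g \<in> borel_measurable borel" and "mixed_norm s r g < top"
  shows "AE z in unit_square_measure. g z < top"
proof (rule unit_square.AE_pair_measure)
  show "{x \<in> space unit_square_measure. g x < top} \<in> sets unit_square_measure"
    using assms(3)[folded borel_prod_unit] by measurable
  have "AE x in unit_measure. Lnorm unit_measure r (\<lambda>y. g (x, y)) < top"
    using assms unfolding mixed_norm_def by (intro Lnorm_finite_AE[of s]) auto
  then show "AE x in unit_measure. AE y in unit_measure. g (x, y) < top"
    by eventually_elim (rule Lnorm_finite_AE[of r], use assms in auto)
qed

text \<open>Dominated convergence is applied first on almost every section, and then to the norms of the sections.\<close>

lemma mixed_norm_dominated_0: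
  fixes w :: "nat \<Rightarrow> real \<times> real \<Rightarrow> ennreal"
  assumes sr: "0 < s" "0 < r"
    and [measurable]: "\<And>i. w i \<in> borel_measurable borel" "g \<in> borel_measurable borel"
    and dom: "\<And>i z. w i z \<le> g z" and fin: "mixed_norm s r g < top"
    and lim: "AE z in unit_square_measure. (\<lambda>i. w i z) \<longlonglongrightarrow> 0"
  shows "(\<lambda>i. mixed_norm s r (w i)) \<longlonglongrightarrow> 0"
proof -
  have "AE x in unit_measure. Lnorm unit_measure r (\<lambda>y. g (x, y)) < top"
    using sr fin unfolding mixed_norm_def by (intro Lnorm_finite_AE[of s]) auto
  with AE_sections[OF lim]
  have "AE x in unit_measure. (\<lambda>i. Lnorm unit_measure r (\<lambda>y. w i (x, y))) \<longlonglongrightarrow> 0"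
    by eventually_elim
      (rule Lnorm_dominated_0[where g = "\<lambda>y. g (_, y)"], use sr dom in auto)
  moreover have "AE x in unit_measure. Lnorm unit_measure r (\<lambda>y. w i (x, y)) \<le> Lnorm unit_measure r (\<lambda>y. g (x, y))" for i
    using sr dom by (intro AE_I2 Lnorm_mono) auto
  ultimately show ?thesis
    using sr fin unfolding mixed_norm_def
    by (intro Lnorm_dominated_0[where g = "\<lambda>x. Lnorm unit_measure r (\<lambda>y. g (x, y))"]) auto
qed

section \<open>Khinchine's inequalities\<close>

text \<open>A choice of signs on a finite index set \<open>I\<close> is encoded by the set \<open>A \<subseteq> I\<close> of the indices with
  sign \<open>+1\<close>, so that averages over signs are sums over \<open>Pow I\<close>.\<close>

definition sgn_of :: "nat set \<Rightarrow> nat \<Rightarrow> real" where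
  "sgn_of A i = (if i \<in> A then 1 else -1)"

lemma sum_Pow_insert:
  fixes h :: "'i set \<Rightarrow> 'b::comm_monoid_add"
  assumes "finite I" "i \<notin> I"
  shows "(\<Sum>A\<in>Pow (insert i I). h A) = (\<Sum>A\<in>Pow I. h A + h (insert i A))"
proof -
  have "inj_on (insert i) (Pow I)" using assms by (intro inj_onI) (auto simp: subset_iff)
  moreover have "Pow I \<inter> insert i ` Pow I = {}" using assms by auto
  ultimately show ?thesis
    using assms by (simp add: Pow_insert sum.union_disjoint sum.reindex sum.distrib)
qed

lemma sign_sum_insert:
  fixes a :: "nat \<Rightarrow> 'k::real_vector"
  assumes "finite I" "i \<notin> I" "A \<subseteq> I"
  shows "(\<Sum>j\<in>insert i I. sgn_of A j *\<^sub>R a j) = (\<Sum>j\<in>I. sgn_of A j *\<^sub>R a j) - a i"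
    and "(\<Sum>j\<in>insert i I. sgn_of (insert i A) j *\<^sub>R a j) = (\<Sum>j\<in>I. sgn_of A j *\<^sub>R a j) + a i"
proof -
  have "(\<Sum>j\<in>I. sgn_of (insert i A) j *\<^sub>R a j) = (\<Sum>j\<in>I. sgn_of A j *\<^sub>R a j)"
    using assms by (intro sum.cong) (auto simp: sgn_of_def)
  moreover have "i \<notin> A" using assms by auto
  ultimately show "(\<Sum>j\<in>insert i I. sgn_of A j *\<^sub>R a j) = (\<Sum>j\<in>I. sgn_of A j *\<^sub>R a j) - a i"
    "(\<Sum>j\<in>insert i I. sgn_of (insert i A) j *\<^sub>R a j) = (\<Sum>j\<in>I. sgn_of A j *\<^sub>R a j) + a i"
    using assms by (auto simp: sgn_of_def)
qed

lemma sum_Pow_exp: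
  fixes a :: "nat \<Rightarrow> real"
  assumes "finite I"
  shows "(\<Sum>A\<in>Pow I. exp (\<Sum>i\<in>I. sgn_of A i *\<^sub>R a i)) = (\<Prod>i\<in>I. exp (a i) + exp (- a i))"
  using assms
proof (induction I)
  case (insert i I)
  have "(\<Sum>A\<in>Pow (insert i I). exp (\<Sum>j\<in>insert i I. sgn_of A j *\<^sub>R a j))
      = (\<Sum>A\<in>Pow I. exp ((\<Sum>j\<in>I. sgn_of A j *\<^sub>R a j) - a i) + exp ((\<Sum>j\<in>I. sgn_of A j *\<^sub>R a j) + a i))"
    unfolding sum_Pow_insert[OF insert.hyps]
    by (intro sum.cong refl) (simp only: PowD sign_sum_insert[OF insert.hyps PowD])
  also have "\<dots> = (exp (a i) + exp (- a i)) * (\<Sum>A\<in>Pow I. exp (\<Sum>j\<in>I. sgn_of A j *\<^sub>R a j))"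
    by (simp add: sum_distrib_left exp_add exp_diff exp_minus field_simps)
  finally show ?case using insert by simp
qed simp

lemma sum_Pow_norm2:
  fixes a :: "nat \<Rightarrow> 'k::real_inner"
  assumes "finite I"
  shows "(\<Sum>A\<in>Pow I. (norm (\<Sum>i\<in>I. sgn_of A i *\<^sub>R a i))\<^sup>2) = 2 ^ card I * (\<Sum>i\<in>I. (norm (a i))\<^sup>2)"
  using assms
proof (induction I)
  case (insert i I)
  have "(\<Sum>A\<in>Pow (insert i I). (norm (\<Sum>j\<in>insert i I. sgn_of A j *\<^sub>R a j))\<^sup>2)
      = (\<Sum>A\<in>Pow I. (norm ((\<Sum>j\<in>I. sgn_of A j *\<^sub>R a j) - a i))\<^sup>2 + (norm ((\<Sum>j\<in>I. sgn_of A j *\<^sub>R a j) + a i))\<^sup>2)"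
    unfolding sum_Pow_insert[OF insert.hyps]
    by (intro sum.cong refl) (simp only: PowD sign_sum_insert[OF insert.hyps PowD])
  also have "\<dots> = (\<Sum>A\<in>Pow I. 2 * (norm (\<Sum>j\<in>I. sgn_of A j *\<^sub>R a j))\<^sup>2 + 2 * (norm (a i))\<^sup>2)"
    by (intro sum.cong refl) (simp add: power2_norm_eq_inner algebra_simps inner_commute)
  also have "\<dots> = 2 * (\<Sum>A\<in>Pow I. (norm (\<Sum>j\<in>I. sgn_of A j *\<^sub>R a j))\<^sup>2) + 2 ^ card I * (2 * (norm (a i))\<^sup>2)"
    using insert by (simp add: sum.distrib card_Pow flip: sum_distrib_left)
  finally show ?case using insert by (simp add: algebra_simps)
qed simp

text \<open>A weak form of \<open>cosh x \<le> exp (x\<^sup>2 / 2)\<close>, enough for a subgaussian bound.\<close>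

lemma exp_add_exp_minus_le:
  fixes x :: real
  assumes "\<bar>x\<bar> \<le> 1"
  shows "exp x + exp (- x) \<le> 2 * exp (x\<^sup>2)"
proof -
  have *: "exp y + exp (- y) \<le> 2 * exp (y\<^sup>2)" if "0 \<le> y" "y \<le> 1" for y :: real
  proof -
    have "exp y \<le> 1 + y + y\<^sup>2" using that by (intro exp_bound) auto
    moreover have "exp (- y) \<le> 1 - y + y\<^sup>2"
    proof -
      have "1 \<le> (1 + y) * (1 - y + y\<^sup>2)" using that by (simp add: algebra_simps power2_eq_square)
      also have "\<dots> \<le> exp y * (1 - y + y\<^sup>2)"
        using that by (intro mult_right_mono exp_ge_add_one_self) auto
      finally show ?thesis by (simp add: exp_minus field_simps)
    qed
    moreover have "1 + y\<^sup>2 \<le> exp (y\<^sup>2)" by (rule exp_ge_add_one_self)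
    ultimately show ?thesis by linarith
  qed
  show ?thesis
    using *[of x] *[of "-x"] assms by (cases "0 \<le> x") auto
qed

lemma powr_le_powr_times_exp:
  fixes z t :: real
  assumes "0 < t" "0 \<le> z"
  shows "z powr t \<le> t powr t * exp z"
proof -
  have "z / t \<le> exp (z / t)" using exp_ge_add_one_self[of "z/t"] by linarith
  then have "(z / t) powr t \<le> exp (z / t) powr t" using assms by (intro powr_mono2) auto
  also have "\<dots> = exp z" using assms by (simp add: exp_powr_real)
  finally show ?thesis using assms by (simp add: powr_divide field_simps)
qed

text \<open>All moments are controlled by the exponential moment, which factorises over the signs.\<close>

lemma khinchine_real_upper:
  fixes a :: "nat \<Rightarrow> real"
  assumes t: "0 < t" and I: "finite I"
  shows "(\<Sum>A\<in>Pow I. \<bar>\<Sum>i\<in>I. sgn_of A i *\<^sub>R a i\<bar> powr t)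
           \<le> 2 ^ card I * (2 * exp 1 * t powr t) * (\<Sum>i\<in>I. (a i)\<^sup>2) powr (t / 2)"
proof -
  define \<sigma> where "\<sigma> = sqrt (\<Sum>i\<in>I. (a i)\<^sup>2)"
  have \<sigma>2: "(\<Sum>i\<in>I. (a i)\<^sup>2) powr (t/2) = \<sigma> powr t" "\<sigma>\<^sup>2 = (\<Sum>i\<in>I. (a i)\<^sup>2)" "0 \<le> \<sigma>"
    by (auto simp: \<sigma>_def sum_nonneg powr_half_sqrt[symmetric] powr_powr) (simp add: powr_half_sqrt sum_nonneg)
  show ?thesis
  proof (cases "\<sigma> = 0")
    case True
    then have "\<forall>i\<in>I. a i = 0" using \<sigma>2 I by (simp add: sum_nonneg_eq_0_iff)
    then show ?thesis by simp
  next
    case False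
    with \<sigma>2 have pos: "0 < \<sigma>" by simp
    have exp_le: "(\<Sum>A\<in>Pow I. exp (\<Sum>i\<in>I. sgn_of A i *\<^sub>R b i)) \<le> 2 ^ card I * exp 1"
      if b: "\<And>i. (b i)\<^sup>2 = (a i / \<sigma>)\<^sup>2" for b
    proof -
      have s1: "(\<Sum>i\<in>I. (b i)\<^sup>2) = 1"
        using pos by (simp add: b power_divide \<sigma>2(2)[symmetric] flip: sum_divide_distrib)
      have b1: "\<bar>b i\<bar> \<le> 1" if "i \<in> I" for i
      proof -
        have "(b i)\<^sup>2 \<le> (\<Sum>i\<in>I. (b i)\<^sup>2)" using I that by (intro member_le_sum) auto
        then show ?thesis using s1 by (simp add: abs_square_le_1)
      qed
      have "(\<Prod>i\<in>I. exp (b i) + exp (- b i)) \<le> (\<Prod>i\<in>I. 2 * exp ((b i)\<^sup>2))"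
        using b1 by (intro prod_mono conjI exp_add_exp_minus_le) (auto intro: add_nonneg_nonneg)
      also have "\<dots> = 2 ^ card I * exp 1" using I s1 by (simp add: prod.distrib flip: exp_sum)
      finally show ?thesis by (simp only: sum_Pow_exp[OF I])
    qed
    have "(\<Sum>A\<in>Pow I. \<bar>\<Sum>i\<in>I. sgn_of A i *\<^sub>R (a i / \<sigma>)\<bar> powr t)
        \<le> (\<Sum>A\<in>Pow I. t powr t * (exp (\<Sum>i\<in>I. sgn_of A i *\<^sub>R (a i / \<sigma>)) + exp (\<Sum>i\<in>I. sgn_of A i *\<^sub>R (- a i / \<sigma>))))"
    proof (rule sum_mono)
      fix A
      let ?S = "\<Sum>i\<in>I. sgn_of A i *\<^sub>R (a i / \<sigma>)"
      have "\<bar>?S\<bar> powr t \<le> t powr t * exp \<bar>?S\<bar>" using t by (intro powr_le_powr_times_exp) auto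
      also have "exp \<bar>?S\<bar> \<le> exp ?S + exp (- ?S)" by (cases "0 \<le> ?S") auto
      also have "- ?S = (\<Sum>i\<in>I. sgn_of A i *\<^sub>R (- a i / \<sigma>))" by (simp add: sum_negf)
      finally show "\<bar>?S\<bar> powr t \<le> t powr t * (exp ?S + exp (\<Sum>i\<in>I. sgn_of A i *\<^sub>R (- a i / \<sigma>)))"
        by (simp add: mult_left_mono)
    qed
    also have "\<dots> = t powr t * ((\<Sum>A\<in>Pow I. exp (\<Sum>i\<in>I. sgn_of A i *\<^sub>R (a i / \<sigma>)))
        + (\<Sum>A\<in>Pow I. exp (\<Sum>i\<in>I. sgn_of A i *\<^sub>R (- a i / \<sigma>))))"
      by (simp add: sum_distrib_left sum.distrib distrib_left)
    also have "\<dots> \<le> t powr t * (2 ^ card I * exp 1 + 2 ^ card I * exp 1)"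
      by (intro mult_left_mono add_mono exp_le) auto
    finally have *: "(\<Sum>A\<in>Pow I. \<bar>\<Sum>i\<in>I. sgn_of A i *\<^sub>R (a i / \<sigma>)\<bar> powr t) \<le> t powr t * (2 ^ card I * exp 1 + 2 ^ card I * exp 1)" .
    have "(\<Sum>A\<in>Pow I. \<bar>\<Sum>i\<in>I. sgn_of A i *\<^sub>R a i\<bar> powr t)
        = (\<Sum>A\<in>Pow I. \<sigma> powr t * \<bar>\<Sum>i\<in>I. sgn_of A i *\<^sub>R (a i / \<sigma>)\<bar> powr t)"
    proof (rule sum.cong[OF refl])
      fix A
      have "(\<Sum>i\<in>I. sgn_of A i *\<^sub>R a i) = \<sigma> * (\<Sum>i\<in>I. sgn_of A i *\<^sub>R (a i / \<sigma>))"
        using pos by (simp add: sum_distrib_left)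
      then show "\<bar>\<Sum>i\<in>I. sgn_of A i *\<^sub>R a i\<bar> powr t = \<sigma> powr t * \<bar>\<Sum>i\<in>I. sgn_of A i *\<^sub>R (a i / \<sigma>)\<bar> powr t"
        using pos by (simp add: abs_mult powr_mult)
    qed
    also have "\<dots> \<le> \<sigma> powr t * (t powr t * (2 ^ card I * exp 1 + 2 ^ card I * exp 1))"
      unfolding sum_distrib_left[symmetric] by (intro mult_left_mono *) auto
    finally show ?thesis by (simp add: \<sigma>2 algebra_simps)
  qed
qed

text \<open>In a Euclidean space the scalar inequality is applied to each coordinate.\<close>

lemma khinchine_upper:
  assumes t: "0 < t"
  obtains K where "0 < K" "\<And>(I :: nat set) (a :: nat \<Rightarrow> 'k::euclidean_space). finite I \<Longrightarrow>
    (\<Sum>A\<in>Pow I. norm (\<Sum>i\<in>I. sgn_of A i *\<^sub>R a i) powr t) \<le> 2 ^ card I * K * (\<Sum>i\<in>I. (norm (a i))\<^sup>2) powr (t / 2)"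
proof -
  define D where "D = real DIM('k)"
  define C where "C = 2 * exp 1 * t powr t"
  have D: "1 \<le> D" by (simp add: D_def Suc_le_eq)
  have C: "0 < C" using t by (simp add: C_def)
  have norm_le: "norm x powr t \<le> D powr t * (\<Sum>b\<in>Basis. \<bar>x \<bullet> b\<bar> powr t)" for x :: 'k
  proof -
    obtain b where b: "b \<in> Basis" "\<And>c. c \<in> Basis \<Longrightarrow> \<bar>x \<bullet> c\<bar> \<le> \<bar>x \<bullet> b\<bar>"
    proof -
      have "Max ((\<lambda>c. \<bar>x \<bullet> c\<bar>) ` Basis) \<in> (\<lambda>c. \<bar>x \<bullet> c\<bar>) ` Basis" by (intro Max_in) auto
      then obtain b where "b \<in> Basis" "\<bar>x \<bullet> b\<bar> = Max ((\<lambda>c. \<bar>x \<bullet> c\<bar>) ` Basis)" by force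
      then show ?thesis by (intro that[of b]) auto
    qed
    have "norm x \<le> (\<Sum>c\<in>Basis. \<bar>x \<bullet> c\<bar>)" by (rule norm_le_l1)
    also have "\<dots> \<le> D * \<bar>x \<bullet> b\<bar>" unfolding D_def by (intro sum_bounded_above b)
    finally have "norm x powr t \<le> (D * \<bar>x \<bullet> b\<bar>) powr t" using t by (intro powr_mono2) auto
    also have "\<dots> = D powr t * \<bar>x \<bullet> b\<bar> powr t" using D by (simp add: powr_mult)
    also have "\<dots> \<le> D powr t * (\<Sum>b\<in>Basis. \<bar>x \<bullet> b\<bar> powr t)"
      using b by (intro mult_left_mono member_le_sum) auto
    finally show ?thesis .
  qed
  show thesis
  proof (rule that[of "D powr t * D * C"])
    show "0 < D powr t * D * C" using C D by simp
    fix I :: "nat set" and a :: "nat \<Rightarrow> 'k" assume I: "finite I"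
    let ?s = "\<Sum>i\<in>I. (norm (a i))\<^sup>2"
    have comp: "(\<Sum>A\<in>Pow I. \<bar>(\<Sum>i\<in>I. sgn_of A i *\<^sub>R a i) \<bullet> b\<bar> powr t) \<le> 2 ^ card I * C * ?s powr (t/2)"
      if "b \<in> Basis" for b
    proof -
      have "(\<Sum>A\<in>Pow I. \<bar>(\<Sum>i\<in>I. sgn_of A i *\<^sub>R a i) \<bullet> b\<bar> powr t)
          = (\<Sum>A\<in>Pow I. \<bar>\<Sum>i\<in>I. sgn_of A i *\<^sub>R (a i \<bullet> b)\<bar> powr t)"
        by (simp add: inner_sum_left)
      also have "\<dots> \<le> 2 ^ card I * C * (\<Sum>i\<in>I. (a i \<bullet> b)\<^sup>2) powr (t/2)"
        unfolding C_def by (rule khinchine_real_upper[OF t I])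
      also have "\<dots> \<le> 2 ^ card I * C * ?s powr (t/2)"
      proof -
        have "(a i \<bullet> b)\<^sup>2 \<le> (norm (a i))\<^sup>2" for i
          using Basis_le_norm[OF that, of "a i"] by (simp add: abs_le_square_iff[symmetric])
        then show ?thesis using C t by (intro mult_left_mono powr_mono2 sum_mono sum_nonneg) auto
      qed
      finally show ?thesis .
    qed
    have "(\<Sum>A\<in>Pow I. norm (\<Sum>i\<in>I. sgn_of A i *\<^sub>R a i) powr t)
        \<le> (\<Sum>A\<in>Pow I. D powr t * (\<Sum>b\<in>Basis. \<bar>(\<Sum>i\<in>I. sgn_of A i *\<^sub>R a i) \<bullet> b\<bar> powr t))"
      by (intro sum_mono norm_le)
    also have "\<dots> = D powr t * (\<Sum>b\<in>Basis. \<Sum>A\<in>Pow I. \<bar>(\<Sum>i\<in>I. sgn_of A i *\<^sub>R a i) \<bullet> b\<bar> powr t)"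
      by (subst sum.swap) (simp add: sum_distrib_left)
    also have "\<dots> \<le> D powr t * (D * (2 ^ card I * C * ?s powr (t/2)))"
      unfolding D_def by (intro mult_left_mono sum_bounded_above comp) auto
    finally show "(\<Sum>A\<in>Pow I. norm (\<Sum>i\<in>I. sgn_of A i *\<^sub>R a i) powr t)
        \<le> 2 ^ card I * (D powr t * D * C) * ?s powr (t/2)" by (simp add: algebra_simps)
  qed
qed

text \<open>By orthogonality the second moment of the signed sums is the sum of squares, which may be taken to be \<open>1\<close>.
  The lower estimate compares \<open>z\<^sup>2\<close> with \<open>z powr t\<close> except for small and for large \<open>z\<close>: small values contribute
  at most \<open>1/4\<close>, and so do large ones because the fourth moment is at most \<open>K\<close>.\<close>

lemma khinchine_lower:
  assumes t: "0 < t"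
  obtains K where "0 < K" "\<And>(I :: nat set) (a :: nat \<Rightarrow> 'k::euclidean_space). finite I \<Longrightarrow>
    2 ^ card I * (\<Sum>i\<in>I. (norm (a i))\<^sup>2) powr (t / 2) \<le> K * (\<Sum>A\<in>Pow I. norm (\<Sum>i\<in>I. sgn_of A i *\<^sub>R a i) powr t)"
proof -
  obtain K where K: "0 < K" and up: "\<And>(I :: nat set) (a :: nat \<Rightarrow> 'k). finite I \<Longrightarrow>
    (\<Sum>A\<in>Pow I. norm (\<Sum>i\<in>I. sgn_of A i *\<^sub>R a i) powr 4) \<le> 2 ^ card I * K * (\<Sum>i\<in>I. (norm (a i))\<^sup>2) powr (4 / 2)"
    by (rule khinchine_upper[of 4]) auto
  define B where "B = (1/2) powr (2 - t) + (2 * sqrt K) powr (2 - t)"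
  have B: "0 < B" using K by (auto simp: B_def intro: add_pos_pos)
  have pointwise: "z\<^sup>2 \<le> B * z powr t + z ^ 4 / (4 * K) + 1/4" if z: "0 \<le> z" for z :: real
  proof -
    have nn: "0 \<le> B * z powr t" "0 \<le> z ^ 4 / (4*K)" using B K z by auto
    consider "z \<le> 1/2" | "2 * sqrt K \<le> z" | "1/2 < z" "z < 2 * sqrt K" by linarith
    then show ?thesis
    proof cases
      case 1
      then have "z\<^sup>2 \<le> (1/2)\<^sup>2" using z by (intro power_mono) auto
      then show ?thesis using nn by (simp add: power2_eq_square)
    next
      case 2
      then have "(2 * sqrt K)\<^sup>2 \<le> z\<^sup>2" using K by (intro power_mono) auto
      then have "4 * K \<le> z\<^sup>2" using K by (simp add: power_mult_distrib)
      then have "z\<^sup>2 * (4 * K) \<le> z\<^sup>2 * z\<^sup>2" by (intro mult_left_mono) auto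
      then have "z\<^sup>2 \<le> z ^ 4 / (4*K)" using K by (simp add: field_simps power4_eq_xxxx power2_eq_square)
      then show ?thesis using nn by linarith
    next
      case 3
      have "z powr (2 - t) \<le> B"
      proof (cases "t \<le> 2")
        case True
        then have "z powr (2 - t) \<le> (2 * sqrt K) powr (2 - t)" using 3 by (intro powr_mono2) auto
        then show ?thesis by (simp add: B_def add_increasing)
      next
        case False
        then have "z powr (2 - t) \<le> (1/2) powr (2 - t)" using 3 by (intro powr_mono2') auto
        then show ?thesis by (simp add: B_def add_increasing2)
      qed
      then have "z powr (2 - t) * z powr t \<le> B * z powr t" by (intro mult_right_mono) auto
      moreover have "z powr (2 - t) * z powr t = z\<^sup>2"
        using 3 by (simp flip: powr_add)
      ultimately show ?thesis using nn by linarith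
    qed
  qed
  show thesis
  proof (rule that[of "2 * B"])
    show "0 < 2 * B" using B by simp
    fix I :: "nat set" and a :: "nat \<Rightarrow> 'k" assume I: "finite I"
    define \<sigma> where "\<sigma> = sqrt (\<Sum>i\<in>I. (norm (a i))\<^sup>2)"
    have \<sigma>2: "(\<Sum>i\<in>I. (norm (a i))\<^sup>2) powr (t/2) = \<sigma> powr t" "\<sigma>\<^sup>2 = (\<Sum>i\<in>I. (norm (a i))\<^sup>2)" "0 \<le> \<sigma>"
      by (auto simp: \<sigma>_def sum_nonneg powr_half_sqrt[symmetric] powr_powr) (simp add: powr_half_sqrt sum_nonneg)
    show "2 ^ card I * (\<Sum>i\<in>I. (norm (a i))\<^sup>2) powr (t / 2)
        \<le> 2 * B * (\<Sum>A\<in>Pow I. norm (\<Sum>i\<in>I. sgn_of A i *\<^sub>R a i) powr t)"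
    proof (cases "\<sigma> = 0")
      case True
      then show ?thesis using \<sigma>2 B by (simp add: sum_nonneg)
    next
      case False
      with \<sigma>2 have pos: "0 < \<sigma>" by simp
      define b where "b i = a i /\<^sub>R \<sigma>" for i
      let ?S = "\<lambda>A. norm (\<Sum>i\<in>I. sgn_of A i *\<^sub>R b i)"
      have b1: "(\<Sum>i\<in>I. (norm (b i))\<^sup>2) = 1"
        using pos by (simp add: b_def power_mult_distrib power_inverse \<sigma>2(2)[symmetric] flip: sum_distrib_left)
      have "2 ^ card I = (\<Sum>A\<in>Pow I. (?S A)\<^sup>2)" using sum_Pow_norm2[OF I, of b] b1 by simp
      also have "\<dots> \<le> (\<Sum>A\<in>Pow I. B * ?S A powr t + ?S A ^ 4 / (4 * K) + 1/4)"
        by (intro sum_mono pointwise) auto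
      also have "\<dots> = B * (\<Sum>A\<in>Pow I. ?S A powr t) + (\<Sum>A\<in>Pow I. ?S A ^ 4) / (4 * K) + 2 ^ card I * (1/4)"
        using I by (simp add: sum.distrib sum_distrib_left sum_divide_distrib card_Pow)
      also have "(\<Sum>A\<in>Pow I. ?S A ^ 4) \<le> 2 ^ card I * K"
        using up[OF I, of b] b1 by (simp add: powr_numeral)
      finally have *: "2 ^ card I \<le> 2 * B * (\<Sum>A\<in>Pow I. ?S A powr t)"
        using K by (simp add: field_simps)
      have "norm (\<Sum>i\<in>I. sgn_of A i *\<^sub>R a i) = \<sigma> * ?S A" for A
      proof -
        have "(\<Sum>i\<in>I. sgn_of A i *\<^sub>R a i) = \<sigma> *\<^sub>R (\<Sum>i\<in>I. sgn_of A i *\<^sub>R b i)"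
          using pos by (simp add: b_def scaleR_sum_right mult.left_commute[of \<sigma>])
        then show ?thesis using pos by simp
      qed
      then have "(\<Sum>A\<in>Pow I. norm (\<Sum>i\<in>I. sgn_of A i *\<^sub>R a i) powr t) = \<sigma> powr t * (\<Sum>A\<in>Pow I. ?S A powr t)"
        using pos by (simp add: powr_mult sum_distrib_left)
      with mult_left_mono[OF *, of "\<sigma> powr t"] show ?thesis by (simp add: \<sigma>2 algebra_simps)
    qed
  qed
qed


lemma khinchine_upper_ennreal:
  assumes "0 < t"
  obtains K where "0 < K" "\<And>(I :: nat set) (a :: nat \<Rightarrow> 'k::euclidean_space). finite I \<Longrightarrow>
    (\<Sum>A\<in>Pow I. enn_powr (ennreal (norm (\<Sum>i\<in>I. sgn_of A i *\<^sub>R a i))) t)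
      \<le> ennreal (2 ^ card I * K) * enn_powr (\<Sum>i\<in>I. enn_powr (ennreal (norm (a i))) 2) (t / 2)"
proof (rule khinchine_upper[OF assms, where 'k = 'k])
  fix K assume K: "0 < K" "\<And>(I :: nat set) (a :: nat \<Rightarrow> 'k). finite I \<Longrightarrow>
    (\<Sum>A\<in>Pow I. norm (\<Sum>i\<in>I. sgn_of A i *\<^sub>R a i) powr t) \<le> 2 ^ card I * K * (\<Sum>i\<in>I. (norm (a i))\<^sup>2) powr (t / 2)"
  show thesis
    by (rule that[OF K(1)])
       (use K in \<open>simp add: sum_nonneg powr_numeral flip: ennreal_mult'\<close>)
qed

lemma khinchine_lower_ennreal:
  assumes "0 < t"
  obtains K where "0 < K" "\<And>(I :: nat set) (a :: nat \<Rightarrow> 'k::euclidean_space). finite I \<Longrightarrow>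
    2 ^ card I * enn_powr (\<Sum>i\<in>I. enn_powr (ennreal (norm (a i))) 2) (t / 2)
      \<le> ennreal K * (\<Sum>A\<in>Pow I. enn_powr (ennreal (norm (\<Sum>i\<in>I. sgn_of A i *\<^sub>R a i))) t)"
proof (rule khinchine_lower[OF assms, where 'k = 'k])
  fix K assume K: "0 < K" "\<And>(I :: nat set) (a :: nat \<Rightarrow> 'k). finite I \<Longrightarrow>
    2 ^ card I * (\<Sum>i\<in>I. (norm (a i))\<^sup>2) powr (t / 2) \<le> K * (\<Sum>A\<in>Pow I. norm (\<Sum>i\<in>I. sgn_of A i *\<^sub>R a i) powr t)"
  have 2: "(2::ennreal) ^ n = ennreal (2 ^ n)" for n by (simp flip: ennreal_power)
  show thesis
    by (rule that[OF K(1)])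
       (use K in \<open>simp add: 2 sum_nonneg powr_numeral flip: ennreal_mult'\<close>)
qed

section \<open>Binary digits as random signs\<close>

lemma nn_integral_halves:
  fixes f :: "real \<Rightarrow> ennreal"
  assumes [measurable]: "f \<in> borel_measurable borel"
  shows "(\<integral>\<^sup>+x. f x \<partial>unit_measure)
    = ((\<integral>\<^sup>+x. f (x / 2) \<partial>unit_measure) + (\<integral>\<^sup>+x. f ((x + 1) / 2) \<partial>unit_measure)) / 2"
proof -
  have half: "(\<integral>\<^sup>+x. g x \<partial>lborel) = (\<integral>\<^sup>+x. g (t + x / 2) \<partial>lborel) / 2"
    if "g \<in> borel_measurable borel" for g :: "real \<Rightarrow> ennreal" and t
    using nn_integral_real_affine[OF that, of "1/2" t]
    by (simp add: ennreal_divide_times divide_ennreal_def mult.commute flip: inverse_ennreal)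
  have "(\<integral>\<^sup>+x. f x \<partial>unit_measure) = (\<integral>\<^sup>+x. f x * indicator {0..1/2} x + f x * indicator {1/2..1} x \<partial>lborel)"
    unfolding nn_integral_unit_measure[OF assms]
  proof (rule nn_integral_cong_AE)
    show "AE x in lborel. f x * indicator {0..1} x = f x * indicator {0..1/2} x + f x * indicator {1/2..1} x"
      using AE_lborel_singleton[of "1/2"] by eventually_elim (auto split: split_indicator)
  qed
  also have "\<dots> = (\<integral>\<^sup>+x. f x * indicator {0..1/2} x \<partial>lborel) + (\<integral>\<^sup>+x. f x * indicator {1/2..1} x \<partial>lborel)"
    by (rule nn_integral_add) auto
  also have "(\<integral>\<^sup>+x. f x * indicator {0..1/2} x \<partial>lborel) = (\<integral>\<^sup>+x. f (x/2) \<partial>unit_measure) / 2"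
    by (subst half[of _ 0]) (auto simp: nn_integral_unit_measure intro!: nn_integral_cong arg_cong[where f = "\<lambda>u. u / 2"] split: split_indicator)
  also have "(\<integral>\<^sup>+x. f x * indicator {1/2..1} x \<partial>lborel) = (\<integral>\<^sup>+x. f ((x+1)/2) \<partial>unit_measure) / 2"
    by (subst half[of _ "1/2"]) (auto simp: nn_integral_unit_measure add_divide_distrib add.commute intro!: nn_integral_cong arg_cong[where f = "\<lambda>u. u / 2"] split: split_indicator)
  finally show ?thesis by (simp add: divide_ennreal_def distrib_right)
qed

lemma AE_unit_measure: "AE x in unit_measure. 0 < x \<and> x < 1"
proof -
  have "AE x in lborel. x \<in> {0..1} \<longrightarrow> 0 < x \<and> x < (1::real)"
    using AE_lborel_singleton[of 0] AE_lborel_singleton[of 1] by eventually_elim auto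
  then show ?thesis
    unfolding unit_measure_def
    by (subst AE_density) (auto elim!: eventually_mono split: split_indicator_asm)
qed

lemma borel_measurable_frac [measurable]: "frac \<in> borel_measurable (borel :: real measure)"
  unfolding frac_def[abs_def] by measurable

lemma frac_add_nat [simp]: "frac (x + of_nat n) = frac (x :: real)"
  by (simp add: frac_def)

text \<open>The map \<open>x \<mapsto> frac (2\<^sup>m x)\<close> preserves Lebesgue measure on the unit interval.\<close>

lemma nn_integral_frac_power2:
  fixes f :: "real \<Rightarrow> ennreal"
  assumes f: "f \<in> borel_measurable borel"
  shows "(\<integral>\<^sup>+x. f (frac (2 ^ m * x)) \<partial>unit_measure) = (\<integral>\<^sup>+x. f x \<partial>unit_measure)"
proof (induction m)
  case 0
  have "AE x in unit_measure. f (frac x) = f x"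
    using AE_unit_measure by eventually_elim (simp add: frac_eq)
  then show ?case by (simp add: nn_integral_cong_AE)
next
  case (Suc m)
  note [measurable] = f
  have "2 ^ Suc m * ((x + 1) / 2) = 2 ^ m * x + of_nat (2 ^ m)" for x :: real
    by (simp add: algebra_simps)
  then have "frac (2 ^ Suc m * ((x + 1) / 2)) = frac (2 ^ m * x)" for x :: real
    by (simp only: frac_add_nat)
  then have "(\<integral>\<^sup>+x. f (frac (2 ^ Suc m * x)) \<partial>unit_measure)
      = ((\<integral>\<^sup>+x. f (frac (2 ^ m * x)) \<partial>unit_measure) + (\<integral>\<^sup>+x. f (frac (2 ^ m * x)) \<partial>unit_measure)) / 2"
    by (subst nn_integral_halves) (simp_all add: mult.commute)
  also have "\<dots> = (\<integral>\<^sup>+x. f (frac (2 ^ m * x)) \<partial>unit_measure)"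
    unfolding mult_2_right[symmetric] by (rule ennreal_mult_divide_eq) auto
  finally show ?case using Suc by simp
qed

text \<open>The positions at which the binary expansion of \<open>x\<close> has the digit \<open>1\<close>, counted from \<open>0\<close>.\<close>

definition bits :: "real \<Rightarrow> nat set" where
  "bits x = {i. 1 / 2 \<le> frac (2 ^ i * x)}"

lemma bits_half:
  assumes "0 < x" "x < 1"
  shows "bits (x / 2) = Suc ` bits x" "bits ((x + 1) / 2) = insert 0 (Suc ` bits x)"
proof -
  have "i \<in> bits (x / 2) \<longleftrightarrow> i \<in> Suc ` bits x" for i
    using assms by (cases i) (auto simp: bits_def frac_eq)
  moreover have "i \<in> bits ((x + 1) / 2) \<longleftrightarrow> i \<in> insert 0 (Suc ` bits x)" for i
  proof (cases i)
    case (Suc j)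
    have "2 ^ Suc j * ((x + 1) / 2) = 2 ^ j * x + of_nat (2 ^ j)"
      by (simp add: algebra_simps)
    then have "frac (2 ^ Suc j * ((x + 1) / 2)) = frac (2 ^ j * x)"
      by (simp only: frac_add_nat)
    then show ?thesis using Suc by (auto simp: bits_def)
  qed (use assms in \<open>auto simp: bits_def frac_eq\<close>)
  ultimately show "bits (x / 2) = Suc ` bits x" "bits ((x + 1) / 2) = insert 0 (Suc ` bits x)"
    by blast+
qed

lemma measurable_bits [measurable]:
  fixes h :: "nat set \<Rightarrow> 'b::topological_space"
  shows "(\<lambda>x. h (bits x \<inter> {..<n})) \<in> borel_measurable borel"
proof -
  have "(\<lambda>x. bits x \<inter> {..<n}) \<in> borel \<rightarrow>\<^sub>M count_space (Pow {..<n})"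
  proof (subst measurable_count_space_eq2)
    show "(\<lambda>x. bits x \<inter> {..<n}) \<in> space borel \<rightarrow> Pow {..<n} \<and>
      (\<forall>A\<in>Pow {..<n}. (\<lambda>x. bits x \<inter> {..<n}) -` {A} \<inter> space borel \<in> sets borel)"
    proof (intro conjI ballI)
      fix A assume "A \<in> Pow {..<n}"
      then have "(\<lambda>x. bits x \<inter> {..<n}) -` {A} \<inter> space borel
          = {x \<in> space borel. \<forall>i\<in>{..<n}. 1/2 \<le> frac (2 ^ i * x) \<longleftrightarrow> i \<in> A}"
        by (auto simp: bits_def)
      also have "\<dots> \<in> sets borel" by measurable
      finally show "(\<lambda>x. bits x \<inter> {..<n}) -` {A} \<inter> space borel \<in> sets borel" .
    qed auto
  qed simp
  then show ?thesis by (rule measurable_compose) simp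
qed

text \<open>The first \<open>n\<close> binary digits of a random number are \<open>n\<close> independent fair coin tosses.\<close>

lemma nn_integral_bits:
  fixes h :: "nat set \<Rightarrow> ennreal"
  shows "(\<integral>\<^sup>+x. h (bits x \<inter> {..<n}) \<partial>unit_measure) = (\<Sum>A\<in>Pow {..<n}. h A) / 2 ^ n"
proof (induction n arbitrary: h)
  case 0
  then show ?case by (simp add: divide_ennreal_def)
next
  case (Suc n)
  have Int: "Suc ` B \<inter> {..<Suc n} = Suc ` (B \<inter> {..<n})"
    "insert 0 (Suc ` B) \<inter> {..<Suc n} = insert 0 (Suc ` (B \<inter> {..<n}))" for B
    by auto
  have "(\<integral>\<^sup>+x. h (bits x \<inter> {..<Suc n}) \<partial>unit_measure)
      = ((\<integral>\<^sup>+x. h (bits (x/2) \<inter> {..<Suc n}) \<partial>unit_measure) + (\<integral>\<^sup>+x. h (bits ((x+1)/2) \<inter> {..<Suc n}) \<partial>unit_measure)) / 2"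
    by (rule nn_integral_halves) simp
  also have "(\<integral>\<^sup>+x. h (bits (x/2) \<inter> {..<Suc n}) \<partial>unit_measure) = (\<integral>\<^sup>+x. h (Suc ` (bits x \<inter> {..<n})) \<partial>unit_measure)"
    by (rule nn_integral_cong_AE, use AE_unit_measure in eventually_elim) (simp add: bits_half Int)
  also have "(\<integral>\<^sup>+x. h (bits ((x+1)/2) \<inter> {..<Suc n}) \<partial>unit_measure) = (\<integral>\<^sup>+x. h (insert 0 (Suc ` (bits x \<inter> {..<n}))) \<partial>unit_measure)"
    by (rule nn_integral_cong_AE, use AE_unit_measure in eventually_elim) (simp add: bits_half Int)
  also have "(\<integral>\<^sup>+x. h (Suc ` (bits x \<inter> {..<n})) \<partial>unit_measure) = (\<Sum>A\<in>Pow {..<n}. h (Suc ` A)) / 2 ^ n"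
    by (rule Suc.IH)
  also have "(\<integral>\<^sup>+x. h (insert 0 (Suc ` (bits x \<inter> {..<n}))) \<partial>unit_measure) = (\<Sum>A\<in>Pow {..<n}. h (insert 0 (Suc ` A))) / 2 ^ n"
    by (rule Suc.IH)
  also have "((\<Sum>A\<in>Pow {..<n}. h (Suc ` A)) / 2 ^ n + (\<Sum>A\<in>Pow {..<n}. h (insert 0 (Suc ` A))) / 2 ^ n) / 2
      = (\<Sum>A\<in>Pow {..<n}. h (Suc ` A) + h (insert 0 (Suc ` A))) / 2 ^ Suc n"
  proof -
    have "inverse (2 ^ Suc n :: ennreal) = inverse (2 ^ n) * inverse 2"
      by (simp add: mult.commute ennreal_inverse_mult')
    then show ?thesis by (simp add: sum.distrib divide_ennreal_def distrib_right mult.assoc)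
  qed
  also have "(\<Sum>A\<in>Pow {..<n}. h (Suc ` A) + h (insert 0 (Suc ` A))) = (\<Sum>A\<in>Pow (Suc ` {..<n}). h A + h (insert 0 A))"
  proof -
    have "Pow (Suc ` {..<n}) = (`) Suc ` Pow {..<n}" by (rule image_Pow_surj[symmetric]) simp
    moreover have "inj_on ((`) Suc) (Pow {..<n})" by (rule inj_on_image_Pow) simp
    ultimately show ?thesis by (simp add: sum.reindex)
  qed
  also have "\<dots> = (\<Sum>A\<in>Pow {..<Suc n}. h A)"
    unfolding lessThan_Suc_eq_insert_0 by (subst sum_Pow_insert) auto
  finally show ?case .
qed

section \<open>Function quasi-norms and completeness\<close>

text \<open>The common properties of the \<open>L\<^sub>p\<close>-type functionals used below. They are expressed for functionals
  on nonnegative extended functions, so that infinite sums of absolute values need no justification.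
  A power \<open>\<rho>\<close> of the functional is subadditive, which replaces the triangle inequality
  when an exponent is below \<open>1\<close>.\<close>

locale function_norm =
  fixes M :: "'a::topological_space measure" and N :: "('a \<Rightarrow> ennreal) \<Rightarrow> ennreal" and \<rho> :: real
  assumes \<rho>: "0 < \<rho>" "\<rho> \<le> 1"
    and sets_M [simp, measurable_cong]: "sets M = sets borel"
    and N_mono_AE: "AE z in M. g z \<le> h z \<Longrightarrow> N g \<le> N h"
    and N_add: "g \<in> borel_measurable borel \<Longrightarrow> h \<in> borel_measurable borel \<Longrightarrow>
      enn_powr (N (\<lambda>z. g z + h z)) \<rho> \<le> enn_powr (N g) \<rho> + enn_powr (N h) \<rho>"
    and N_cmult: "g \<in> borel_measurable borel \<Longrightarrow> N (\<lambda>z. c * g z) = c * N g"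
    and N_eq_0_iff: "g \<in> borel_measurable borel \<Longrightarrow> N g = 0 \<longleftrightarrow> (AE z in M. g z = 0)"
    and N_finite_AE: "g \<in> borel_measurable borel \<Longrightarrow> N g < top \<Longrightarrow> AE z in M. g z < top"
    and N_SUP: "(\<And>i. G i \<in> borel_measurable borel) \<Longrightarrow> incseq G \<Longrightarrow>
      N (\<lambda>z. SUP i. G i z) = (SUP i::nat. N (G i))"
begin

lemma N_mono: "(\<And>z. g z \<le> h z) \<Longrightarrow> N g \<le> N h"
  by (rule N_mono_AE) simp

lemma N_zero [simp]: "N (\<lambda>z. 0) = 0"
  by (simp add: N_eq_0_iff)

lemma N_sum_le:
  assumes "\<And>i. i \<in> I \<Longrightarrow> G i \<in> borel_measurable borel"
  shows "enn_powr (N (\<lambda>z. \<Sum>i\<in>I. G i z)) \<rho> \<le> (\<Sum>i\<in>I. enn_powr (N (G i)) \<rho>)"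
  using assms
proof (induction I rule: infinite_finite_induct)
  case (insert i I)
  have "enn_powr (N (\<lambda>z. \<Sum>i\<in>insert i I. G i z)) \<rho> = enn_powr (N (\<lambda>z. G i z + (\<Sum>i\<in>I. G i z))) \<rho>"
    using insert by simp
  also have "\<dots> \<le> enn_powr (N (G i)) \<rho> + enn_powr (N (\<lambda>z. \<Sum>i\<in>I. G i z)) \<rho>"
    using insert by (intro N_add borel_measurable_sum) auto
  finally show ?case using insert by (auto intro: order_trans add_left_mono)
qed auto

lemma N_suminf_le:
  fixes G :: "nat \<Rightarrow> 'a \<Rightarrow> ennreal"
  assumes [measurable]: "\<And>i. G i \<in> borel_measurable borel"
  shows "enn_powr (N (\<lambda>z. \<Sum>i. G i z)) \<rho> \<le> (\<Sum>i. enn_powr (N (G i)) \<rho>)"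
proof -
  have "N (\<lambda>z. \<Sum>i. G i z) = N (\<lambda>z. SUP n. \<Sum>i<n. G i z)"
    by (simp add: suminf_eq_SUP)
  also have "\<dots> = (SUP n. N (\<lambda>z. \<Sum>i<n. G i z))"
    by (rule N_SUP) (auto simp: incseq_def le_fun_def intro!: sum_mono2)
  finally have "enn_powr (N (\<lambda>z. \<Sum>i. G i z)) \<rho> = (SUP n. enn_powr (N (\<lambda>z. \<Sum>i<n. G i z)) \<rho>)"
    using \<rho> by (simp add: enn_powr_SUP)
  also have "\<dots> \<le> (SUP n. \<Sum>i<n. enn_powr (N (G i)) \<rho>)"
    by (intro SUP_mono') (auto intro: N_sum_le)
  finally show ?thesis by (simp add: suminf_eq_SUP)
qed

definition fnorm :: "('a \<Rightarrow> 'k::real_normed_vector) \<Rightarrow> ennreal" where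
  "fnorm f = N (\<lambda>z. ennreal (norm (f z)))"

lemma fnorm_zero [simp]: "fnorm (\<lambda>z. 0) = 0"
  by (simp add: fnorm_def)

lemma fnorm_scale:
  fixes f :: "'a \<Rightarrow> 'k::real_normed_field"
  assumes [measurable]: "f \<in> borel_measurable borel"
  shows "fnorm (\<lambda>z. c * f z) = ennreal (norm c) * fnorm f"
  by (simp add: fnorm_def norm_mult ennreal_mult N_cmult)

lemma fnorm_minus [simp]: "fnorm (\<lambda>z. - f z) = fnorm f"
  by (simp add: fnorm_def)

lemma fnorm_minus_commute: "fnorm (\<lambda>z. f z - g z) = fnorm (\<lambda>z. g z - f z)"
  by (simp add: fnorm_def norm_minus_commute)

lemma fnorm_add:
  assumes [measurable]: "f \<in> borel_measurable borel" "g \<in> borel_measurable borel"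
  shows "enn_powr (fnorm (\<lambda>z. f z + g z)) \<rho> \<le> enn_powr (fnorm f) \<rho> + enn_powr (fnorm g) \<rho>"
proof -
  have "fnorm (\<lambda>z. f z + g z) \<le> N (\<lambda>z. ennreal (norm (f z)) + ennreal (norm (g z)))"
    unfolding fnorm_def by (rule N_mono) (auto simp: norm_triangle_ineq simp flip: ennreal_plus)
  then have "enn_powr (fnorm (\<lambda>z. f z + g z)) \<rho> \<le> enn_powr (N (\<lambda>z. ennreal (norm (f z)) + ennreal (norm (g z)))) \<rho>"
    using \<rho> by (intro enn_powr_mono) auto
  also have "\<dots> \<le> enn_powr (fnorm f) \<rho> + enn_powr (fnorm g) \<rho>"
    unfolding fnorm_def by (rule N_add) auto
  finally show ?thesis .
qed

lemma fnorm_diff_triangle: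
  fixes f g h :: "'a \<Rightarrow> 'k::{real_normed_vector, second_countable_topology}"
  assumes [measurable]: "f \<in> borel_measurable borel" "g \<in> borel_measurable borel" "h \<in> borel_measurable borel"
  shows "enn_powr (fnorm (\<lambda>z. f z - h z)) \<rho>
    \<le> enn_powr (fnorm (\<lambda>z. f z - g z)) \<rho> + enn_powr (fnorm (\<lambda>z. g z - h z)) \<rho>"
  using fnorm_add[of "\<lambda>z. f z - g z" "\<lambda>z. g z - h z"] by simp

lemma fnorm_eq_0_iff:
  assumes [measurable]: "f \<in> borel_measurable borel"
  shows "fnorm f = 0 \<longleftrightarrow> (AE z in M. f z = 0)"
  by (simp add: fnorm_def N_eq_0_iff ennreal_eq_0_iff)

lemma fnorm_add_less_top:
  assumes "f \<in> borel_measurable borel" "g \<in> borel_measurable borel" "fnorm f < top" "fnorm g < top"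
  shows "fnorm (\<lambda>z. f z + g z) < top"
proof -
  have "enn_powr (fnorm f) \<rho> + enn_powr (fnorm g) \<rho> < top"
    using assms by simp
  with fnorm_add[OF assms(1,2)] have "enn_powr (fnorm (\<lambda>z. f z + g z)) \<rho> < top"
    by (rule le_less_trans)
  then show ?thesis by simp
qed

text \<open>The Riesz--Fischer argument: the sum of the absolute increments of a fast Cauchy sequence has finite
  quasi-norm, so it is finite almost everywhere and the sequence converges pointwise.\<close>

lemma fast_Cauchy_converges:
  fixes f :: "nat \<Rightarrow> 'a \<Rightarrow> 'k::{banach, second_countable_topology}"
  assumes [measurable]: "\<And>n. f n \<in> borel_measurable borel"
    and fast: "\<And>n. enn_powr (fnorm (\<lambda>z. f (Suc n) z - f n z)) \<rho> \<le> ennreal ((1/2) ^ n)"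
  obtains g where "g \<in> borel_measurable borel" "(\<lambda>n. fnorm (\<lambda>z. g z - f n z)) \<longlonglongrightarrow> 0"
proof -
  define R where "R k z = (\<Sum>j. ennreal (norm (f (Suc (j + k)) z - f (j + k) z)))" for k z
  have [measurable]: "R k \<in> borel_measurable borel" for k unfolding R_def by measurable
  have NR: "enn_powr (N (R k)) \<rho> \<le> ennreal (2 * (1/2) ^ k)" for k
  proof -
    have "enn_powr (N (R k)) \<rho> \<le> (\<Sum>j. enn_powr (N (\<lambda>z. ennreal (norm (f (Suc (j + k)) z - f (j + k) z)))) \<rho>)"
      unfolding R_def by (rule N_suminf_le) simp
    also have "\<dots> \<le> (\<Sum>j. ennreal ((1/2) ^ (j + k)))"
      using fast by (intro suminf_le) (auto simp: fnorm_def)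
    also have "\<dots> = ennreal (\<Sum>j. (1/2) ^ (j + k))"
      by (intro suminf_ennreal2) (auto simp: power_add intro!: summable_mult2)
    also have "(\<Sum>j. (1/2::real) ^ (j + k)) = 2 * (1/2) ^ k"
      by (simp add: power_add suminf_mult2[symmetric] suminf_geometric)
    finally show ?thesis .
  qed
  \<comment> \<open>\<open>f n z\<close> diverges only on a null set\<close>
  define g where "g z = lim (\<lambda>n. f n z)" for z
  have [measurable]: "g \<in> borel_measurable borel"
    unfolding g_def by (rule borel_measurable_lim_metric) simp
  have "enn_powr (N (R 0)) \<rho> < top" using NR[of 0] by (rule le_less_trans) simp
  then have "AE z in M. R 0 z < top" by (intro N_finite_AE) auto
  then have bound: "AE z in M. ennreal (norm (g z - f k z)) \<le> R k z" for k
  proof eventually_elim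
    case (elim z)
    define d where "d j = f (Suc j) z - f j z" for j
    have "summable (\<lambda>j. norm (d j))"
      using elim by (intro summable_suminf_not_top) (auto simp: R_def d_def less_top)
    then have sm: "summable (\<lambda>j. norm (d (j + k)))" for k
      by (rule summable_ignore_initial_segment)
    have part: "(\<Sum>j<n. d (j + k)) = f (n + k) z - f k z" for n k
      by (induction n) (auto simp: d_def)
    have "(\<lambda>n. f (n + k) z - f k z) \<longlonglongrightarrow> (\<Sum>j. d (j + k))"
      using summable_LIMSEQ[OF summable_norm_cancel[OF sm[of k]]] by (simp add: part)
    from tendsto_add[OF this tendsto_const[of "f k z"]]
    have lim: "(\<lambda>n. f (n + k) z) \<longlonglongrightarrow> (\<Sum>j. d (j + k)) + f k z"
      by simp
    have "g z = (\<Sum>j. d (j + k)) + f k z"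
      unfolding g_def using lim[THEN LIMSEQ_offset] by (rule limI)
    then have "norm (g z - f k z) \<le> (\<Sum>j. norm (d (j + k)))"
      using summable_norm[OF sm[of k]] by simp
    also have "ennreal \<dots> = R k z"
      unfolding R_def using sm[of k] by (subst suminf_ennreal2[symmetric]) (auto simp: d_def)
    finally show ?case by (simp add: ennreal_leI)
  qed
  have le: "enn_powr (fnorm (\<lambda>z. g z - f k z)) \<rho> \<le> ennreal (2 * (1/2) ^ k)" for k
  proof -
    have "enn_powr (fnorm (\<lambda>z. g z - f k z)) \<rho> \<le> enn_powr (N (R k)) \<rho>"
      using \<rho> bound unfolding fnorm_def by (intro enn_powr_mono N_mono_AE) auto
    with NR show ?thesis by (rule order_trans[rotated])
  qed
  have "(\<lambda>k. ennreal (2 * (1/2) ^ k)) \<longlonglongrightarrow> ennreal (2 * 0)"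
    by (intro tendsto_ennrealI tendsto_mult tendsto_const LIMSEQ_power_zero) simp
  then have "(\<lambda>k. ennreal (2 * (1/2) ^ k)) \<longlonglongrightarrow> 0" by simp
  then have "(\<lambda>k. enn_powr (fnorm (\<lambda>z. g z - f k z)) \<rho>) \<longlonglongrightarrow> 0"
    by (rule tendsto_sandwich[OF _ _ tendsto_const, rotated 2]) (auto simp: le)
  then have "(\<lambda>k. enn_powr (enn_powr (fnorm (\<lambda>z. g z - f k z)) \<rho>) (1/\<rho>)) \<longlonglongrightarrow> 0"
    by (rule tendsto_enn_powr_0) (use \<rho> in auto)
  then have "(\<lambda>n. fnorm (\<lambda>z. g z - f n z)) \<longlonglongrightarrow> 0"
    using \<rho> by (simp add: enn_powr_enn_powr)
  then show thesis by (rule that[rotated]) simp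
qed

text \<open>A Cauchy sequence has a fast subsequence, and converges to the limit of the latter.\<close>

lemma Cauchy_converges:
  fixes f :: "nat \<Rightarrow> 'a \<Rightarrow> 'k::{banach, second_countable_topology}"
  assumes m [measurable]: "\<And>n. f n \<in> borel_measurable borel"
    and Cauchy: "\<And>e. 0 < e \<Longrightarrow> \<exists>n0. \<forall>m\<ge>n0. \<forall>n\<ge>n0. fnorm (\<lambda>z. f m z - f n z) < ennreal e"
  obtains g where "g \<in> borel_measurable borel" "(\<lambda>n. fnorm (\<lambda>z. g z - f n z)) \<longlonglongrightarrow> 0"
proof -
  have "\<exists>n0. \<forall>m\<ge>n0. \<forall>n\<ge>n0. enn_powr (fnorm (\<lambda>z. f m z - f n z)) \<rho> \<le> ennreal ((1/2) ^ k)" for k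
  proof -
    have "0 < ((1/2::real) ^ k) powr (1/\<rho>)" by simp
    from Cauchy[OF this] obtain n0 where
      n0: "\<And>m n. m \<ge> n0 \<Longrightarrow> n \<ge> n0 \<Longrightarrow> fnorm (\<lambda>z. f m z - f n z) < ennreal (((1/2) ^ k) powr (1/\<rho>))" by blast
    have "enn_powr (fnorm (\<lambda>z. f m z - f n z)) \<rho> \<le> ennreal ((1/2) ^ k)" if "m \<ge> n0" "n \<ge> n0" for m n
      using n0[OF that] \<rho> enn_powr_mono[of "fnorm (\<lambda>z. f m z - f n z)" "ennreal (((1/2) ^ k) powr (1/\<rho>))" \<rho>]
      by (simp add: powr_powr)
    then show ?thesis by blast
  qed
  then obtain n0 where n0: "\<And>k m n. n0 k \<le> m \<Longrightarrow> n0 k \<le> n \<Longrightarrow>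
      enn_powr (fnorm (\<lambda>z. f m z - f n z)) \<rho> \<le> ennreal ((1/2) ^ k)" by metis
  define \<iota> where "\<iota> k = (\<Sum>j\<le>k. n0 j)" for k
  have \<iota>: "n0 k \<le> \<iota> k" "\<iota> k \<le> \<iota> (Suc k)" for k
    unfolding \<iota>_def by (auto intro: member_le_sum)
  obtain g where g [measurable]: "g \<in> borel_measurable borel" and
    lim: "(\<lambda>k. fnorm (\<lambda>z. g z - f (\<iota> k) z)) \<longlonglongrightarrow> 0"
  proof (rule fast_Cauchy_converges[of "\<lambda>k. f (\<iota> k)"])
    show "enn_powr (fnorm (\<lambda>z. f (\<iota> (Suc n)) z - f (\<iota> n) z)) \<rho> \<le> ennreal ((1/2) ^ n)" for n
      using \<iota>(1)[of n] \<iota>(2)[of n] by (intro n0) auto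
  qed auto
  have "(\<lambda>n. fnorm (\<lambda>z. g z - f n z)) \<longlonglongrightarrow> 0"
  proof -
    have "(\<lambda>n. enn_powr (fnorm (\<lambda>z. g z - f n z)) \<rho>) \<longlonglongrightarrow> 0"
    proof (rule order_tendstoI)
      fix u :: ennreal assume u: "0 < u"
      obtain e :: real where e: "0 < e" "ennreal (2 * e) < u"
      proof -
        obtain c where c: "0 < c" "c < u" using dense[OF u] by blast
        then have "c \<noteq> top" by auto
        then obtain b where b: "c = ennreal b" "0 \<le> b" by (cases c) auto
        with c have "0 < b" by (auto simp: less_le)
        then show thesis using b c by (intro that[of "b/2"]) auto
      qed
      have "\<forall>\<^sub>F k in sequentially. (1/2::real) ^ k < e"
        by (rule order_tendstoD[OF LIMSEQ_power_zero]) (use e in auto)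
      moreover have "\<forall>\<^sub>F k in sequentially. enn_powr (fnorm (\<lambda>z. g z - f (\<iota> k) z)) \<rho> < ennreal e"
        using tendsto_enn_powr_0[OF lim, of \<rho>] \<rho> e by (intro order_tendstoD) auto
      ultimately have "\<forall>\<^sub>F k in sequentially. (1/2::real) ^ k < e \<and> enn_powr (fnorm (\<lambda>z. g z - f (\<iota> k) z)) \<rho> < ennreal e"
        by eventually_elim simp
      then obtain k where k: "(1/2::real) ^ k < e" "enn_powr (fnorm (\<lambda>z. g z - f (\<iota> k) z)) \<rho> < ennreal e"
        using eventually_happens'[OF sequentially_bot] by blast
      show "\<forall>\<^sub>F n in sequentially. enn_powr (fnorm (\<lambda>z. g z - f n z)) \<rho> < u"
        using eventually_ge_at_top[of "n0 k"]
      proof eventually_elim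
        case (elim n)
        have "enn_powr (fnorm (\<lambda>z. g z - f n z)) \<rho>
            \<le> enn_powr (fnorm (\<lambda>z. g z - f (\<iota> k) z)) \<rho> + enn_powr (fnorm (\<lambda>z. f (\<iota> k) z - f n z)) \<rho>"
          by (rule fnorm_diff_triangle) auto
        also have "\<dots> \<le> ennreal e + ennreal ((1/2) ^ k)"
          using k elim \<iota>(1)[of k] by (intro add_mono n0) auto
        also have "\<dots> \<le> ennreal (2 * e)"
          using k e by (simp flip: ennreal_plus)
        finally show ?case using e by simp
      qed
    qed auto
    from tendsto_enn_powr_0[OF this, of "1/\<rho>"] show ?thesis
      using \<rho> by (simp add: enn_powr_enn_powr)
  qed
  with g show thesis by (rule that)
qed

end

text \<open>The power \<open>\<rho>\<close> is moved inside, where it is subadditive, and the remaining exponent \<open>k / \<rho>\<close> is at least \<open>1\<close>.\<close>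

lemma Lnorm_rho_add:
  assumes "0 < \<rho>" "\<rho> \<le> 1" "\<rho> \<le> k" and [measurable]: "f \<in> borel_measurable M" "g \<in> borel_measurable M"
  shows "enn_powr (Lnorm M k (\<lambda>z. f z + g z)) \<rho> \<le> enn_powr (Lnorm M k f) \<rho> + enn_powr (Lnorm M k g) \<rho>"
proof -
  have k: "1 \<le> k / \<rho>" "0 < k / \<rho>" using assms by auto
  have "enn_powr (Lnorm M k (\<lambda>z. f z + g z)) \<rho> = Lnorm M (k / \<rho>) (\<lambda>z. enn_powr (f z + g z) \<rho>)"
    using assms k by (simp add: Lnorm_enn_powr)
  also have "\<dots> \<le> Lnorm M (k / \<rho>) (\<lambda>z. enn_powr (f z) \<rho> + enn_powr (g z) \<rho>)"
    using assms k by (intro Lnorm_mono enn_powr_add_le) auto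
  also have "\<dots> \<le> Lnorm M (k / \<rho>) (\<lambda>z. enn_powr (f z) \<rho>) + Lnorm M (k / \<rho>) (\<lambda>z. enn_powr (g z) \<rho>)"
    using assms k by (intro Lnorm_add_le) auto
  also have "\<dots> = enn_powr (Lnorm M k f) \<rho> + enn_powr (Lnorm M k g) \<rho>"
    using assms k by (simp add: Lnorm_enn_powr)
  finally show ?thesis .
qed

lemma function_norm_Lnorm:
  fixes M :: "'a::topological_space measure"
  assumes p: "0 < p" and M: "sets M = sets borel"
  shows "function_norm M (Lnorm M p) (min 1 p)"
proof -
  have m: "borel_measurable M = borel_measurable borel" using M by (intro measurable_cong_sets) auto
  show ?thesis
  proof
    show "0 < min 1 p" "min 1 p \<le> 1" "sets M = sets borel" using assms by auto
    show "Lnorm M p g = 0 \<longleftrightarrow> (AE z in M. g z = 0)" if "g \<in> borel_measurable borel" for g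
      using p that by (intro Lnorm_eq_0_iff) (auto simp: m)
  qed (use p in \<open>auto simp: m[symmetric] intro: Lnorm_mono_AE Lnorm_rho_add Lnorm_cmult Lnorm_finite_AE Lnorm_SUP\<close>)
qed

lemma mixed_norm_rho_add:
  fixes g h :: "real \<times> real \<Rightarrow> ennreal"
  assumes \<rho>: "0 < \<rho>" "\<rho> \<le> 1" "\<rho> \<le> s" "\<rho> \<le> r"
    and [measurable]: "g \<in> borel_measurable borel" "h \<in> borel_measurable borel"
  shows "enn_powr (mixed_norm s r (\<lambda>z. g z + h z)) \<rho> \<le> enn_powr (mixed_norm s r g) \<rho> + enn_powr (mixed_norm s r h) \<rho>"
proof -
  have "enn_powr (Lnorm unit_measure s (\<lambda>x. Lnorm unit_measure r (\<lambda>y. g (x, y) + h (x, y)))) \<rho>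
      = Lnorm unit_measure (s / \<rho>) (\<lambda>x. enn_powr (Lnorm unit_measure r (\<lambda>y. g (x, y) + h (x, y))) \<rho>)"
    using \<rho> by (simp add: Lnorm_enn_powr)
  also have "\<dots> \<le> Lnorm unit_measure (s / \<rho>) (\<lambda>x. enn_powr (Lnorm unit_measure r (\<lambda>y. g (x, y))) \<rho>
      + enn_powr (Lnorm unit_measure r (\<lambda>y. h (x, y))) \<rho>)"
    using \<rho> by (intro Lnorm_mono Lnorm_rho_add) auto
  also have "\<dots> \<le> Lnorm unit_measure (s / \<rho>) (\<lambda>x. enn_powr (Lnorm unit_measure r (\<lambda>y. g (x, y))) \<rho>)
      + Lnorm unit_measure (s / \<rho>) (\<lambda>x. enn_powr (Lnorm unit_measure r (\<lambda>y. h (x, y))) \<rho>)"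
    using \<rho> by (intro Lnorm_add_le) auto
  finally show ?thesis
    using \<rho> by (simp add: Lnorm_enn_powr mixed_norm_def)
qed

lemma function_norm_mixed_norm:
  assumes s: "0 < s" and r: "0 < r"
  shows "function_norm unit_square_measure (mixed_norm s r) (min 1 (min s r))"
proof
  show "0 < min 1 (min s r)" "min 1 (min s r) \<le> 1" using assms by auto
  show "sets unit_square_measure = sets borel"
    by (simp add: borel_prod[symmetric] cong: sets_pair_measure_cong)
  show "mixed_norm s r g = 0 \<longleftrightarrow> (AE z in unit_square_measure. g z = 0)" if "g \<in> borel_measurable borel" for g
    using assms that by (intro mixed_norm_eq_0_iff) auto
qed (use assms in \<open>auto intro: mixed_norm_mono_AE mixed_norm_rho_add mixed_norm_cmult mixed_norm_finite_AE mixed_norm_SUP\<close>)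

section \<open>Quasi-normed spaces of functions and their embeddings\<close>

text \<open>A quasi-normed space whose vectors are the classes \<open>cls f\<close> of functions \<open>f\<close> in a linear space \<open>F\<close>
  of functions with finite quasi-norm, modulo equality almost everywhere.\<close>

locale fun_space = function_norm M N \<rho>
  for M :: "'a::topological_space measure" and N \<rho> +
  fixes X :: "('k::{real_normed_field, banach, second_countable_topology}, 'v) qn_space"
    and cls :: "('a \<Rightarrow> 'k) \<Rightarrow> 'v" and F :: "('a \<Rightarrow> 'k) set"
  assumes F_measurable: "f \<in> F \<Longrightarrow> f \<in> borel_measurable borel"
    and F_finite: "f \<in> F \<Longrightarrow> fnorm f < top"
    and F_zero: "(\<lambda>z. 0) \<in> F"
    and F_add: "f \<in> F \<Longrightarrow> g \<in> F \<Longrightarrow> (\<lambda>z. f z + g z) \<in> F"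
    and F_scale: "f \<in> F \<Longrightarrow> (\<lambda>z. c * f z) \<in> F"
    and vecs_X: "vecs X = cls ` F"
    and cls_eq_iff: "f \<in> F \<Longrightarrow> g \<in> F \<Longrightarrow> cls f = cls g \<longleftrightarrow> (AE z in M. f z = g z)"
    and vadd_X: "f \<in> F \<Longrightarrow> g \<in> F \<Longrightarrow> vadd X (cls f) (cls g) = cls (\<lambda>z. f z + g z)"
    and vscale_X: "f \<in> F \<Longrightarrow> vscale X c (cls f) = cls (\<lambda>z. c * f z)"
    and qnorm_X: "f \<in> F \<Longrightarrow> qnorm X (cls f) = enn2real (fnorm f)"
begin

lemma F_diff: "f \<in> F \<Longrightarrow> g \<in> F \<Longrightarrow> (\<lambda>z. f z - g z) \<in> F"
  using F_add[OF _ F_scale[of g "-1"], of f] by simp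

lemma F_minus: "f \<in> F \<Longrightarrow> (\<lambda>z. - f z) \<in> F"
  using F_scale[of f "-1"] by simp

lemma ennreal_qnorm: "f \<in> F \<Longrightarrow> ennreal (qnorm X (cls f)) = fnorm f"
  using F_finite by (simp add: qnorm_X)

lemma vecs_cls: "f \<in> F \<Longrightarrow> cls f \<in> vecs X"
  by (simp add: vecs_X)

lemma vecsE:
  assumes "v \<in> vecs X"
  obtains f where "f \<in> F" "v = cls f"
  using assms by (auto simp: vecs_X)

lemma qnorm_nonneg: "v \<in> vecs X \<Longrightarrow> 0 \<le> qnorm X v"
  by (auto elim!: vecsE simp: qnorm_X)

lemma qn_dist_cls: "f \<in> F \<Longrightarrow> g \<in> F \<Longrightarrow> qn_dist X (cls f) (cls g) = qnorm X (cls (\<lambda>z. f z - g z))"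
  using fnorm_minus_commute[of f g] by (simp add: qn_dist_def vscale_X vadd_X F_minus qnorm_X F_diff)

abbreviation zero_vec :: 'v where "zero_vec \<equiv> cls (\<lambda>z. 0)"

lemma zero_vec: "zero_vec \<in> vecs X"
  by (rule vecs_cls[OF F_zero])

lemma qn_dist_zero: "v \<in> vecs X \<Longrightarrow> qn_dist X zero_vec v = qnorm X v"
proof (elim vecsE)
  fix f assume f: "f \<in> F" "v = cls f"
  have "(\<lambda>z. - f z) \<in> F" using F_scale[OF f(1), of "-1"] by simp
  then show ?thesis using f by (simp add: qn_dist_cls F_zero qnorm_X)
qed

lemma vscale_zero: "v \<in> vecs X \<Longrightarrow> vscale X 0 v = zero_vec"
  by (auto elim!: vecsE simp: vscale_X)

lemma vscale_vecs: "v \<in> vecs X \<Longrightarrow> vscale X c v \<in> vecs X"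
  by (auto elim!: vecsE simp: vscale_X intro!: vecs_cls F_scale)

lemma qnorm_vscale: "v \<in> vecs X \<Longrightarrow> qnorm X (vscale X c v) = norm c * qnorm X v"
  by (auto elim!: vecsE simp: vscale_X qnorm_X F_scale fnorm_scale F_measurable enn2real_mult)

lemma qnorm_eq_0: "v \<in> vecs X \<Longrightarrow> qnorm X v = 0 \<longleftrightarrow> v = zero_vec"
proof (elim vecsE)
  fix f assume f: "f \<in> F" "v = cls f"
  then have "qnorm X v = 0 \<longleftrightarrow> fnorm f = 0"
    using F_finite[of f] by (auto simp: qnorm_X enn2real_eq_0_iff)
  then show ?thesis using f by (simp add: fnorm_eq_0_iff F_measurable cls_eq_iff F_zero)
qed

lemma qn_dist_triangle:
  assumes "u \<in> vecs X" "v \<in> vecs X" "w \<in> vecs X"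
  shows "qn_dist X u w powr \<rho> \<le> qn_dist X u v powr \<rho> + qn_dist X v w powr \<rho>"
proof -
  obtain f g h where fgh: "f \<in> F" "g \<in> F" "h \<in> F" "u = cls f" "v = cls g" "w = cls h"
    using assms by (auto elim!: vecsE)
  have *: "enn_powr (fnorm (\<lambda>z. p z - q z)) \<rho> = ennreal (qn_dist X (cls p) (cls q) powr \<rho>)"
    if "p \<in> F" "q \<in> F" for p q
    using that ennreal_qnorm[OF F_diff[OF that]] qnorm_nonneg[OF vecs_cls[OF F_diff[OF that]]]
    by (simp add: qn_dist_cls flip: enn_powr_ennreal)
  show ?thesis
    using fnorm_diff_triangle[of f g h] fgh by (simp add: F_measurable * flip: ennreal_plus)
qed

text \<open>Balls of a quasi-norm can fail to be open. Here they are open because a power of the distance satisfies the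
  triangle inequality.\<close>

lemma openin_ball:
  assumes v: "v \<in> vecs X"
  shows "openin (qn_topology X) {w \<in> vecs X. qn_dist X v w < e}"
  unfolding openin_qn_topology
proof (intro conjI ballI)
  fix w assume "w \<in> {w \<in> vecs X. qn_dist X v w < e}"
  then have w: "w \<in> vecs X" "qn_dist X v w < e" by auto
  have dist_nonneg: "0 \<le> qn_dist X v w" if "v \<in> vecs X" "w \<in> vecs X" for v w
    using that by (auto elim!: vecsE simp: qn_dist_cls F_diff intro!: qnorm_nonneg vecs_cls)
  define d where "d = e powr \<rho> - qn_dist X v w powr \<rho>"
  have "qn_dist X v w powr \<rho> < e powr \<rho>"
    using w \<rho> dist_nonneg[OF v w(1)] by (intro powr_less_mono2) auto
  then have d: "0 < d" by (simp add: d_def)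
  have e: "0 < e" using dist_nonneg[OF v w(1)] w by linarith
  have "qn_dist X v u < e" if u: "u \<in> vecs X" "qn_dist X w u < d powr (1/\<rho>)" for u
  proof -
    have "qn_dist X w u powr \<rho> < (d powr (1/\<rho>)) powr \<rho>"
      using u \<rho> dist_nonneg[OF w(1) u(1)] by (intro powr_less_mono2) auto
    then have "qn_dist X v u powr \<rho> < e powr \<rho>"
      using qn_dist_triangle[OF v w(1) u(1)] d \<rho> by (simp add: powr_powr d_def)
    then show ?thesis
      using \<rho> e by (meson less_eq_real_def not_less powr_mono2)
  qed
  then show "\<exists>da>0. \<forall>y\<in>vecs X. qn_dist X w y < da \<longrightarrow> y \<in> {w \<in> vecs X. qn_dist X v w < e}"
    using d by (intro exI[of _ "d powr (1/\<rho>)"]) auto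
qed auto

end

text \<open>As for linear operators between normed spaces, continuity at zero and homogeneity give bounds.\<close>

lemma embeds_isomorphically_bounds:
  fixes X :: "('k::{real_normed_field, banach, second_countable_topology}, 'v) qn_space"
    and Y :: "('k, 'w) qn_space"
  assumes X: "fun_space M N \<rho> X cls F" and Y: "fun_space M' N' \<rho>' Y cls' F'"
    and emb: "embeds_isomorphically X Y"
  obtains T c C where "qn_linear X Y T" "0 < c" "0 < C"
    "\<And>v. v \<in> vecs X \<Longrightarrow> c * qnorm X v \<le> qnorm Y (T v)"
    "\<And>v. v \<in> vecs X \<Longrightarrow> qnorm Y (T v) \<le> C * qnorm X v"
proof -
  interpret X: fun_space M N \<rho> X cls F by fact
  interpret Y: fun_space M' N' \<rho>' Y cls' F' by fact
  obtain T where lin: "qn_linear X Y T" and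
    hom: "homeomorphic_map (qn_topology X) (subtopology (qn_topology Y) (T ` vecs X)) T"
    using emb by (auto simp: embeds_isomorphically_def)
  have T_vecs: "T v \<in> vecs Y" if "v \<in> vecs X" for v using lin that by (auto simp: qn_linear_def)
  have T_scale: "T (vscale X a v) = vscale Y a (T v)" if "v \<in> vecs X" for a v
    using lin that by (auto simp: qn_linear_def)
  have T_zero: "T X.zero_vec = Y.zero_vec"
    using T_scale[OF X.zero_vec, of 0] by (simp add: X.vscale_zero Y.vscale_zero X.zero_vec T_vecs)
  have inj: "inj_on T (vecs X)"
    using homeomorphic_imp_injective_map[OF hom] by (simp add: topspace_qn_topology)
  \<comment> \<open>a vector of quasi-norm \<open>q > 0\<close> is scaled to quasi-norm \<open>d/2\<close>\<close>
  have scaled: "norm (of_real (d / (2 * q)) :: 'k) = d / (2 * q)" if "0 < d" "0 < q" for d q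
    using that by (simp only: norm_of_real) simp
  obtain d where d: "0 < d" "\<And>v. v \<in> vecs X \<Longrightarrow> qnorm X v < d \<Longrightarrow> qnorm Y (T v) < 1"
  proof -
    let ?V = "{w \<in> vecs Y. qn_dist Y Y.zero_vec w < 1}"
    have "continuous_map (qn_topology X) (qn_topology Y) T"
      using homeomorphic_imp_continuous_map[OF hom] by (simp add: continuous_map_in_subtopology)
    then have "openin (qn_topology X) {v \<in> topspace (qn_topology X). T v \<in> ?V}"
      using Y.openin_ball[OF Y.zero_vec] by (rule openin_continuous_map_preimage)
    moreover have "X.zero_vec \<in> {v \<in> topspace (qn_topology X). T v \<in> ?V}"
      using Y.qnorm_eq_0[OF Y.zero_vec]
      by (simp add: topspace_qn_topology X.zero_vec T_zero Y.zero_vec Y.qn_dist_zero)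
    ultimately obtain d where "0 < d" "\<forall>v\<in>vecs X. qn_dist X X.zero_vec v < d \<longrightarrow> v \<in> {v \<in> topspace (qn_topology X). T v \<in> ?V}"
      unfolding openin_qn_topology by blast
    then show thesis
      by (intro that[of d]) (auto simp: X.qn_dist_zero Y.qn_dist_zero)
  qed
  obtain e where e: "0 < e" "\<And>v. v \<in> vecs X \<Longrightarrow> qnorm Y (T v) < e \<Longrightarrow> qnorm X v < 1"
  proof -
    let ?U = "{v \<in> vecs X. qn_dist X X.zero_vec v < 1}"
    have "openin (subtopology (qn_topology Y) (T ` vecs X)) (T ` ?U)"
      using homeomorphic_imp_open_map[OF hom] X.openin_ball[OF X.zero_vec] by (auto simp: open_map_def)
    then obtain V where V: "openin (qn_topology Y) V" "T ` ?U = V \<inter> T ` vecs X"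
      by (auto simp: openin_subtopology)
    have "X.zero_vec \<in> ?U"
      using X.qnorm_eq_0[OF X.zero_vec] by (simp add: X.zero_vec X.qn_dist_zero)
    then have "Y.zero_vec \<in> V" using V(2) T_zero by (metis (no_types, lifting) IntD1 imageI)
    with V(1) obtain e where e: "0 < e" "\<forall>w\<in>vecs Y. qn_dist Y Y.zero_vec w < e \<longrightarrow> w \<in> V"
      unfolding openin_qn_topology by blast
    have "qnorm X v < 1" if v: "v \<in> vecs X" "qnorm Y (T v) < e" for v
    proof -
      have "T v \<in> V" using e v by (simp add: T_vecs Y.qn_dist_zero)
      then have "T v \<in> T ` ?U" using V(2) v by blast
      then have "v \<in> ?U" using inj v by (auto dest: inj_onD)
      then show ?thesis using v by (simp add: X.qn_dist_zero)
    qed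
    with e show thesis by (intro that[of e]) auto
  qed
  show thesis
  proof (rule that[OF lin])
    show "0 < e / 2" "0 < 2 / d" using d e by auto
    fix v assume v: "v \<in> vecs X"
    show "qnorm Y (T v) \<le> 2 / d * qnorm X v"
    proof (cases "qnorm X v = 0")
      case True
      then have "T v = Y.zero_vec" using v by (simp add: X.qnorm_eq_0 T_zero)
      then show ?thesis using True Y.qnorm_eq_0[OF Y.zero_vec] by simp
    next
      case False
      with X.qnorm_nonneg[OF v] have q: "0 < qnorm X v" by simp
      let ?a = "of_real (d / (2 * qnorm X v)) :: 'k"
      have "qnorm Y (T (vscale X ?a v)) < 1"
        using d(1) q v by (intro d X.vscale_vecs) (simp_all add: X.qnorm_vscale scaled del: of_real_divide of_real_mult)
      then have "d / (2 * qnorm X v) * qnorm Y (T v) < 1"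
        using d q v by (simp add: T_scale Y.qnorm_vscale T_vecs scaled del: of_real_divide of_real_mult)
      then show ?thesis using d q by (simp add: field_simps)
    qed
    show "e / 2 * qnorm X v \<le> qnorm Y (T v)"
    proof (cases "qnorm Y (T v) = 0")
      case True
      then have "T v = T X.zero_vec" using v by (simp add: Y.qnorm_eq_0 T_vecs T_zero)
      then have "v = X.zero_vec" using inj v X.zero_vec by (auto dest: inj_onD)
      then show ?thesis using True X.qnorm_eq_0[OF X.zero_vec] by simp
    next
      case False
      with Y.qnorm_nonneg[OF T_vecs[OF v]] have q: "0 < qnorm Y (T v)" by simp
      let ?a = "of_real (e / (2 * qnorm Y (T v))) :: 'k"
      have "qnorm X (vscale X ?a v) < 1"
        using e(1) q v by (intro e X.vscale_vecs) (simp_all add: T_scale Y.qnorm_vscale T_vecs scaled del: of_real_divide of_real_mult)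
      then have "e / (2 * qnorm Y (T v)) * qnorm X v < 1"
        using e q v by (simp add: X.qnorm_vscale scaled del: of_real_divide of_real_mult)
      then show ?thesis using e q by (simp add: field_simps)
    qed
  qed
qed

text \<open>Conversely, a linear map that is bounded above and below is a homeomorphism onto its image, and the image
  is closed if the domain is complete.\<close>

lemma embeds_isomorphicallyI:
  fixes X :: "('k::{real_normed_field, banach, second_countable_topology}, 'v) qn_space"
    and Y :: "('k, 'w) qn_space"
  assumes X: "fun_space M N \<rho> X cls F" and Y: "fun_space M' N' \<rho>' Y cls' F'"
    and lin: "qn_linear X Y T" and cC: "0 < c" "0 < C"
    and lower: "\<And>v. v \<in> vecs X \<Longrightarrow> c * qnorm X v \<le> qnorm Y (T v)"
    and upper: "\<And>v. v \<in> vecs X \<Longrightarrow> qnorm Y (T v) \<le> C * qnorm X v"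
    and complete: "\<And>u. (\<And>n. u n \<in> vecs X) \<Longrightarrow>
      (\<And>e. 0 < e \<Longrightarrow> \<exists>n0. \<forall>m\<ge>n0. \<forall>n\<ge>n0. qn_dist X (u m) (u n) < e) \<Longrightarrow>
      \<exists>v\<in>vecs X. (\<lambda>n. qn_dist X v (u n)) \<longlonglongrightarrow> 0"
  shows "embeds_isomorphically X Y"
proof -
  interpret X: fun_space M N \<rho> X cls F by fact
  interpret Y: fun_space M' N' \<rho>' Y cls' F' by fact
  have T_vecs: "T v \<in> vecs Y" if "v \<in> vecs X" for v using lin that by (auto simp: qn_linear_def)
  have diff_vecs: "vadd X v (vscale X (-1) w) \<in> vecs X" if "v \<in> vecs X" "w \<in> vecs X" for v w
    using that by (auto elim!: X.vecsE simp: X.vscale_X X.vadd_X X.F_minus intro!: X.vecs_cls X.F_diff)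
  have T_dist: "qn_dist Y (T v) (T w) = qnorm Y (T (vadd X w (vscale X (-1) v)))" if "v \<in> vecs X" "w \<in> vecs X" for v w
    using that lin X.vscale_vecs[OF that(1)] by (simp add: qn_dist_def qn_linear_def)
  have dist_lower: "c * qn_dist X v w \<le> qn_dist Y (T v) (T w)"
    and dist_upper: "qn_dist Y (T v) (T w) \<le> C * qn_dist X v w" if "v \<in> vecs X" "w \<in> vecs X" for v w
    using lower[OF diff_vecs[OF that(2,1)]] upper[OF diff_vecs[OF that(2,1)]] unfolding T_dist[OF that] qn_dist_def[of X] by auto
  have X_self: "qn_dist X v v = 0" if "v \<in> vecs X" for v
    using that X.qnorm_eq_0[OF X.zero_vec] by (auto elim!: X.vecsE simp: X.qn_dist_cls)
  have Y_comm: "qn_dist Y v w = qn_dist Y w v" if "v \<in> vecs Y" "w \<in> vecs Y" for v w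
    using that by (auto elim!: Y.vecsE simp: Y.qn_dist_cls Y.qnorm_X Y.F_diff intro!: arg_cong[where f = enn2real] Y.fnorm_minus_commute)
  have Y_nonneg: "0 \<le> qn_dist Y v w" if "v \<in> vecs Y" "w \<in> vecs Y" for v w
    using that by (auto elim!: Y.vecsE simp: Y.qn_dist_cls Y.F_diff intro!: Y.qnorm_nonneg Y.vecs_cls)
  have Y_eq: "v = w" if d0: "qn_dist Y v w = 0" and v: "v \<in> vecs Y" and w: "w \<in> vecs Y" for v w
  proof -
    obtain f g where fg: "f \<in> F'" "g \<in> F'" "v = cls' f" "w = cls' g"
      using Y.vecsE[OF v] Y.vecsE[OF w] by metis
    then have "cls' (\<lambda>z. f z - g z) = Y.zero_vec"
      using d0 by (simp add: Y.qn_dist_cls Y.qnorm_eq_0 Y.vecs_cls Y.F_diff)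
    then have "AE z in M'. f z - g z = 0" using fg by (simp add: Y.cls_eq_iff Y.F_diff Y.F_zero)
    then show ?thesis using fg by (simp add: Y.cls_eq_iff)
  qed
  have inj: "inj_on T (vecs X)"
  proof (rule inj_onI)
    fix v w assume vw: "v \<in> vecs X" "w \<in> vecs X" "T v = T w"
    let ?d = "vadd X w (vscale X (-1) v)"
    have "qn_dist Y (T v) (T w) = 0"
      using vw T_vecs[of w] Y.qnorm_eq_0[OF Y.zero_vec] by (auto elim!: Y.vecsE simp: Y.qn_dist_cls)
    then have "qnorm X ?d = 0"
      using dist_lower[OF vw(1,2)] cC X.qnorm_nonneg[OF diff_vecs[OF vw(2,1)]]
      by (simp add: qn_dist_def zero_less_mult_iff mult_le_0_iff)
    then have d: "?d = X.zero_vec" using diff_vecs[OF vw(2,1)] by (simp add: X.qnorm_eq_0)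
    obtain f g where fg: "f \<in> F" "g \<in> F" "v = cls f" "w = cls g" using vw by (auto elim!: X.vecsE)
    then have "AE z in M. g z - f z = 0"
      using d by (simp add: X.vscale_X X.vadd_X X.F_minus X.cls_eq_iff X.F_diff X.F_zero)
    then have "AE z in M. f z = g z" by eventually_elim simp
    then show "v = w" using fg by (simp add: X.cls_eq_iff)
  qed
  have "continuous_map (qn_topology X) (qn_topology Y) T"
    unfolding continuous_map_def
  proof (intro conjI allI impI)
    show "T \<in> topspace (qn_topology X) \<rightarrow> topspace (qn_topology Y)"
      using T_vecs by (simp add: topspace_qn_topology)
    fix V assume V: "openin (qn_topology Y) V"
    show "openin (qn_topology X) {v \<in> topspace (qn_topology X). T v \<in> V}"
      unfolding openin_qn_topology topspace_qn_topology
    proof (intro conjI ballI)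
      fix v assume "v \<in> {v \<in> vecs X. T v \<in> V}"
      then have v: "v \<in> vecs X" "T v \<in> V" by auto
      then obtain e where e: "0 < e" "\<And>w. w \<in> vecs Y \<Longrightarrow> qn_dist Y (T v) w < e \<Longrightarrow> w \<in> V"
        using V unfolding openin_qn_topology by blast
      have "T w \<in> V" if "w \<in> vecs X" "qn_dist X v w < e / C" for w
        using that cC dist_upper[OF v(1) that(1)] by (intro e T_vecs) (auto simp: field_simps)
      then show "\<exists>d>0. \<forall>w\<in>vecs X. qn_dist X v w < d \<longrightarrow> w \<in> {v \<in> vecs X. T v \<in> V}"
        using e cC by (intro exI[of _ "e / C"]) auto
    qed auto
  qed
  then have cont: "continuous_map (qn_topology X) (subtopology (qn_topology Y) (T ` vecs X)) T"
    by (auto simp: continuous_map_in_subtopology topspace_qn_topology)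
  have "open_map (qn_topology X) (subtopology (qn_topology Y) (T ` vecs X)) T"
    unfolding open_map_def
  proof (intro allI impI)
    fix U assume U: "openin (qn_topology X) U"
    then have UX: "U \<subseteq> vecs X" by (simp add: openin_qn_topology)
    have "\<exists>e>0. \<forall>w\<in>vecs X. qn_dist X u w < e \<longrightarrow> w \<in> U" if "u \<in> U" for u
      using U that unfolding openin_qn_topology by blast
    then obtain e where e: "\<And>u. u \<in> U \<Longrightarrow> 0 < e u"
      "\<And>u w. u \<in> U \<Longrightarrow> w \<in> vecs X \<Longrightarrow> qn_dist X u w < e u \<Longrightarrow> w \<in> U" by metis
    define V where "V = (\<Union>u\<in>U. {w \<in> vecs Y. qn_dist Y (T u) w < c * e u})"
    have "openin (qn_topology Y) V"
      unfolding V_def using UX by (intro openin_Union) (auto intro!: Y.openin_ball T_vecs)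
    moreover have "T ` U = V \<inter> T ` vecs X"
    proof (intro equalityI subsetI)
      fix w assume "w \<in> T ` U"
      then obtain u where u: "u \<in> U" "w = T u" by auto
      then have ux: "u \<in> vecs X" using UX by auto
      have "qn_dist Y (T u) (T u) \<le> 0" using dist_upper[OF ux ux] X_self[OF ux] by simp
      also have "0 < c * e u" using e(1)[OF u(1)] cC by simp
      finally have "w \<in> {w \<in> vecs Y. qn_dist Y (T u) w < c * e u}" using u T_vecs[OF ux] by simp
      then show "w \<in> V \<inter> T ` vecs X" using u ux unfolding V_def by blast
    next
      fix w assume "w \<in> V \<inter> T ` vecs X"
      then obtain u v where uv: "u \<in> U" "qn_dist Y (T u) w < c * e u" "v \<in> vecs X" "w = T v"
        unfolding V_def by auto
      then have "c * qn_dist X u v < c * e u"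
        using dist_lower[of u v] UX by auto
      then have "qn_dist X u v < e u" using cC by simp
      from e(2)[OF uv(1,3) this] have "v \<in> U" .
      then show "w \<in> T ` U" using uv(4) by blast
    qed
    ultimately show "openin (subtopology (qn_topology Y) (T ` vecs X)) (T ` U)"
      by (auto simp: openin_subtopology)
  qed
  moreover have "T ` vecs X \<subseteq> vecs Y" using T_vecs by auto
  ultimately have hom: "homeomorphic_map (qn_topology X) (subtopology (qn_topology Y) (T ` vecs X)) T"
    using cont inj by (intro bijective_open_imp_homeomorphic_map) (auto simp: topspace_qn_topology)
  have "openin (qn_topology Y) (vecs Y - T ` vecs X)"
    unfolding openin_qn_topology
  proof (intro conjI ballI, rule Diff_subset, rule ccontr)
    fix w assume "w \<in> vecs Y - T ` vecs X"
    then have w: "w \<in> vecs Y" "w \<notin> T ` vecs X" by auto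
    assume "\<not> (\<exists>e>0. \<forall>y\<in>vecs Y. qn_dist Y w y < e \<longrightarrow> y \<in> vecs Y - T ` vecs X)"
    then have *: "\<exists>v\<in>vecs X. qn_dist Y w (T v) < e" if "0 < e" for e
      using that T_vecs by blast
    have "\<forall>n. \<exists>v\<in>vecs X. qn_dist Y w (T v) < inverse (Suc n)" by (intro allI *) simp
    then obtain u where u: "\<And>n. u n \<in> vecs X" "\<And>n. qn_dist Y w (T (u n)) < inverse (Suc n)" by metis
    have to0: "(\<lambda>n. qn_dist Y w (T (u n))) \<longlonglongrightarrow> 0"
      by (rule tendsto_sandwich[OF _ _ tendsto_const LIMSEQ_inverse_real_of_nat])
         (use u Y_nonneg w T_vecs in \<open>auto intro!: always_eventually less_imp_le simp del: inverse_eq_divide\<close>)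
    have to0': "(\<lambda>n. qn_dist Y w (T (u n)) powr \<rho>') \<longlonglongrightarrow> 0"
      by (rule tendsto_zero_powrI[OF to0 tendsto_const])
         (use Y.\<rho> u w T_vecs in \<open>auto intro!: always_eventually Y_nonneg\<close>)
    have "\<exists>v\<in>vecs X. (\<lambda>n. qn_dist X v (u n)) \<longlonglongrightarrow> 0"
    proof (rule complete[OF u(1)])
      fix e :: real assume e: "0 < e"
      then have "0 < (c * e) powr \<rho>' / 2" using cC by simp
      with to0' have "\<forall>\<^sub>F n in sequentially. qn_dist Y w (T (u n)) powr \<rho>' < (c * e) powr \<rho>' / 2"
        by (rule order_tendstoD)
      then obtain n0 where n0: "\<And>n. n \<ge> n0 \<Longrightarrow> qn_dist Y w (T (u n)) powr \<rho>' < (c * e) powr \<rho>' / 2"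
        by (auto simp: eventually_sequentially)
      have "qn_dist X (u m) (u n) < e" if "m \<ge> n0" "n \<ge> n0" for m n
      proof -
        have "qn_dist Y (T (u m)) (T (u n)) powr \<rho>' \<le> qn_dist Y (T (u m)) w powr \<rho>' + qn_dist Y w (T (u n)) powr \<rho>'"
          using u w T_vecs by (intro Y.qn_dist_triangle) auto
        also have "\<dots> < (c * e) powr \<rho>'"
          using n0[OF that(1)] n0[OF that(2)] Y_comm[OF T_vecs[OF u(1)[of m]] w(1)] by simp
        finally have "qn_dist Y (T (u m)) (T (u n)) < c * e"
          using Y.\<rho> e cC powr_mono2[of \<rho>' "c * e" "qn_dist Y (T (u m)) (T (u n))"] by (intro not_le_imp_less notI) auto
        then have "c * qn_dist X (u m) (u n) < c * e" using dist_lower[OF u(1) u(1), of m n] by linarith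
        then show ?thesis using cC by simp
      qed
      then show "\<exists>n0. \<forall>m\<ge>n0. \<forall>n\<ge>n0. qn_dist X (u m) (u n) < e" by blast
    qed
    then obtain v where v: "v \<in> vecs X" "(\<lambda>n. qn_dist X v (u n)) \<longlonglongrightarrow> 0" by auto
    have "(\<lambda>n. C * qn_dist X v (u n)) \<longlonglongrightarrow> C * 0" by (intro tendsto_mult v tendsto_const)
    then have "(\<lambda>n. C * qn_dist X v (u n)) \<longlonglongrightarrow> 0" by simp
    then have "(\<lambda>n. qn_dist Y (T v) (T (u n))) \<longlonglongrightarrow> 0"
      by (rule tendsto_sandwich[OF _ _ tendsto_const, rotated 2])
         (use dist_upper[OF v(1) u(1)] Y_nonneg[OF T_vecs[OF v(1)] T_vecs[OF u(1)]] in auto)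
    then have "(\<lambda>n. qn_dist Y (T v) (T (u n)) powr \<rho>') \<longlonglongrightarrow> 0"
      by (rule tendsto_zero_powrI[OF _ tendsto_const])
         (use Y.\<rho> u v T_vecs in \<open>auto intro!: always_eventually Y_nonneg\<close>)
    from tendsto_add[OF to0' this]
    have "(\<lambda>n. qn_dist Y w (T (u n)) powr \<rho>' + qn_dist Y (T v) (T (u n)) powr \<rho>') \<longlonglongrightarrow> 0" by simp
    moreover have "qn_dist Y w (T v) powr \<rho>' \<le> qn_dist Y w (T (u n)) powr \<rho>' + qn_dist Y (T v) (T (u n)) powr \<rho>'" for n
      using Y.qn_dist_triangle[OF w(1) T_vecs[OF u(1)[of n]] T_vecs[OF v(1)]]
        Y_comm[OF T_vecs[OF u(1)[of n]] T_vecs[OF v(1)]] by simp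
    ultimately have "qn_dist Y w (T v) powr \<rho>' \<le> 0"
      by (intro LIMSEQ_le_const) auto
    then have "qn_dist Y w (T v) = 0" by simp
    then have "w = T v" using w T_vecs[OF v(1)] by (intro Y_eq) auto
    then show False using w v by auto
  qed
  then have "closedin (qn_topology Y) (T ` vecs X)"
    using \<open>T ` vecs X \<subseteq> vecs Y\<close> by (simp add: closedin_def topspace_qn_topology)
  with lin hom show ?thesis by (auto simp: embeds_isomorphically_def)
qed

section \<open>The sequence spaces\<close>

lemma sets_count_space_nat: "sets (count_space UNIV :: nat measure) = sets borel"
  by (simp add: sets_borel_eq_count_space)

lemma borel_measurable_nat [simp]: "(f :: nat \<Rightarrow> _) \<in> borel_measurable borel"
  by (rule measurableI) (auto simp: sets_borel_eq_count_space)

lemma Lnorm_count_space: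
  "Lnorm (count_space UNIV) p g = enn_powr (\<Sum>n. enn_powr (g n) p) (1 / p)" for g :: "nat \<Rightarrow> ennreal"
  by (simp add: Lnorm_def nn_integral_count_space_nat)

lemma Lnorm_count_space_summable:
  fixes x :: "nat \<Rightarrow> 'k::real_normed_vector"
  assumes "summable (\<lambda>n. norm (x n) powr p)"
  shows "Lnorm (count_space UNIV) p (\<lambda>n. ennreal (norm (x n))) = ennreal ((\<Sum>n. norm (x n) powr p) powr (1 / p))"
  using assms by (simp add: Lnorm_count_space suminf_ennreal2 suminf_nonneg)

lemma Lnorm_count_space_finite_iff:
  fixes x :: "nat \<Rightarrow> 'k::real_normed_vector"
  shows "Lnorm (count_space UNIV) p (\<lambda>n. ennreal (norm (x n))) < top \<longleftrightarrow> summable (\<lambda>n. norm (x n) powr p)"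
  (is "?L \<longleftrightarrow> ?R")
proof
  assume ?L
  then have "(\<Sum>n. ennreal (norm (x n) powr p)) \<noteq> top" by (simp add: Lnorm_count_space less_top)
  then show ?R by (intro summable_suminf_not_top) auto
next
  assume ?R
  then show ?L by (simp add: Lnorm_count_space_summable)
qed

lemma fun_space_ell_space:
  assumes p: "0 < p"
  shows "fun_space (count_space UNIV) (Lnorm (count_space UNIV) p) (min 1 p)
    (ell_space p :: ('k::{real_normed_field, banach, second_countable_topology}, nat \<Rightarrow> 'k) qn_space) id
    {x. summable (\<lambda>n. norm (x n) powr p)}"
proof -
  interpret N: function_norm "count_space UNIV" "Lnorm (count_space (UNIV::nat set)) p" "min 1 p"
    by (rule function_norm_Lnorm[OF p sets_count_space_nat])
  have F: "summable (\<lambda>n. norm (x n) powr p) \<longleftrightarrow> N.fnorm x < top" for x :: "nat \<Rightarrow> 'k"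
    by (simp add: N.fnorm_def Lnorm_count_space_finite_iff)
  show ?thesis
  proof
    fix x y :: "nat \<Rightarrow> 'k" and c :: 'k
    assume x: "x \<in> {x. summable (\<lambda>n. norm (x n) powr p)}"
    then have x': "N.fnorm x < top" by (simp add: F)
    show "N.fnorm x < top" by fact
    show "(\<lambda>z. c * x z) \<in> {x. summable (\<lambda>n. norm (x n) powr p)}"
      using x' by (simp add: F N.fnorm_scale ennreal_mult_less_top)
    show "qnorm (ell_space p) (id x) = enn2real (N.fnorm x)"
      using x by (simp add: ell_space_def N.fnorm_def Lnorm_count_space_summable)
    assume "y \<in> {x. summable (\<lambda>n. norm (x n) powr p)}"
    then show "(\<lambda>z. x z + y z) \<in> {x. summable (\<lambda>n. norm (x n) powr p)}"
      using x' by (simp add: F N.fnorm_add_less_top)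
    show "id x = id y \<longleftrightarrow> (AE n in count_space UNIV. x n = y n)"
      by (auto simp: AE_count_space)
  qed (use p in \<open>auto simp: ell_space_def\<close>)
qed

lemma ell_space_complete:
  fixes u :: "nat \<Rightarrow> nat \<Rightarrow> 'k::{real_normed_field, banach, second_countable_topology}"
  assumes p: "0 < p" and u: "\<And>n. u n \<in> vecs (ell_space p)"
    and Cauchy: "\<And>e. 0 < e \<Longrightarrow> \<exists>n0. \<forall>m\<ge>n0. \<forall>n\<ge>n0. qn_dist (ell_space p) (u m) (u n) < e"
  shows "\<exists>v\<in>vecs (ell_space p). (\<lambda>n. qn_dist (ell_space p) v (u n)) \<longlonglongrightarrow> 0"
proof -
  interpret X: fun_space "count_space UNIV" "Lnorm (count_space UNIV) p" "min 1 p"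
    "ell_space p :: ('k, nat \<Rightarrow> 'k) qn_space" id "{x. summable (\<lambda>n. norm (x n) powr p)}"
    by (rule fun_space_ell_space[OF p])
  let ?F = "{x :: nat \<Rightarrow> 'k. summable (\<lambda>n. norm (x n) powr p)}"
  have uF: "u n \<in> ?F" for n using u[of n] by (simp add: ell_space_def)
  have dist: "ennreal (qn_dist (ell_space p) x y) = X.fnorm (\<lambda>n. x n - y n)" if "x \<in> ?F" "y \<in> ?F" for x y
    using X.qn_dist_cls[OF that] X.ennreal_qnorm[OF X.F_diff[OF that]] by simp
  have dist_nonneg: "0 \<le> qn_dist (ell_space p) x y" if "x \<in> ?F" "y \<in> ?F" for x y
    using X.qn_dist_cls[OF that] X.qnorm_nonneg[OF X.vecs_cls[OF X.F_diff[OF that]]] by simp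
  obtain g where g: "(\<lambda>n. X.fnorm (\<lambda>z. g z - u n z)) \<longlonglongrightarrow> 0"
  proof (rule X.Cauchy_converges[of u])
    fix e :: real assume e: "0 < e"
    then obtain n0 where "\<And>m n. n0 \<le> m \<Longrightarrow> n0 \<le> n \<Longrightarrow> qn_dist (ell_space p) (u m) (u n) < e"
      using Cauchy by blast
    then show "\<exists>n0. \<forall>m\<ge>n0. \<forall>n\<ge>n0. X.fnorm (\<lambda>z. u m z - u n z) < ennreal e"
      using e by (intro exI[of _ n0]) (auto simp: dist[OF uF uF, symmetric] ennreal_less_iff dist_nonneg[OF uF uF])
  qed auto
  have "\<forall>\<^sub>F n in sequentially. X.fnorm (\<lambda>z. g z - u n z) < 1"
    using g by (rule order_tendstoD) simp
  then obtain n where "X.fnorm (\<lambda>z. g z - u n z) < 1"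
    using eventually_happens'[OF sequentially_bot] by blast
  then have "X.fnorm (\<lambda>z. g z - u n z) < top" by (rule less_trans) simp
  from X.fnorm_add_less_top[OF _ _ this X.F_finite[OF uF[of n]]] have "X.fnorm g < top" by simp
  then have gF: "g \<in> ?F" by (simp add: X.fnorm_def Lnorm_count_space_finite_iff)
  have "(\<lambda>n. ennreal (qn_dist (ell_space p) g (u n))) \<longlonglongrightarrow> ennreal 0"
    using g by (simp add: dist[OF gF uF])
  then have "(\<lambda>n. qn_dist (ell_space p) g (u n)) \<longlonglongrightarrow> 0"
    by (rule tendsto_ennrealD) (auto simp: dist_nonneg[OF gF uF])
  moreover have "g \<in> vecs (ell_space p)" using gF by (simp add: ell_space_def)
  ultimately show ?thesis by blast
qed

lemma function_norm_Sup: "function_norm (count_space UNIV) (\<lambda>g :: nat \<Rightarrow> ennreal. SUP n. g n) 1"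
proof
  fix g h :: "nat \<Rightarrow> ennreal"
  show "sets (count_space UNIV :: nat measure) = sets borel" by (rule sets_count_space_nat)
  have "(SUP n. g n + h n) \<le> (SUP n. g n) + (SUP n. h n)"
    by (intro SUP_least add_mono SUP_upper) auto
  then show "enn_powr (SUP n. g n + h n) 1 \<le> enn_powr (SUP n. g n) 1 + enn_powr (SUP n. h n) 1" by simp
  show "(SUP n. c * g n) = c * (SUP n. g n)" for c by (simp add: SUP_mult_left_ennreal)
  show "((SUP n. g n) = 0) = (AE n in count_space UNIV. g n = 0)"
    by (auto simp: AE_count_space SUP_eq_iff bot_ennreal[symmetric] SUP_bot_conv)
  show "(AE n in count_space UNIV. g n < top)" if "(SUP n. g n) < top"
    using le_less_trans[OF SUP_upper that] by (auto simp: AE_count_space)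
  show "(SUP n. SUP i. G i n) = (SUP i. SUP n. G i n)" for G :: "nat \<Rightarrow> nat \<Rightarrow> ennreal"
    by (rule SUP_commute)
  show "(SUP n. g n) \<le> (SUP n. h n)" if "AE n in count_space UNIV. g n \<le> h n"
    using that by (intro SUP_mono') (auto simp: AE_count_space)
qed auto

text \<open>For \<open>c\<^sub>0\<close> the linear space \<open>F\<close> of the locale is smaller than the space of all functions with finite norm.\<close>

lemma fun_space_c0_space:
  "fun_space (count_space UNIV) (\<lambda>g. SUP n. g n) 1
    (c0_space :: ('k::{real_normed_field, banach, second_countable_topology}, nat \<Rightarrow> 'k) qn_space) id
    {x. x \<longlonglongrightarrow> 0}"
proof -
  interpret N: function_norm "count_space UNIV" "\<lambda>g :: nat \<Rightarrow> ennreal. SUP n. g n" 1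
    by (rule function_norm_Sup)
  have fin: "N.fnorm x = ennreal (SUP n. norm (x n))" if "x \<longlonglongrightarrow> 0" for x :: "nat \<Rightarrow> 'k"
  proof -
    have bdd: "bdd_above (range (\<lambda>n. norm (x n)))"
      using convergent_imp_Bseq[of x] that by (auto simp: convergent_def Bseq_def bdd_above_def)
    show ?thesis
      unfolding N.fnorm_def
    proof (rule antisym)
      show "(SUP n. ennreal (norm (x n))) \<le> ennreal (SUP n. norm (x n))"
        using bdd by (intro SUP_least ennreal_leI cSUP_upper) auto
      show "ennreal (SUP n. norm (x n)) \<le> (SUP n. ennreal (norm (x n)))" (is "_ \<le> ?S")
      proof (cases ?S)
        case (real b)
        have "norm (x n) \<le> b" for n
          using SUP_upper[of n UNIV "\<lambda>n. ennreal (norm (x n))"] real by simp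
        then show ?thesis using real by (auto intro!: ennreal_leI cSUP_least)
      next
        case top
        then show ?thesis by (metis top_greatest)
      qed
    qed
  qed
  have pos: "0 \<le> (SUP n. norm (x n))" if "x \<longlonglongrightarrow> 0" for x :: "nat \<Rightarrow> 'k"
  proof -
    have bdd: "bdd_above (range (\<lambda>n. norm (x n)))"
      using convergent_imp_Bseq[of x] that by (auto simp: convergent_def Bseq_def bdd_above_def)
    have "0 \<le> norm (x 0)" by simp
    also have "\<dots> \<le> (SUP n. norm (x n))" using bdd by (intro cSUP_upper) auto
    finally show ?thesis .
  qed
  show ?thesis
  proof
    fix x y :: "nat \<Rightarrow> 'k" and c :: 'k
    assume x: "x \<in> {x. x \<longlonglongrightarrow> 0}"
    then show "N.fnorm x < top" by (simp add: fin)
    show "(\<lambda>z. c * x z) \<in> {x. x \<longlonglongrightarrow> 0}" using x by (simp add: tendsto_mult_right_zero)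
    show "qnorm c0_space (id x) = enn2real (N.fnorm x)"
      using x pos by (simp add: c0_space_def fin)
    assume "y \<in> {x. x \<longlonglongrightarrow> 0}"
    then show "(\<lambda>z. x z + y z) \<in> {x. x \<longlonglongrightarrow> 0}" using x by (simp add: tendsto_add_zero)
    show "id x = id y \<longleftrightarrow> (AE n in count_space UNIV. x n = y n)"
      by (auto simp: AE_count_space)
  qed (auto simp: c0_space_def)
qed

section \<open>The space \<open>L\<^sub>s(L\<^sub>r)\<close> as a space of Borel functions\<close>

lemma AE_unit_measure_iff: "(AE x in unit_measure. P x) \<longleftrightarrow> (AE x in lebesgue_on {0..1}. P x)"
proof -
  have "(AE x in unit_measure. P x) \<longleftrightarrow> (AE x in lborel. x \<in> {0..1} \<longrightarrow> P x)"
    unfolding unit_measure_def by (subst AE_density) (auto intro!: AE_cong simp: indicator_def)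
  then show ?thesis by (subst AE_restrict_space_iff) (auto simp: AE_completion_iff)
qed

lemma AE_unit_square_iff: "(AE z in unit_square_measure. P z) \<longleftrightarrow> (AE z in unit_sq. P z)"
proof -
  have "unit_square_measure = density (lborel \<Otimes>\<^sub>M lborel) (\<lambda>(x, y). indicator {0..1} x * indicator {0..1} y)"
    unfolding unit_measure_def
    by (rule pair_measure_density)
       (auto intro: lborel.sigma_finite_measure_axioms unit_measure.sigma_finite_measure_axioms[unfolded unit_measure_def])
  also have "lborel \<Otimes>\<^sub>M lborel = (lborel :: (real \<times> real) measure)" by (rule lborel_prod)
  finally have eq: "unit_square_measure = density lborel (\<lambda>(x, y). indicator {0..1} x * indicator {0..1} y)" .
  have "(AE z in unit_square_measure. P z) \<longleftrightarrow> (AE z in lborel. z \<in> {0..1} \<times> {0..1} \<longrightarrow> P z)"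
    unfolding eq
  proof (subst AE_density)
    show "(\<lambda>(x::real, y::real). indicator {0..1} x * indicator {0..1} y :: ennreal) \<in> borel_measurable lborel"
    proof -
      have eq: "(\<lambda>(x::real, y::real). indicator {0..1} x * indicator {0..1} y) = (indicator ({0..1} \<times> {0..1}) :: real \<times> real \<Rightarrow> ennreal)"
        by (auto simp: fun_eq_iff indicator_def)
      have [measurable]: "{0..1::real} \<times> {0..1::real} \<in> sets borel"
        by (simp add: borel_closed closed_Times)
      show ?thesis unfolding eq by measurable
    qed
  qed (auto intro!: AE_cong simp: indicator_def of_bool_def split: if_splits)
  moreover have "{0..1::real} \<times> {0..1::real} \<in> sets borel"
    by (intro borel_closed closed_Times) auto
  ultimately show ?thesis unfolding unit_sq_def
    by (subst AE_restrict_space_iff) (auto simp: AE_completion_iff)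
qed

lemma borel_measurable_unit_sq:
  "f \<in> borel_measurable borel \<Longrightarrow> f \<in> borel_measurable unit_sq" for f :: "real \<times> real \<Rightarrow> _"
  unfolding unit_sq_def by (intro measurable_restrict_space1 measurable_completion) simp

text \<open>A measurable function for the completed measure agrees almost everywhere with a Borel function; for values in a
  Euclidean space this is applied to the coordinates.\<close>

lemma unit_sq_borel_version:
  fixes f :: "real \<times> real \<Rightarrow> 'k::euclidean_space"
  assumes "f \<in> borel_measurable unit_sq"
  obtains g where "g \<in> borel_measurable borel" "AE z in unit_sq. f z = g z"
proof -
  let ?S = "{0..1::real} \<times> {0..1::real}"
  have S: "?S \<in> sets borel" by (intro borel_closed closed_Times) auto
  define h where "h z = (if z \<in> ?S then f z else 0)" for z
  have f: "h \<in> borel_measurable lebesgue"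
    using assms S unfolding unit_sq_def h_def by (intro borel_measurable_if_I) auto
  have "\<forall>b. \<exists>g. g \<in> borel_measurable borel \<and> (AE z in lborel. h z \<bullet> b = g z)"
    using completion_ex_borel_measurable_real[of "\<lambda>z. h z \<bullet> _" lborel] f by auto
  then obtain g where "\<forall>b. g b \<in> borel_measurable borel \<and> (AE z in lborel. h z \<bullet> b = g b z)"
    by (rule choice[THEN exE])
  then have g: "g b \<in> borel_measurable borel" "AE z in lborel. h z \<bullet> b = g b z" for b
    by auto
  have "AE z in lborel. \<forall>b\<in>Basis. h z \<bullet> b = g b z"
    using g by (intro AE_finite_allI) auto
  then have "AE z in lborel. h z = (\<Sum>b\<in>Basis. g b z *\<^sub>R b)"
    by eventually_elim (metis (no_types, lifting) euclidean_representation sum.cong)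
  then have "AE z in lborel. z \<in> ?S \<longrightarrow> f z = (\<Sum>b\<in>Basis. g b z *\<^sub>R b)"
    by eventually_elim (auto simp: h_def)
  then have "AE z in unit_sq. f z = (\<Sum>b\<in>Basis. g b z *\<^sub>R b)"
    unfolding unit_sq_def using S by (subst AE_restrict_space_iff) (auto simp: AE_completion_iff)
  moreover have "(\<lambda>z. \<Sum>b\<in>Basis. g b z *\<^sub>R b) \<in> borel_measurable borel"
    using g by (intro borel_measurable_sum borel_measurable_scaleR) auto
  ultimately show thesis by (intro that)
qed

lemma nn_integral_lebesgue_on_unit:
  "f \<in> borel_measurable borel \<Longrightarrow> (\<integral>\<^sup>+x. f x \<partial>lebesgue_on {0..1::real}) = (\<integral>\<^sup>+x. f x \<partial>unit_measure)"
  by (simp add: nn_integral_restrict_space nn_integral_completion nn_integral_unit_measure)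

text \<open>A Lebesgue measurable function may have non-measurable sections. By Fubini's theorem almost all
  sections agree almost everywhere with those of a Borel version, and the integrals only depend on that.\<close>

lemma mixed_integral_eq_mixed_norm:
  fixes g :: "real \<times> real \<Rightarrow> 'k::{real_normed_field, second_countable_topology}"
  assumes s: "0 < s" and r: "0 < r" and [measurable]: "g \<in> borel_measurable borel"
    and eq: "AE z in unit_sq. f z = g z"
  shows "mixed_integral s r f = enn_powr (mixed_norm s r (\<lambda>z. ennreal (norm (g z)))) s"
proof -
  have sr: "0 < s / r" using s r by simp
  have "AE x in lebesgue_on {0..1}. AE y in lebesgue_on {0..1}. f (x, y) = g (x, y)"
    using AE_sections[of "\<lambda>z. f z = g z"] eq by (simp add: AE_unit_square_iff AE_unit_measure_iff)
  then have "mixed_integral s r f = mixed_integral s r g"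
    unfolding mixed_integral_def
    by (intro nn_integral_cong_AE)
       (auto elim!: eventually_mono intro!: arg_cong2[where f = enn_powr] nn_integral_cong_AE)
  also have "\<dots> = (\<integral>\<^sup>+x. enn_powr (\<integral>\<^sup>+y. enn_powr (ennreal (norm (g (x, y)))) r \<partial>unit_measure) (s / r) \<partial>unit_measure)"
  proof -
    have inner: "(\<integral>\<^sup>+y. ennreal (norm (g (x, y)) powr r) \<partial>lebesgue_on {0..1})
      = enn_powr (Lnorm unit_measure r (\<lambda>y. ennreal (norm (g (x, y))))) r" for x
      using r by (subst nn_integral_lebesgue_on_unit) (auto simp: enn_powr_Lnorm)
    have meas: "(\<lambda>x. enn_powr (enn_powr (Lnorm unit_measure r (\<lambda>y. ennreal (norm (g (x, y))))) r) (s / r)) \<in> borel_measurable borel"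
      using r sr by measurable
    show ?thesis
      unfolding mixed_integral_def inner nn_integral_lebesgue_on_unit[OF meas]
      by (simp only: enn_powr_Lnorm[OF r])
  qed
  also have "\<dots> = enn_powr (mixed_norm s r (\<lambda>z. ennreal (norm (g z)))) s"
  proof -
    have "enn_powr (Lnorm unit_measure r h) s = enn_powr (\<integral>\<^sup>+y. enn_powr (h y) r \<partial>unit_measure) (s / r)" for h
      by (simp add: Lnorm_def enn_powr_enn_powr)
    then show ?thesis by (simp only: mixed_norm_def enn_powr_Lnorm[OF s])
  qed
  finally show ?thesis .
qed

lemma equiv_mixed_rel: "equiv (mixed_funs s r) (mixed_rel s r)"
  by (rule equivI) (auto simp: mixed_rel_def refl_on_def intro!: symI transI elim: eventually_mono eventually_elim2)

definition mixed_class :: "real \<Rightarrow> real \<Rightarrow> (real \<times> real \<Rightarrow> 'k::real_normed_field) \<Rightarrow> (real \<times> real \<Rightarrow> 'k) set" where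
  "mixed_class s r f = mixed_rel s r `` {f}"

text \<open>The Borel functions of finite quasi-norm. Every class of the mixed-norm space contains one of them, so
  they serve as representatives.\<close>

definition mixed_borel :: "real \<Rightarrow> real \<Rightarrow> (real \<times> real \<Rightarrow> 'k::real_normed_field) set" where
  "mixed_borel s r = {f \<in> borel_measurable borel. mixed_norm s r (\<lambda>z. ennreal (norm (f z))) < top}"

lemma mixed_funs_iff:
  fixes f :: "real \<times> real \<Rightarrow> 'k::{real_normed_field, euclidean_space}"
  assumes "0 < s" "0 < r" "g \<in> borel_measurable borel" "AE z in unit_sq. f z = g z" "f \<in> borel_measurable unit_sq"
  shows "f \<in> mixed_funs s r \<longleftrightarrow> g \<in> mixed_borel s r"
  using assms by (simp add: mixed_funs_def mixed_borel_def mixed_integral_eq_mixed_norm)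

lemma mixed_borel_imp_funs:
  fixes f :: "real \<times> real \<Rightarrow> 'k::{real_normed_field, euclidean_space}"
  shows "0 < s \<Longrightarrow> 0 < r \<Longrightarrow> f \<in> mixed_borel s r \<Longrightarrow> f \<in> mixed_funs s r"
  using mixed_funs_iff[of s r f f] by (simp add: mixed_borel_def borel_measurable_unit_sq)

lemma fun_space_mixed_L:
  assumes s: "0 < s" and r: "0 < r"
  shows "fun_space unit_square_measure (mixed_norm s r) (min 1 (min s r))
    (mixed_L s r :: ('k::{real_normed_field, euclidean_space}, (real \<times> real \<Rightarrow> 'k) set) qn_space)
    (mixed_class s r) (mixed_borel s r)"
proof -
  interpret N: function_norm unit_square_measure "mixed_norm s r" "min 1 (min s r)"
    by (rule function_norm_mixed_norm[OF s r])
  let ?R = "mixed_rel s r :: ((real \<times> real \<Rightarrow> 'k) \<times> (real \<times> real \<Rightarrow> 'k)) set"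
  have F: "f \<in> mixed_borel s r \<longleftrightarrow> f \<in> borel_measurable borel \<and> N.fnorm f < top" for f :: "real \<times> real \<Rightarrow> 'k"
    by (simp add: mixed_borel_def N.fnorm_def)
  have add: "(\<lambda>z. f z + g z) \<in> mixed_borel s r" if "f \<in> mixed_borel s r" "g \<in> mixed_borel s r" for f g :: "real \<times> real \<Rightarrow> 'k"
    using that by (auto simp: F intro: N.fnorm_add_less_top)
  have scale: "(\<lambda>z. c * f z) \<in> mixed_borel s r" if "f \<in> mixed_borel s r" for c and f :: "real \<times> real \<Rightarrow> 'k"
  proof -
    have f: "f \<in> borel_measurable borel" "N.fnorm f < top" using that by (simp_all add: F)
    then have "(\<lambda>z. c * f z) \<in> borel_measurable borel" by measurable
    moreover have "N.fnorm (\<lambda>z. c * f z) < top"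
      unfolding N.fnorm_scale[OF f(1)] using f(2) by (simp add: ennreal_mult_less_top)
    ultimately show ?thesis by (simp only: F)
  qed
  have cls_iff: "h \<in> mixed_class s r f \<longleftrightarrow> h \<in> borel_measurable unit_sq \<and> (AE z in unit_sq. h z = f z)"
    if f: "f \<in> mixed_borel s r" for f h :: "real \<times> real \<Rightarrow> 'k"
    using mixed_borel_imp_funs[OF s r f] mixed_funs_iff[OF s r, of f h] f
    by (auto simp: mixed_class_def mixed_rel_def F mixed_funs_def elim: eventually_mono)
  have self: "f \<in> mixed_class s r f" if f: "f \<in> mixed_borel s r" for f :: "real \<times> real \<Rightarrow> 'k"
    using f by (simp add: cls_iff F borel_measurable_unit_sq)
  have class_eq: "mixed_rel s r `` {h} = mixed_class s r f"
    if f: "f \<in> mixed_borel s r" and h: "h \<in> borel_measurable unit_sq" "AE z in unit_sq. h z = f z"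
    for f h :: "real \<times> real \<Rightarrow> 'k"
    using cls_iff[OF f, of h] h equiv_class_eq[OF equiv_mixed_rel, of f h s r] by (simp add: mixed_class_def)
  show ?thesis
  proof
    show "vecs (mixed_L s r) = mixed_class s r ` (mixed_borel s r :: (real \<times> real \<Rightarrow> 'k) set)"
    proof (intro equalityI subsetI)
      fix A :: "(real \<times> real \<Rightarrow> 'k) set" assume "A \<in> vecs (mixed_L s r)"
      then obtain h where h: "h \<in> mixed_funs s r" "A = ?R `` {h}" by (auto simp: mixed_L_def elim!: quotientE)
      then have hm: "h \<in> borel_measurable unit_sq" by (simp add: mixed_funs_def)
      then obtain g where g: "g \<in> borel_measurable borel" "AE z in unit_sq. h z = g z" by (rule unit_sq_borel_version)
      then have "g \<in> mixed_borel s r" using mixed_funs_iff[OF s r g hm] h by simp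
      then show "A \<in> mixed_class s r ` mixed_borel s r" using class_eq[OF _ hm g(2)] h by auto
    next
      fix A :: "(real \<times> real \<Rightarrow> 'k) set" assume "A \<in> mixed_class s r ` mixed_borel s r"
      then show "A \<in> vecs (mixed_L s r)"
        using mixed_borel_imp_funs[OF s r] by (auto simp: mixed_L_def mixed_class_def intro!: quotientI)
    qed
    fix f g :: "real \<times> real \<Rightarrow> 'k" and c :: 'k
    assume f: "f \<in> mixed_borel s r"
    then show "f \<in> borel_measurable borel" "N.fnorm f < top" by (auto simp: F)
    show "(\<lambda>z. c * f z) \<in> mixed_borel s r" by (rule scale[OF f])
    have "?R `` {\<lambda>z. c * h z} = mixed_class s r (\<lambda>z. c * f z)" if "h \<in> mixed_class s r f" for h
    proof (rule class_eq[OF scale[OF f]])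
      have h: "h \<in> borel_measurable unit_sq" "AE z in unit_sq. h z = f z"
        using that unfolding cls_iff[OF f] by auto
      show "(\<lambda>z. c * h z) \<in> borel_measurable unit_sq" using h(1) by measurable
      show "AE z in unit_sq. c * h z = c * f z" using h(2) by eventually_elim simp
    qed
    then show "vscale (mixed_L s r) c (mixed_class s r f) = mixed_class s r (\<lambda>z. c * f z)"
      using self[OF f] by (auto simp: mixed_L_def)
    have "enn2real (mixed_integral s r h) powr (1 / s) = enn2real (N.fnorm f)" if "h \<in> mixed_class s r f" for h
    proof -
      have "mixed_integral s r h = enn_powr (N.fnorm f) s"
        unfolding N.fnorm_def
      proof (rule mixed_integral_eq_mixed_norm[OF s r])
        show "f \<in> borel_measurable borel" using f by (simp add: F)
        show "AE z in unit_sq. h z = f z" using that unfolding cls_iff[OF f] by auto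
      qed
      then show ?thesis
        using f s by (cases "N.fnorm f") (auto simp: F powr_powr)
    qed
    then show "qnorm (mixed_L s r) (mixed_class s r f) = enn2real (N.fnorm f)"
      using self[OF f] by (auto simp: mixed_L_def intro!: the_elem_image_unique)
    assume g: "g \<in> mixed_borel s r"
    show "(\<lambda>z. f z + g z) \<in> mixed_borel s r" by (rule add[OF f g])
    have "?R `` {\<lambda>z. h z + k z} = mixed_class s r (\<lambda>z. f z + g z)"
      if "h \<in> mixed_class s r f" "k \<in> mixed_class s r g" for h k
    proof (rule class_eq[OF add[OF f g]])
      have h: "h \<in> borel_measurable unit_sq" "AE z in unit_sq. h z = f z"
        using that unfolding cls_iff[OF f] by auto
      have k: "k \<in> borel_measurable unit_sq" "AE z in unit_sq. k z = g z"
        using that unfolding cls_iff[OF g] by auto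
      show "(\<lambda>z. h z + k z) \<in> borel_measurable unit_sq" using h(1) k(1) by measurable
      show "AE z in unit_sq. h z + k z = f z + g z" using h(2) k(2) by eventually_elim simp
    qed
    then show "vadd (mixed_L s r) (mixed_class s r f) (mixed_class s r g) = mixed_class s r (\<lambda>z. f z + g z)"
      using self[OF f] self[OF g] by (auto simp: mixed_L_def)
    show "mixed_class s r f = mixed_class s r g \<longleftrightarrow> (AE z in unit_square_measure. f z = g z)"
      using f g self[OF f] cls_iff[OF g, of f] class_eq[OF g, of f]
      by (auto simp: AE_unit_square_iff F borel_measurable_unit_sq mixed_class_def)
  next
    show "(\<lambda>z. 0) \<in> (mixed_borel s r :: (real \<times> real \<Rightarrow> 'k) set)" by (simp add: F)
  qed
qed

section \<open>Embeddings of \<open>\<ell>\<^sub>p\<close> as sequences of functions\<close>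

abbreviation mixed_fnorm :: "real \<Rightarrow> real \<Rightarrow> (real \<times> real \<Rightarrow> 'k::real_normed_vector) \<Rightarrow> ennreal" where
  "mixed_fnorm s r f \<equiv> mixed_norm s r (\<lambda>z. ennreal (norm (f z)))"

abbreviation signed_norm ::
    "real \<Rightarrow> real \<Rightarrow> (nat \<Rightarrow> real \<times> real \<Rightarrow> 'k::real_normed_vector) \<Rightarrow> nat set \<Rightarrow> nat set \<Rightarrow> ennreal" where
  "signed_norm s r h I B \<equiv> mixed_fnorm s r (\<lambda>z. \<Sum>i\<in>I. sgn_of B i *\<^sub>R h i z)"

text \<open>If \<open>\<ell>\<^sub>p\<close> embeds, the images of the unit vectors form a sequence of functions all of whose signed
  sums over \<open>n\<close> indices have quasi-norm of order \<open>n powr \<tau>\<close> with \<open>\<tau> = 1/p\<close>, and \<open>\<tau> = 0\<close> for \<open>c\<^sub>0\<close>. The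
  bounds on \<open>p\<close> will be bounds on \<open>\<tau>\<close> for sequences of this kind. For \<open>n = 0\<close> the conditions hold since
  \<open>0 powr \<tau> = 0\<close>.\<close>

definition spreads :: "real \<Rightarrow> real \<Rightarrow> real \<Rightarrow> (nat \<Rightarrow> real \<times> real \<Rightarrow> 'k::real_normed_vector) \<Rightarrow> bool" where
  "spreads s r \<tau> h \<longleftrightarrow> (\<forall>i. h i \<in> borel_measurable borel) \<and>
    (\<exists>c>0. \<exists>C>0. \<forall>I B. finite I \<longrightarrow>
      ennreal (c * real (card I) powr \<tau>) \<le> signed_norm s r h I B \<and>
      signed_norm s r h I B \<le> ennreal (C * real (card I) powr \<tau>))"

definition sign_vec :: "nat set \<Rightarrow> nat set \<Rightarrow> nat \<Rightarrow> 'k::real_normed_field" where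
  "sign_vec I B n = (if n \<in> I then of_real (sgn_of B n) else 0)"

lemma abs_sgn_of [simp]: "\<bar>sgn_of B n\<bar> = 1"
  by (simp add: sgn_of_def)

lemma spreads_of_embedding:
  fixes X :: "('k::{real_normed_field, euclidean_space}, nat \<Rightarrow> 'k) qn_space"
  assumes s: "0 < s" and r: "0 < r"
    and X: "fun_space (count_space UNIV) N \<rho> X id F"
    and emb: "embeds_isomorphically X (mixed_L s r)"
    and F: "\<And>I B. finite I \<Longrightarrow> sign_vec I B \<in> F"
    and norm_F: "\<And>I B. finite I \<Longrightarrow> qnorm X (sign_vec I B) = real (card I) powr \<tau>"
  obtains h :: "nat \<Rightarrow> real \<times> real \<Rightarrow> 'k" where "spreads s r \<tau> h"
proof -
  interpret X: fun_space "count_space UNIV" N \<rho> X id F by fact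
  interpret Y: fun_space unit_square_measure "mixed_norm s r" "min 1 (min s r)"
    "mixed_L s r :: ('k, _) qn_space" "mixed_class s r" "mixed_borel s r"
    by (rule fun_space_mixed_L[OF s r])
  obtain T c C where T: "qn_linear X (mixed_L s r) T" "0 < c" "0 < C"
    "\<And>v. v \<in> vecs X \<Longrightarrow> c * qnorm X v \<le> qnorm (mixed_L s r) (T v)"
    "\<And>v. v \<in> vecs X \<Longrightarrow> qnorm (mixed_L s r) (T v) \<le> C * qnorm X v"
    by (rule embeds_isomorphically_bounds[OF X Y.fun_space_axioms emb]) (rule that)
  have vX: "v \<in> vecs X" if "v \<in> F" for v using X.vecs_cls[OF that] by simp
  have "T (sign_vec {i} UNIV) \<in> vecs (mixed_L s r)" for i
    using T(1) vX[OF F[of "{i}" UNIV]] by (simp add: qn_linear_def)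
  then have "\<exists>f\<in>mixed_borel s r. T (sign_vec {i} UNIV) = mixed_class s r f" for i
    using Y.vecsE by metis
  then obtain h where h: "\<And>i. h i \<in> mixed_borel s r" "\<And>i. T (sign_vec {i} UNIV) = mixed_class s r (h i)" by metis
  have sums: "(\<lambda>z. \<Sum>i\<in>I. sgn_of B i *\<^sub>R h i z) \<in> mixed_borel s r \<and>
      T (sign_vec I B) = mixed_class s r (\<lambda>z. \<Sum>i\<in>I. sgn_of B i *\<^sub>R h i z)" if "finite I" for I B
    using that
  proof (induction I)
    case empty
    have "T (vscale X 0 (sign_vec {} B)) = vscale (mixed_L s r) 0 (T (sign_vec {} B))"
      using T(1) vX[OF F[of "{}" B]] by (simp add: qn_linear_def)
    moreover have "vscale X 0 (sign_vec {} B) = sign_vec {} B"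
      using X.vscale_zero[OF vX[OF F[of "{}" B]]] by (simp add: sign_vec_def fun_eq_iff)
    moreover have "T (sign_vec {} B) \<in> vecs (mixed_L s r)"
      using T(1) vX[OF F[of "{}" B]] by (simp add: qn_linear_def)
    ultimately show ?case using Y.F_zero by (simp add: Y.vscale_zero)
  next
    case (insert i I)
    have eq: "sign_vec (insert i I) B = (\<lambda>n. of_real (sgn_of B i) * sign_vec {i} UNIV n + sign_vec I B n)"
      using insert by (auto simp: sign_vec_def fun_eq_iff sgn_of_def)
    have "sign_vec (insert i I) B = vadd X (vscale X (of_real (sgn_of B i)) (sign_vec {i} UNIV)) (sign_vec I B)"
      using X.vscale_X[OF F[of "{i}" UNIV]] X.vadd_X[OF X.F_scale[OF F[of "{i}" UNIV]] F[OF insert(1), of B]] eq by simp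
    then have "T (sign_vec (insert i I) B)
        = vadd (mixed_L s r) (vscale (mixed_L s r) (of_real (sgn_of B i)) (T (sign_vec {i} UNIV))) (T (sign_vec I B))"
      using T(1) vX[OF F[of "{i}" UNIV]] vX[OF F[OF insert(1), of B]] X.vscale_vecs[OF vX[OF F[of "{i}" UNIV]]]
      by (simp add: qn_linear_def)
    also have "\<dots> = mixed_class s r (\<lambda>z. of_real (sgn_of B i) * h i z + (\<Sum>i\<in>I. sgn_of B i *\<^sub>R h i z))"
      using insert.IH h by (simp add: Y.vscale_X Y.vadd_X Y.F_scale)
    also have "(\<lambda>z. of_real (sgn_of B i) * h i z + (\<Sum>i\<in>I. sgn_of B i *\<^sub>R h i z)) = (\<lambda>z. \<Sum>i\<in>insert i I. sgn_of B i *\<^sub>R h i z)"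
      using insert by (simp add: scaleR_conv_of_real)
    finally show ?case
      using Y.F_add[OF Y.F_scale[OF h(1)[of i], of "of_real (sgn_of B i)"], of "\<lambda>z. \<Sum>i\<in>I. sgn_of B i *\<^sub>R h i z"] insert
      by (simp add: scaleR_conv_of_real)
  qed
  have "ennreal (c * real (card I) powr \<tau>) \<le> signed_norm s r h I B \<and>
      signed_norm s r h I B \<le> ennreal (C * real (card I) powr \<tau>)"
    if "finite I" for I B
  proof -
    have "signed_norm s r h I B = ennreal (qnorm (mixed_L s r) (T (sign_vec I B)))"
      using sums[OF that, of B] Y.ennreal_qnorm[of "\<lambda>z. \<Sum>i\<in>I. sgn_of B i *\<^sub>R h i z"] by (simp add: Y.fnorm_def)
    then show ?thesis
      using T(4,5)[OF vX[OF F[OF that, of B]]] norm_F[OF that, of B] by (simp add: ennreal_leI)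
  qed
  then have "spreads s r \<tau> h"
    unfolding spreads_def using T(2,3) h(1) by (auto simp: Y.F_measurable)
  then show thesis by (rule that)
qed

lemma embedding_imp_spreads:
  assumes s: "0 < s" and r: "0 < r" and p: "0 < p"
    and emb: "embeds_isomorphically (ell p :: ('k::{real_normed_field, euclidean_space}, nat \<Rightarrow> 'k) qn_space) (mixed_L s r)"
  obtains h :: "nat \<Rightarrow> real \<times> real \<Rightarrow> 'k::{real_normed_field, euclidean_space}" where "spreads s r (if p = \<infinity> then 0 else 1 / real_of_ereal p) h"
proof (cases "p = \<infinity>")
  case True
  show thesis
  proof (rule spreads_of_embedding[OF s r fun_space_c0_space, of "0"])
    show "embeds_isomorphically (c0_space :: ('k, _) qn_space) (mixed_L s r)"
      using emb True by (simp add: ell_def)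
    show "sign_vec I B \<in> {x :: nat \<Rightarrow> 'k. x \<longlonglongrightarrow> 0}" if "finite I" for I B
    proof -
      have "\<forall>\<^sub>F n in sequentially. n \<notin> I"
        using that by (metis cofinite_eq_sequentially eventually_cofinite finite_Collect_not finite_nat_set_iff_bounded mem_Collect_eq not_not Collect_mem_eq)
      then have "\<forall>\<^sub>F n in sequentially. sign_vec I B n = (0 :: 'k)"
        by eventually_elim (simp add: sign_vec_def)
      then show ?thesis by (simp add: tendsto_eventually)
    qed
    show "qnorm c0_space (sign_vec I B :: nat \<Rightarrow> 'k) = real (card I) powr 0" if "finite I" for I B
    proof (cases "I = {}")
      case False
      then obtain i where i: "i \<in> I" by auto
      have "(SUP n. norm (sign_vec I B n :: 'k)) = 1"
      proof (rule antisym)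
        show "(SUP n. norm (sign_vec I B n :: 'k)) \<le> 1"
          by (rule cSUP_least) (auto simp: sign_vec_def)
        have "norm (sign_vec I B i :: 'k) \<le> (SUP n. norm (sign_vec I B n :: 'k))"
          by (rule cSUP_upper) (auto simp: sign_vec_def intro!: bdd_aboveI[of _ 1])
        then show "1 \<le> (SUP n. norm (sign_vec I B n :: 'k))" using i by (simp add: sign_vec_def)
      qed
      then show ?thesis using that False by (simp add: c0_space_def)
    qed (simp add: c0_space_def sign_vec_def)
  qed (use True that in auto)
next
  case False
  define q where "q = real_of_ereal p"
  have q: "0 < q" using p False by (cases p) (auto simp: q_def)
  have fin: "(\<lambda>n. norm (sign_vec I B n :: 'k) powr q) sums real (card I)" if "finite I" for I B
  proof -
    have "(\<lambda>n. norm (sign_vec I B n :: 'k) powr q) sums (\<Sum>n\<in>I. norm (sign_vec I B n :: 'k) powr q)"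
      using that by (rule sums_finite) (simp add: sign_vec_def)
    then show ?thesis by (simp add: sign_vec_def)
  qed
  show thesis
  proof (rule spreads_of_embedding[OF s r fun_space_ell_space[OF q], of "1 / q"])
    show "embeds_isomorphically (ell_space q :: ('k, _) qn_space) (mixed_L s r)"
      using emb False by (simp add: ell_def q_def)
    show "sign_vec I B \<in> {x :: nat \<Rightarrow> 'k. summable (\<lambda>n. norm (x n) powr q)}" if "finite I" for I B
      using fin[OF that, of B] by (simp add: sums_iff)
    show "qnorm (ell_space q) (sign_vec I B :: nat \<Rightarrow> 'k) = real (card I) powr (1 / q)" if "finite I" for I B
      using fin[OF that, of B] by (simp add: ell_space_def sums_iff)
  qed (use False that q_def in auto)
qed

text \<open>Conversely, it suffices to bound the finite sums of a sequence of functions: completeness extends the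
  map from finitely supported sequences to all of \<open>\<ell>\<^sub>p\<close>.\<close>

lemma embeds_if_finite_sums:
  fixes h :: "nat \<Rightarrow> real \<times> real \<Rightarrow> 'k::{real_normed_field, euclidean_space}"
  assumes s: "0 < s" and r: "0 < r" and p: "0 < p" and cC: "0 < c" "0 < C"
    and h [measurable]: "\<And>n. h n \<in> borel_measurable borel"
    and lower: "\<And>a m. ennreal (c * (\<Sum>n<m. norm (a n) powr p) powr (1 / p))
       \<le> mixed_fnorm s r (\<lambda>z. \<Sum>n<m. a n * h n z)"
    and upper: "\<And>a m. mixed_fnorm s r (\<lambda>z. \<Sum>n<m. a n * h n z)
       \<le> ennreal (C * (\<Sum>n<m. norm (a n) powr p) powr (1 / p))"
  shows "embeds_isomorphically (ell_space p :: ('k, _) qn_space) (mixed_L s r)"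
proof -
  let ?\<rho> = "min 1 (min s r)"
  interpret X: fun_space "count_space UNIV" "Lnorm (count_space UNIV) p" "min 1 p"
    "ell_space p :: ('k, nat \<Rightarrow> 'k) qn_space" id "{x. summable (\<lambda>n. norm (x n) powr p)}"
    by (rule fun_space_ell_space[OF p])
  interpret Y: fun_space unit_square_measure "mixed_norm s r" ?\<rho>
    "mixed_L s r :: ('k, _) qn_space" "mixed_class s r" "mixed_borel s r"
    by (rule fun_space_mixed_L[OF s r])
  define S where "S m a z = (\<Sum>n<m. a n * h n z)" for m a z
  have S_meas [measurable]: "S m a \<in> borel_measurable borel" for m a unfolding S_def by measurable
  have S_lower: "ennreal (c * (\<Sum>n<m. norm (a n) powr p) powr (1 / p)) \<le> Y.fnorm (S m a)" for m a
    using lower[of a m] by (simp add: Y.fnorm_def S_def)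
  have S_upper: "Y.fnorm (S m a) \<le> ennreal (C * (\<Sum>n<m. norm (a n) powr p) powr (1 / p))" for m a
    using upper[of a m] by (simp add: Y.fnorm_def S_def)
  have S_borel: "S m a \<in> mixed_borel s r" for m a
    using le_less_trans[OF S_upper[of m a] ennreal_less_top] by (simp add: mixed_borel_def Y.fnorm_def)
  have lim_ex: "\<exists>g\<in>borel_measurable borel. (\<lambda>m. Y.fnorm (\<lambda>z. g z - S m a z)) \<longlonglongrightarrow> 0"
    if a: "summable (\<lambda>n. norm (a n) powr p)" for a
  proof (rule Y.Cauchy_converges[of "\<lambda>m. S m a"])
    fix e :: real assume e: "0 < e"
    have tail: "Y.fnorm (\<lambda>z. S m a z - S k a z) \<le> ennreal (C * (\<Sum>n=k..<m. norm (a n) powr p) powr (1 / p))"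
      if "k \<le> m" for k m
    proof -
      have split: "{..<m} = {..<k} \<union> {k..<m}" "{..<k} \<inter> {k..<m} = {}" using that by auto
      define b where "b n = (if k \<le> n then a n else 0)" for n
      have "S m b = (\<lambda>z. S m a z - S k a z)"
        unfolding S_def split(1) by (simp add: sum.union_disjoint split(2) b_def)
      moreover have "(\<Sum>n<m. norm (b n) powr p) = (\<Sum>n=k..<m. norm (a n) powr p)"
        unfolding split(1) by (simp add: sum.union_disjoint split(2) b_def)
      ultimately show ?thesis using S_upper[of m b] by simp
    qed
    define \<delta> where "\<delta> = (e / (2 * C)) powr p"
    have \<delta>: "0 < \<delta>" using e cC by (simp add: \<delta>_def)
    obtain n0 where n0: "\<And>k m. k \<ge> n0 \<Longrightarrow> norm (\<Sum>n=k..<m. norm (a n) powr p) < \<delta>"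
      using a \<delta> unfolding summable_Cauchy by meson
    have less: "Y.fnorm (\<lambda>z. S m a z - S k a z) < ennreal e" if "k \<ge> n0" "k \<le> m" for k m
    proof -
      have "(\<Sum>n=k..<m. norm (a n) powr p) powr (1/p) \<le> \<delta> powr (1/p)"
        using n0[OF that(1), of m] p by (intro powr_mono2) (auto simp: sum_nonneg)
      also have "\<dots> = e / (2 * C)" using p e cC by (simp add: \<delta>_def powr_powr)
      finally have "C * (\<Sum>n=k..<m. norm (a n) powr p) powr (1/p) \<le> e / 2"
        using cC by (simp add: field_simps)
      then have "ennreal (C * (\<Sum>n=k..<m. norm (a n) powr p) powr (1/p)) < ennreal e"
        using e by (intro ennreal_lessI) auto
      with tail[OF that(2)] show ?thesis by (rule le_less_trans)
    qed
    have "Y.fnorm (\<lambda>z. S m a z - S k a z) < ennreal e" if "n0 \<le> m" "n0 \<le> k" for m k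
      using less[of k m] less[of m k] that Y.fnorm_minus_commute[of "S m a" "S k a"] by (cases "k \<le> m") auto
    then show "\<exists>n0. \<forall>m\<ge>n0. \<forall>n\<ge>n0. Y.fnorm (\<lambda>z. S m a z - S n a z) < ennreal e" by blast
  qed auto
  \<comment> \<open>\<open>G a\<close> is the sum of the series with coefficients \<open>a\<close>\<close>
  define G where "G a = (SOME g. g \<in> borel_measurable borel \<and> (\<lambda>m. Y.fnorm (\<lambda>z. g z - S m a z)) \<longlonglongrightarrow> 0)" for a
  have "G a \<in> borel_measurable borel \<and> (\<lambda>m. Y.fnorm (\<lambda>z. G a z - S m a z)) \<longlonglongrightarrow> 0"
    if "summable (\<lambda>n. norm (a n) powr p)" for a
    unfolding G_def using lim_ex[OF that] by (intro someI_ex[of "\<lambda>g. g \<in> borel_measurable borel \<and> _ g"]) blast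
  then have G [measurable]: "G a \<in> borel_measurable borel" and G_lim: "(\<lambda>m. Y.fnorm (\<lambda>z. G a z - S m a z)) \<longlonglongrightarrow> 0"
    if "summable (\<lambda>n. norm (a n) powr p)" for a
    using that by blast+
  have G_lim': "(\<lambda>m. enn_powr (Y.fnorm (\<lambda>z. G a z - S m a z)) ?\<rho>) \<longlonglongrightarrow> 0"
    if "summable (\<lambda>n. norm (a n) powr p)" for a
    using G_lim[OF that] Y.\<rho>(1) by (rule tendsto_enn_powr_0)
  have G_borel: "G a \<in> mixed_borel s r" if a: "summable (\<lambda>n. norm (a n) powr p)" for a
  proof -
    have "\<forall>\<^sub>F m in sequentially. Y.fnorm (\<lambda>z. G a z - S m a z) < 1"
      using G_lim[OF a] by (rule order_tendstoD) simp
    then obtain m where "Y.fnorm (\<lambda>z. G a z - S m a z) < 1"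
      using eventually_happens'[OF sequentially_bot] by blast
    then have "Y.fnorm (\<lambda>z. G a z - S m a z) < top" by (rule less_trans) simp
    from Y.fnorm_add_less_top[OF _ _ this Y.F_finite[OF S_borel[of m a]]] have "Y.fnorm (G a) < top"
      using G[OF a] by simp
    then show ?thesis using G[OF a] by (simp add: mixed_borel_def Y.fnorm_def)
  qed
  \<comment> \<open>two functions agree if the distance between them is bounded by a null sequence\<close>
  have AE_eqI: "AE z in unit_square_measure. f z = g z"
    if fg: "f \<in> borel_measurable borel" "g \<in> borel_measurable borel"
      and lim: "x \<longlonglongrightarrow> 0" "\<And>m. enn_powr (Y.fnorm (\<lambda>z. f z - g z)) ?\<rho> \<le> x m"
    for f g :: "real \<times> real \<Rightarrow> 'k" and x :: "nat \<Rightarrow> ennreal"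
  proof -
    have "enn_powr (Y.fnorm (\<lambda>z. f z - g z)) ?\<rho> \<le> 0"
      using lim by (intro LIMSEQ_le_const[OF lim(1)]) auto
    then have "Y.fnorm (\<lambda>z. f z - g z) = 0" by simp
    then have "AE z in unit_square_measure. f z - g z = 0"
      using fg by (subst (asm) Y.fnorm_eq_0_iff) auto
    then show ?thesis by eventually_elim simp
  qed
  have summable_add: "summable (\<lambda>n. norm (a n + b n) powr p)"
    if "summable (\<lambda>n. norm (a n) powr p)" "summable (\<lambda>n. norm (b n) powr p)" for a b :: "nat \<Rightarrow> 'k"
    using X.F_add[of a b] that by simp
  have summable_scale: "summable (\<lambda>n. norm (d * a n) powr p)"
    if "summable (\<lambda>n. norm (a n) powr p)" for d and a :: "nat \<Rightarrow> 'k"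
    using X.F_scale[of a d] that by simp
  have G_add: "AE z in unit_square_measure. G (\<lambda>n. a n + b n) z = G a z + G b z"
    if a: "summable (\<lambda>n. norm (a n) powr p)" and b: "summable (\<lambda>n. norm (b n) powr p)" for a b
  proof (rule AE_eqI)
    note [measurable] = G[OF a] G[OF b] G[OF summable_add[OF a b]]
    let ?x = "\<lambda>m. enn_powr (Y.fnorm (\<lambda>z. G (\<lambda>n. a n + b n) z - S m (\<lambda>n. a n + b n) z)) ?\<rho>
      + (enn_powr (Y.fnorm (\<lambda>z. G a z - S m a z)) ?\<rho> + enn_powr (Y.fnorm (\<lambda>z. G b z - S m b z)) ?\<rho>)"
    show "G (\<lambda>n. a n + b n) \<in> borel_measurable borel" "(\<lambda>z. G a z + G b z) \<in> borel_measurable borel" by auto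
    have "?x \<longlonglongrightarrow> 0 + (0 + 0)"
      by (intro tendsto_add G_lim' a b summable_add)
    then show "?x \<longlonglongrightarrow> 0" by simp
    fix m
    have Sadd: "S m (\<lambda>n. a n + b n) z = S m a z + S m b z" for z
      by (simp add: S_def distrib_right sum.distrib)
    have "enn_powr (Y.fnorm (\<lambda>z. G (\<lambda>n. a n + b n) z - (G a z + G b z))) ?\<rho>
        \<le> enn_powr (Y.fnorm (\<lambda>z. G (\<lambda>n. a n + b n) z - S m (\<lambda>n. a n + b n) z)) ?\<rho>
          + enn_powr (Y.fnorm (\<lambda>z. S m (\<lambda>n. a n + b n) z - (G a z + G b z))) ?\<rho>"
      by (rule Y.fnorm_diff_triangle) auto
    also have "Y.fnorm (\<lambda>z. S m (\<lambda>n. a n + b n) z - (G a z + G b z))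
        = Y.fnorm (\<lambda>z. (G a z - S m a z) + (G b z - S m b z))"
      by (subst Y.fnorm_minus_commute) (simp add: Sadd algebra_simps)
    also have "enn_powr \<dots> ?\<rho> \<le> enn_powr (Y.fnorm (\<lambda>z. G a z - S m a z)) ?\<rho> + enn_powr (Y.fnorm (\<lambda>z. G b z - S m b z)) ?\<rho>"
      by (rule Y.fnorm_add) auto
    finally show "enn_powr (Y.fnorm (\<lambda>z. G (\<lambda>n. a n + b n) z - (G a z + G b z))) ?\<rho> \<le> ?x m"
      by (simp add: add_left_mono)
  qed
  have G_scale: "AE z in unit_square_measure. G (\<lambda>n. d * a n) z = d * G a z"
    if a: "summable (\<lambda>n. norm (a n) powr p)" for a d
  proof (rule AE_eqI)
    note [measurable] = G[OF a] G[OF summable_scale[OF a]]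
    let ?x = "\<lambda>m. enn_powr (Y.fnorm (\<lambda>z. G (\<lambda>n. d * a n) z - S m (\<lambda>n. d * a n) z)) ?\<rho>
      + ennreal (norm d powr ?\<rho>) * enn_powr (Y.fnorm (\<lambda>z. G a z - S m a z)) ?\<rho>"
    show "G (\<lambda>n. d * a n) \<in> borel_measurable borel" "(\<lambda>z. d * G a z) \<in> borel_measurable borel" by auto
    have "?x \<longlonglongrightarrow> 0 + ennreal (norm d powr ?\<rho>) * 0"
      by (intro tendsto_add G_lim' a summable_scale ennreal_tendsto_cmult) auto
    then show "?x \<longlonglongrightarrow> 0" by simp
    fix m
    have Sscale: "S m (\<lambda>n. d * a n) z = d * S m a z" for z
      by (simp add: S_def sum_distrib_left mult.assoc)
    have "enn_powr (Y.fnorm (\<lambda>z. G (\<lambda>n. d * a n) z - d * G a z)) ?\<rho>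
        \<le> enn_powr (Y.fnorm (\<lambda>z. G (\<lambda>n. d * a n) z - S m (\<lambda>n. d * a n) z)) ?\<rho>
          + enn_powr (Y.fnorm (\<lambda>z. S m (\<lambda>n. d * a n) z - d * G a z)) ?\<rho>"
      by (rule Y.fnorm_diff_triangle) auto
    also have "Y.fnorm (\<lambda>z. S m (\<lambda>n. d * a n) z - d * G a z) = Y.fnorm (\<lambda>z. d * (G a z - S m a z))"
      by (subst Y.fnorm_minus_commute) (simp add: Sscale right_diff_distrib)
    also have "\<dots> = ennreal (norm d) * Y.fnorm (\<lambda>z. G a z - S m a z)"
      by (rule Y.fnorm_scale) auto
    finally show "enn_powr (Y.fnorm (\<lambda>z. G (\<lambda>n. d * a n) z - d * G a z)) ?\<rho> \<le> ?x m"
      by (simp add: enn_powr_mult)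
  qed
  have G_upper: "Y.fnorm (G a) \<le> ennreal (C * (\<Sum>n. norm (a n) powr p) powr (1 / p))"
    if a: "summable (\<lambda>n. norm (a n) powr p)" for a
  proof -
    let ?K = "ennreal (C * (\<Sum>n. norm (a n) powr p) powr (1 / p))"
    have "enn_powr (Y.fnorm (G a)) ?\<rho> \<le> enn_powr (Y.fnorm (\<lambda>z. G a z - S m a z)) ?\<rho> + enn_powr ?K ?\<rho>" for m
    proof -
      have "(\<Sum>n<m. norm (a n) powr p) powr (1 / p) \<le> (\<Sum>n. norm (a n) powr p) powr (1 / p)"
        using p a by (intro powr_mono2 sum_le_suminf) (auto simp: sum_nonneg)
      then have "Y.fnorm (S m a) \<le> ?K"
        using cC by (intro order_trans[OF S_upper] ennreal_leI mult_left_mono) auto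
      then have "enn_powr (Y.fnorm (S m a)) ?\<rho> \<le> enn_powr ?K ?\<rho>"
        using Y.\<rho> by (intro enn_powr_mono) auto
      moreover have "enn_powr (Y.fnorm (G a)) ?\<rho> \<le> enn_powr (Y.fnorm (\<lambda>z. G a z - S m a z)) ?\<rho> + enn_powr (Y.fnorm (S m a)) ?\<rho>"
        using Y.fnorm_add[of "\<lambda>z. G a z - S m a z" "S m a"] G[OF a] by simp
      ultimately show ?thesis by (meson add_left_mono order_trans)
    qed
    moreover have "(\<lambda>m. enn_powr (Y.fnorm (\<lambda>z. G a z - S m a z)) ?\<rho> + enn_powr ?K ?\<rho>) \<longlonglongrightarrow> 0 + enn_powr ?K ?\<rho>"
      by (intro tendsto_add G_lim' a tendsto_const)
    ultimately have "enn_powr (Y.fnorm (G a)) ?\<rho> \<le> 0 + enn_powr ?K ?\<rho>"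
      by (intro LIMSEQ_le_const) auto
    then show ?thesis using Y.\<rho>(1) by (simp only: enn_powr_le_iff add_0_left)
  qed
  have G_lower: "ennreal (c * (\<Sum>n. norm (a n) powr p) powr (1 / p)) \<le> Y.fnorm (G a)"
    if a: "summable (\<lambda>n. norm (a n) powr p)" for a
  proof -
    have part: "ennreal (c * (\<Sum>n<k. norm (a n) powr p) powr (1 / p)) \<le> Y.fnorm (G a)" for k
    proof -
      let ?K = "ennreal (c * (\<Sum>n<k. norm (a n) powr p) powr (1 / p))"
      have "enn_powr ?K ?\<rho> \<le> enn_powr (Y.fnorm (\<lambda>z. G a z - S m a z)) ?\<rho> + enn_powr (Y.fnorm (G a)) ?\<rho>" if "k \<le> m" for m
      proof -
        have "(\<Sum>n<k. norm (a n) powr p) powr (1 / p) \<le> (\<Sum>n<m. norm (a n) powr p) powr (1 / p)"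
          using p that by (intro powr_mono2 sum_mono2) (auto simp: sum_nonneg)
        then have "?K \<le> Y.fnorm (S m a)"
          using cC by (intro order_trans[OF _ S_lower] ennreal_leI mult_left_mono) auto
        then have "enn_powr ?K ?\<rho> \<le> enn_powr (Y.fnorm (S m a)) ?\<rho>"
          using Y.\<rho> by (intro enn_powr_mono) auto
        also have "\<dots> \<le> enn_powr (Y.fnorm (\<lambda>z. S m a z - G a z)) ?\<rho> + enn_powr (Y.fnorm (G a)) ?\<rho>"
          using Y.fnorm_add[of "\<lambda>z. S m a z - G a z" "G a"] G[OF a] by simp
        finally show ?thesis by (subst Y.fnorm_minus_commute)
      qed
      moreover have "(\<lambda>m. enn_powr (Y.fnorm (\<lambda>z. G a z - S m a z)) ?\<rho> + enn_powr (Y.fnorm (G a)) ?\<rho>) \<longlonglongrightarrow> 0 + enn_powr (Y.fnorm (G a)) ?\<rho>"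
        by (intro tendsto_add G_lim' a tendsto_const)
      ultimately have "enn_powr ?K ?\<rho> \<le> 0 + enn_powr (Y.fnorm (G a)) ?\<rho>"
        by (intro LIMSEQ_le_const) auto
      then show ?thesis using Y.\<rho>(1) by (simp only: enn_powr_le_iff add_0_left)
    qed
    have "(\<lambda>k. ennreal (c * (\<Sum>n<k. norm (a n) powr p) powr (1 / p))) \<longlonglongrightarrow> ennreal (c * (\<Sum>n. norm (a n) powr p) powr (1 / p))"
      using p by (intro tendsto_ennrealI tendsto_mult tendsto_const tendsto_powr' summable_LIMSEQ a) (auto simp: sum_nonneg)
    then show ?thesis by (rule LIMSEQ_le_const2) (use part in auto)
  qed
  show ?thesis
  proof (rule embeds_isomorphicallyI[OF X.fun_space_axioms Y.fun_space_axioms _ cC])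
    let ?T = "\<lambda>a. mixed_class s r (G a)"
    have vecs: "a \<in> vecs (ell_space p) \<longleftrightarrow> summable (\<lambda>n. norm (a n) powr p)" for a :: "nat \<Rightarrow> 'k"
      by (simp add: ell_space_def)
    show "qn_linear (ell_space p) (mixed_L s r) ?T"
      unfolding qn_linear_def
    proof (intro conjI ballI allI)
      fix a :: "nat \<Rightarrow> 'k" and d assume "a \<in> vecs (ell_space p)"
      then have a: "summable (\<lambda>n. norm (a n) powr p)" by (simp only: vecs)
      show "mixed_class s r (G a) \<in> vecs (mixed_L s r)" by (intro Y.vecs_cls G_borel a)
      show "mixed_class s r (G (vscale (ell_space p) d a)) = vscale (mixed_L s r) d (mixed_class s r (G a))"
        using G_scale[OF a, of d] G_borel[OF a] G_borel[OF summable_scale[OF a, of d]]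
        by (simp add: Y.vscale_X Y.cls_eq_iff Y.F_scale ell_space_def)
      fix b :: "nat \<Rightarrow> 'k" assume "b \<in> vecs (ell_space p)"
      then have b: "summable (\<lambda>n. norm (b n) powr p)" by (simp only: vecs)
      show "mixed_class s r (G (vadd (ell_space p) a b)) = vadd (mixed_L s r) (mixed_class s r (G a)) (mixed_class s r (G b))"
        using G_add[OF a b] G_borel[OF a] G_borel[OF b] G_borel[OF summable_add[OF a b]]
        by (simp add: Y.vadd_X Y.cls_eq_iff Y.F_add ell_space_def)
    qed
    fix a :: "nat \<Rightarrow> 'k" assume "a \<in> vecs (ell_space p)"
    then have a: "summable (\<lambda>n. norm (a n) powr p)" by (simp only: vecs)
    have q: "qnorm (ell_space p) a = (\<Sum>n. norm (a n) powr p) powr (1 / p)" by (simp add: ell_space_def)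
    have nn: "0 \<le> qnorm (mixed_L s r) (mixed_class s r (G a))"
      by (intro Y.qnorm_nonneg Y.vecs_cls G_borel a)
    show "c * qnorm (ell_space p) a \<le> qnorm (mixed_L s r) (mixed_class s r (G a))"
      using G_lower[OF a] nn by (simp add: q flip: Y.ennreal_qnorm[OF G_borel[OF a]])
    show "qnorm (mixed_L s r) (mixed_class s r (G a)) \<le> C * qnorm (ell_space p) a"
      using G_upper[OF a] cC by (simp add: q ennreal_le_iff flip: Y.ennreal_qnorm[OF G_borel[OF a]])
  qed (rule ell_space_complete[OF p])
qed

section \<open>Type and cotype bounds\<close>

text \<open>All restrictions on \<open>\<tau>\<close> are obtained by letting \<open>n\<close> tend to infinity in an estimate of this form.\<close>

lemma powr_growth:
  fixes a b c C D :: real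
  assumes ab: "a < b" "0 < b" and c: "0 < c"
    and le: "\<And>n. c * real n powr b \<le> C * real n powr a + D"
  shows False
proof -
  have "(\<lambda>n. C * real n powr (a - b) + D * real n powr (- b)) \<longlonglongrightarrow> C * 0 + D * 0"
    using ab by (intro tendsto_add tendsto_mult tendsto_const tendsto_neg_powr filterlim_real_sequentially) auto
  then have "\<forall>\<^sub>F n in sequentially. C * real n powr (a - b) + D * real n powr (- b) < c"
    using c by (intro order_tendstoD) auto
  moreover have "\<forall>\<^sub>F n in sequentially. (1::nat) \<le> n" by (rule eventually_ge_at_top)
  ultimately have "\<forall>\<^sub>F n in sequentially. C * real n powr (a - b) + D * real n powr (- b) < c \<and> 1 \<le> n"
    by (rule eventually_conj)
  then obtain n :: nat where n: "C * real n powr (a - b) + D * real n powr (- b) < c" "1 \<le> n"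
    using eventually_happens'[OF sequentially_bot] by blast
  have "(C * real n powr (a - b) + D * real n powr (- b)) * real n powr b < c * real n powr b"
    using n by (intro mult_strict_right_mono) auto
  moreover have "(C * real n powr (a - b) + D * real n powr (- b)) * real n powr b = C * real n powr a + D"
    using n by (simp add: distrib_right mult.assoc flip: powr_add)
  ultimately show False using le[of n] by linarith
qed

lemma power2_ennreal_neq_top [simp]: "(2::ennreal) ^ n \<noteq> top"
proof -
  have "(2::ennreal) ^ n = ennreal (2 ^ n)" by (simp flip: ennreal_power)
  then show ?thesis by simp
qed

text \<open>The square of the square function; its quasi-norm with exponents \<open>s/2\<close> and \<open>r/2\<close>, to the power \<open>1/2\<close>, is that of the
  square function with exponents \<open>s\<close> and \<open>r\<close>.\<close>

definition square_sum :: "(nat \<Rightarrow> 'a \<Rightarrow> 'k::real_normed_vector) \<Rightarrow> nat set \<Rightarrow> 'a \<Rightarrow> ennreal" where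
  "square_sum h I z = (\<Sum>i\<in>I. enn_powr (ennreal (norm (h i z))) 2)"

lemma measurable_square_sum [measurable]:
  "(\<And>i. h i \<in> borel_measurable M) \<Longrightarrow> square_sum h I \<in> borel_measurable M"
  unfolding square_sum_def by (intro borel_measurable_sum borel_measurable_enn_powr) auto

text \<open>Averaging over signs turns bounds for all signed sums into bounds for the square function, since the
  mixed norm of order \<open>t \<le> min s r\<close> is convex.\<close>

lemma square_sum_le:
  fixes h :: "nat \<Rightarrow> real \<times> real \<Rightarrow> 'k::euclidean_space"
  assumes s: "0 < s" and r: "0 < r" and h [measurable]: "\<And>i. h i \<in> borel_measurable borel"
  obtains K where "0 < K" "\<forall>I b. finite I \<longrightarrow> 0 \<le> b \<longrightarrow>
    (\<forall>A. signed_norm s r h I A \<le> ennreal b) \<longrightarrow>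
    enn_powr (mixed_norm (s / 2) (r / 2) (square_sum h I)) (1 / 2) \<le> ennreal (K * b)"
proof -
  define t where "t = min s r"
  have t: "0 < t" "1 \<le> s / t" "1 \<le> r / t" "0 < s / t" "0 < r / t" using s r by (auto simp: t_def)
  obtain K where K: "0 < K" and low: "\<And>(I :: nat set) (a :: nat \<Rightarrow> 'k). finite I \<Longrightarrow>
    2 ^ card I * enn_powr (\<Sum>i\<in>I. enn_powr (ennreal (norm (a i))) 2) (t / 2)
      \<le> ennreal K * (\<Sum>A\<in>Pow I. enn_powr (ennreal (norm (\<Sum>i\<in>I. sgn_of A i *\<^sub>R a i))) t)"
    by (rule khinchine_lower_ennreal[OF t(1)]) auto
  show thesis
  proof (rule that[of "K powr (1 / t)"])
    show "0 < K powr (1 / t)" using K by simp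
  next
    show "\<forall>I b. finite I \<longrightarrow> 0 \<le> b \<longrightarrow>
      (\<forall>A. signed_norm s r h I A \<le> ennreal b) \<longrightarrow>
      enn_powr (mixed_norm (s / 2) (r / 2) (square_sum h I)) (1 / 2) \<le> ennreal (K powr (1 / t) * b)"
    proof (intro allI impI)
      fix I and b :: real assume I: "finite I" and b: "0 \<le> b" and
        le: "\<forall>A. signed_norm s r h I A \<le> ennreal b"
      let ?N = "mixed_norm (s / t) (r / t)" and ?S = "\<lambda>A z. enn_powr (ennreal (norm (\<Sum>i\<in>I. sgn_of A i *\<^sub>R h i z))) t"
      have pow: "?N (\<lambda>z. enn_powr (square_sum h I z) (t / 2)) = enn_powr (mixed_norm (s / 2) (r / 2) (square_sum h I)) (t / 2)"
        using t by (simp add: mixed_norm_enn_powr)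
      have "2 ^ card I * ?N (\<lambda>z. enn_powr (square_sum h I z) (t / 2))
          = ?N (\<lambda>z. 2 ^ card I * enn_powr (square_sum h I z) (t / 2))"
        using t by (simp add: mixed_norm_cmult)
      also have "\<dots> \<le> ?N (\<lambda>z. ennreal K * (\<Sum>A\<in>Pow I. ?S A z))"
        using t low[OF I] by (intro mixed_norm_mono) (auto simp: square_sum_def)
      also have "\<dots> = ennreal K * ?N (\<lambda>z. \<Sum>A\<in>Pow I. ?S A z)"
        using t by (intro mixed_norm_cmult) auto
      also have "\<dots> \<le> ennreal K * (\<Sum>A\<in>Pow I. ?N (?S A))"
        using t by (intro mult_left_mono mixed_norm_sum_le) auto
      also have "\<dots> \<le> ennreal K * (\<Sum>A\<in>Pow I. ennreal (b powr t))"
      proof (intro mult_left_mono sum_mono)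
        fix A
        have "?N (?S A) = enn_powr (signed_norm s r h I A) t"
          by (subst mixed_norm_enn_powr) (use t in auto)
        also have "\<dots> \<le> enn_powr (ennreal b) t" using t by (intro enn_powr_mono le[rule_format]) auto
        finally show "?N (?S A) \<le> ennreal (b powr t)" using b by simp
      qed simp
      also have "\<dots> = 2 ^ card I * ennreal (K * b powr t)"
        using K I by (simp add: card_Pow ennreal_mult mult_ac)
      finally have "?N (\<lambda>z. enn_powr (square_sum h I z) (t / 2)) \<le> ennreal (K * b powr t)"
        by (subst (asm) ennreal_mult_le_mult_iff) auto
      then have "enn_powr (enn_powr (mixed_norm (s / 2) (r / 2) (square_sum h I)) (t / 2)) (1 / t) \<le> enn_powr (ennreal (K * b powr t)) (1 / t)"
        unfolding pow using t by (intro enn_powr_mono) auto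
      then show "enn_powr (mixed_norm (s / 2) (r / 2) (square_sum h I)) (1 / 2) \<le> ennreal (K powr (1 / t) * b)"
        using t K b by (simp add: enn_powr_enn_powr powr_mult powr_powr)
    qed
  qed
qed

text \<open>The dual statement, with \<open>t \<ge> max s r\<close>, for which the mixed norm is concave.\<close>

lemma square_sum_ge:
  fixes h :: "nat \<Rightarrow> real \<times> real \<Rightarrow> 'k::euclidean_space"
  assumes s: "0 < s" and r: "0 < r" and h [measurable]: "\<And>i. h i \<in> borel_measurable borel"
  obtains K where "0 < K" "\<forall>I b. finite I \<longrightarrow> 0 \<le> b \<longrightarrow>
    (\<forall>A. ennreal b \<le> signed_norm s r h I A) \<longrightarrow>
    ennreal b \<le> ennreal K * enn_powr (mixed_norm (s / 2) (r / 2) (square_sum h I)) (1 / 2)"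
proof -
  define t where "t = max s r"
  have t: "0 < t" "s / t \<le> 1" "r / t \<le> 1" "0 < s / t" "0 < r / t" using s r by (auto simp: t_def)
  obtain K where K: "0 < K" and up: "\<And>(I :: nat set) (a :: nat \<Rightarrow> 'k). finite I \<Longrightarrow>
    (\<Sum>A\<in>Pow I. enn_powr (ennreal (norm (\<Sum>i\<in>I. sgn_of A i *\<^sub>R a i))) t)
      \<le> ennreal (2 ^ card I * K) * enn_powr (\<Sum>i\<in>I. enn_powr (ennreal (norm (a i))) 2) (t / 2)"
    by (rule khinchine_upper_ennreal[OF t(1)]) auto
  show thesis
  proof (rule that[of "K powr (1 / t)"])
    show "0 < K powr (1 / t)" using K by simp
  next
    show "\<forall>I b. finite I \<longrightarrow> 0 \<le> b \<longrightarrow>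
      (\<forall>A. ennreal b \<le> signed_norm s r h I A) \<longrightarrow>
      ennreal b \<le> ennreal (K powr (1 / t)) * enn_powr (mixed_norm (s / 2) (r / 2) (square_sum h I)) (1 / 2)"
    proof (intro allI impI)
      fix I and b :: real assume I: "finite I" and b: "0 \<le> b" and
        le: "\<forall>A. ennreal b \<le> signed_norm s r h I A"
      let ?N = "mixed_norm (s / t) (r / t)" and ?S = "\<lambda>A z. enn_powr (ennreal (norm (\<Sum>i\<in>I. sgn_of A i *\<^sub>R h i z))) t"
      let ?W = "mixed_norm (s / 2) (r / 2) (square_sum h I)"
      have "2 ^ card I * ennreal (b powr t) = (\<Sum>A\<in>Pow I. ennreal (b powr t))"
        using I by (simp add: card_Pow)
      also have "\<dots> \<le> (\<Sum>A\<in>Pow I. ?N (?S A))"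
      proof (intro sum_mono)
        fix A
        have "enn_powr (ennreal b) t \<le> enn_powr (signed_norm s r h I A) t"
          using t by (intro enn_powr_mono le[rule_format]) auto
        also have "\<dots> = ?N (?S A)"
          by (subst mixed_norm_enn_powr) (use t in auto)
        finally show "ennreal (b powr t) \<le> ?N (?S A)" using b by simp
      qed
      also have "\<dots> \<le> ?N (\<lambda>z. \<Sum>A\<in>Pow I. ?S A z)"
        using t by (intro mixed_norm_sum_ge) auto
      also have "\<dots> \<le> ?N (\<lambda>z. ennreal (2 ^ card I * K) * enn_powr (square_sum h I z) (t / 2))"
        using t up[OF I] by (intro mixed_norm_mono) (auto simp: square_sum_def)
      also have "\<dots> = ennreal (2 ^ card I * K) * ?N (\<lambda>z. enn_powr (square_sum h I z) (t / 2))"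
        using t by (intro mixed_norm_cmult) auto
      also have "?N (\<lambda>z. enn_powr (square_sum h I z) (t / 2)) = enn_powr ?W (t / 2)"
        using t by (simp add: mixed_norm_enn_powr)
      also have "ennreal (2 ^ card I * K) * enn_powr ?W (t / 2) = 2 ^ card I * (ennreal K * enn_powr ?W (t / 2))"
        using K by (simp add: ennreal_mult mult.assoc flip: ennreal_power)
      finally have "ennreal (b powr t) \<le> ennreal K * enn_powr ?W (t / 2)"
        by (subst (asm) ennreal_mult_le_mult_iff) auto
      then have "enn_powr (ennreal (b powr t)) (1 / t) \<le> enn_powr (ennreal K * enn_powr ?W (t / 2)) (1 / t)"
        using t by (intro enn_powr_mono) auto
      then show "ennreal b \<le> ennreal (K powr (1 / t)) * enn_powr ?W (1 / 2)"
        using t K b by (simp add: enn_powr_enn_powr enn_powr_mult powr_powr)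
    qed
  qed
qed

lemma spreads_single:
  assumes "spreads s r \<tau> h"
  obtains C where "0 < C" "\<And>i. mixed_fnorm s r (h i) \<le> ennreal C"
proof -
  obtain C where C: "0 < C" "\<And>I B. finite I \<Longrightarrow>
      signed_norm s r h I B \<le> ennreal (C * real (card I) powr \<tau>)"
    using assms unfolding spreads_def by blast
  have "mixed_fnorm s r (h i) \<le> ennreal C" for i
    using C(2)[of "{i}" UNIV] by (simp add: sgn_of_def)
  with C(1) show thesis by (rule that)
qed

text \<open>With \<open>m = min 2 (min s r)\<close>, the square function is at most the \<open>m\<close>-th power mean, whose quasi-norm is
  at most \<open>C * n powr (1/m)\<close> because the functional with exponents \<open>s/m\<close> and \<open>r/m\<close> is convex.\<close>

lemma spreads_type:
  fixes h :: "nat \<Rightarrow> real \<times> real \<Rightarrow> 'k::euclidean_space"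
  assumes s: "0 < s" and r: "0 < r" and spr: "spreads s r \<tau> h"
  shows "\<tau> \<le> 1 / min 2 (min s r)"
proof (rule ccontr)
  define m where "m = min 2 (min s r)"
  have m: "0 < m" "m / 2 \<le> 1" "0 < m / 2" "1 \<le> s / m" "1 \<le> r / m" "0 < s / m" "0 < r / m"
    using s r by (auto simp: m_def)
  assume "\<not> \<tau> \<le> 1 / min 2 (min s r)"
  then have \<tau>: "1 / m < \<tau>" by (simp add: m_def)
  then have \<tau>0: "0 < \<tau>" using m(1) by (meson divide_pos_pos less_trans zero_less_one)
  have h [measurable]: "\<And>i. h i \<in> borel_measurable borel" using spr by (simp add: spreads_def)
  obtain c where c: "0 < c" "\<And>I B. finite I \<Longrightarrow>
      ennreal (c * real (card I) powr \<tau>) \<le> signed_norm s r h I B"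
    using spr unfolding spreads_def by blast
  obtain C where C: "0 < C" "\<And>i. mixed_fnorm s r (h i) \<le> ennreal C"
    by (rule spreads_single[OF spr]) (rule that)
  obtain K where K: "0 < K" "\<forall>I b. finite I \<longrightarrow> 0 \<le> b \<longrightarrow>
    (\<forall>A. ennreal b \<le> signed_norm s r h I A) \<longrightarrow>
    ennreal b \<le> ennreal K * enn_powr (mixed_norm (s / 2) (r / 2) (square_sum h I)) (1 / 2)"
    by (rule square_sum_ge[OF s r, of h, OF h]) (rule that)
  have "c * real n powr \<tau> \<le> K * C * real n powr (1 / m) + 0" for n
  proof -
    let ?I = "{..<n}" and ?W = "mixed_norm (s / 2) (r / 2) (square_sum h {..<n})"
    have "enn_powr ?W (m / 2) = mixed_norm (s / m) (r / m) (\<lambda>z. enn_powr (square_sum h ?I z) (m / 2))"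
      using m by (simp add: mixed_norm_enn_powr)
    also have "\<dots> \<le> mixed_norm (s / m) (r / m) (\<lambda>z. \<Sum>i\<in>?I. enn_powr (ennreal (norm (h i z))) m)"
    proof (rule mixed_norm_mono)
      fix z
      show "enn_powr (square_sum h ?I z) (m / 2) \<le> (\<Sum>i\<in>?I. enn_powr (ennreal (norm (h i z))) m)"
      proof -
        have "enn_powr (square_sum h ?I z) (m / 2) \<le> (\<Sum>i\<in>?I. enn_powr (enn_powr (ennreal (norm (h i z))) 2) (m / 2))"
          unfolding square_sum_def using m by (intro enn_powr_sum_le) auto
        also have "\<dots> = (\<Sum>i\<in>?I. enn_powr (ennreal (norm (h i z))) m)"
          by (simp only: enn_powr_enn_powr) simp
        finally show ?thesis .
      qed
    qed (use m in auto)
    also have "\<dots> \<le> (\<Sum>i\<in>?I. mixed_norm (s / m) (r / m) (\<lambda>z. enn_powr (ennreal (norm (h i z))) m))"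
      using m by (intro mixed_norm_sum_le) auto
    also have "\<dots> = (\<Sum>i\<in>?I. enn_powr (mixed_fnorm s r (h i)) m)"
      by (intro sum.cong refl, subst mixed_norm_enn_powr) (use m in auto)
    also have "\<dots> \<le> (\<Sum>i\<in>?I. enn_powr (ennreal C) m)"
      using m C by (intro sum_mono enn_powr_mono) auto
    also have "\<dots> = ennreal (real n * C powr m)"
      using C by (simp add: ennreal_mult ennreal_of_nat_eq_real_of_nat)
    finally have "enn_powr (enn_powr ?W (m / 2)) (1 / m) \<le> enn_powr (ennreal (real n * C powr m)) (1 / m)"
      using m by (intro enn_powr_mono) auto
    then have W: "enn_powr ?W (1 / 2) \<le> ennreal (C * real n powr (1 / m))"
      using m C by (simp add: enn_powr_enn_powr powr_mult powr_powr mult.commute)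
    have "ennreal (c * real n powr \<tau>) \<le> ennreal K * enn_powr ?W (1 / 2)"
      using c(2)[of ?I] c(1) by (intro K(2)[rule_format]) auto
    also have "\<dots> \<le> ennreal K * ennreal (C * real n powr (1 / m))"
      using W by (rule mult_left_mono) simp
    finally show ?thesis using K C by (simp add: ennreal_le_iff mult.assoc flip: ennreal_mult)
  qed
  then show False by (rule powr_growth[OF \<tau> \<tau>0 c(1)])
qed

text \<open>Let \<open>M = max 2 (max s' r')\<close>. The functional with exponents \<open>s'/M\<close> and \<open>r'/M\<close> is concave, so the \<open>M\<close>-th powers of
  the quasi-norms of \<open>n\<close> functions \<open>h i\<close> add up to at most the \<open>M\<close>-th power of that of the square function, which is at
  most a multiple of \<open>n powr (\<tau> * M)\<close>. As \<open>\<tau> * M < 1\<close>, only finitely many of them can be bounded below.\<close>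

lemma spreads_small:
  fixes h :: "nat \<Rightarrow> real \<times> real \<Rightarrow> 'k::euclidean_space"
  assumes s: "0 < s'" "s' \<le> s" and r: "0 < r'" "r' \<le> r" and spr: "spreads s r \<tau> h"
    and \<tau>: "\<tau> < 1 / max 2 (max s' r')" and \<delta>: "0 < \<delta>"
  shows "finite {i. ennreal \<delta> \<le> mixed_fnorm s' r' (h i)}" (is "finite ?J")
proof (rule ccontr)
  assume inf: "infinite ?J"
  define M where "M = max 2 (max s' r')"
  have M: "0 < M" "1 \<le> M / 2" "0 < M / 2" "0 < s' / M" "s' / M \<le> 1" "0 < r' / M" "r' / M \<le> 1"
    using s r by (auto simp: M_def)
  have \<tau>M: "\<tau> * M < 1" using \<tau> M by (simp add: M_def field_simps)
  have h [measurable]: "\<And>i. h i \<in> borel_measurable borel" using spr by (simp add: spreads_def)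
  obtain C where C: "0 < C" "\<And>I B. finite I \<Longrightarrow>
      signed_norm s r h I B \<le> ennreal (C * real (card I) powr \<tau>)"
    using spr unfolding spreads_def by blast
  obtain K where K: "0 < K" "\<forall>I b. finite I \<longrightarrow> 0 \<le> b \<longrightarrow>
    (\<forall>A. signed_norm s' r' h I A \<le> ennreal b) \<longrightarrow>
    enn_powr (mixed_norm (s' / 2) (r' / 2) (square_sum h I)) (1 / 2) \<le> ennreal (K * b)"
    by (rule square_sum_le[OF s(1) r(1), of h, OF h]) (rule that)
  have "\<delta> powr M * real n powr 1 \<le> (K * C) powr M * real n powr (\<tau> * M) + 0" for n
  proof -
    obtain I where I: "finite I" "card I = n" "I \<subseteq> ?J" using infinite_arbitrarily_large[OF inf] by blast
    let ?W = "mixed_norm (s' / 2) (r' / 2) (square_sum h I)"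
    have "ennreal (real n * \<delta> powr M) = (\<Sum>i\<in>I. enn_powr (ennreal \<delta>) M)"
      using I \<delta> by (simp add: ennreal_mult ennreal_of_nat_eq_real_of_nat)
    also have "\<dots> \<le> (\<Sum>i\<in>I. enn_powr (mixed_fnorm s' r' (h i)) M)"
      using I M by (intro sum_mono enn_powr_mono) auto
    also have "\<dots> = (\<Sum>i\<in>I. mixed_norm (s' / M) (r' / M) (\<lambda>z. enn_powr (ennreal (norm (h i z))) M))"
      by (intro sum.cong refl, subst mixed_norm_enn_powr) (use M in auto)
    also have "\<dots> \<le> mixed_norm (s' / M) (r' / M) (\<lambda>z. \<Sum>i\<in>I. enn_powr (ennreal (norm (h i z))) M)"
      using M by (intro mixed_norm_sum_ge) auto
    also have "\<dots> \<le> mixed_norm (s' / M) (r' / M) (\<lambda>z. enn_powr (square_sum h I z) (M / 2))"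
    proof (rule mixed_norm_mono)
      fix z
      show "(\<Sum>i\<in>I. enn_powr (ennreal (norm (h i z))) M) \<le> enn_powr (square_sum h I z) (M / 2)"
      proof -
        have "(\<Sum>i\<in>I. enn_powr (ennreal (norm (h i z))) M) = (\<Sum>i\<in>I. enn_powr (enn_powr (ennreal (norm (h i z))) 2) (M / 2))"
          by (simp only: enn_powr_enn_powr) simp
        also have "\<dots> \<le> enn_powr (square_sum h I z) (M / 2)"
          unfolding square_sum_def using M by (intro sum_enn_powr_le) auto
        finally show ?thesis .
      qed
    qed (use M in auto)
    also have "\<dots> = enn_powr (enn_powr ?W (1 / 2)) M"
      using M by (simp add: mixed_norm_enn_powr enn_powr_enn_powr)
    also have "\<dots> \<le> enn_powr (ennreal (K * (C * real n powr \<tau>))) M"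
    proof (intro enn_powr_mono K(2)[rule_format] I)
      fix A
      have "signed_norm s' r' h I A
          \<le> signed_norm s r h I A"
        using s r by (intro mixed_norm_exponent_mono) auto
      also have "\<dots> \<le> ennreal (C * real n powr \<tau>)" using C(2)[OF I(1), of A] I by simp
      finally show "signed_norm s' r' h I A \<le> ennreal (C * real n powr \<tau>)" .
    qed (use C M in auto)
    also have "\<dots> = ennreal ((K * C) powr M * real n powr (\<tau> * M))"
      using K C by (simp add: powr_mult powr_powr mult.assoc)
    finally show ?thesis by (simp add: ennreal_le_iff mult.commute)
  qed
  moreover have "0 < \<delta> powr M" using \<delta> by simp
  ultimately show False using powr_growth[OF \<tau>M zero_less_one] by blast
qed

lemma spreads_cotype:
  fixes h :: "nat \<Rightarrow> real \<times> real \<Rightarrow> 'k::euclidean_space"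
  assumes s: "0 < s" and r: "0 < r" and spr: "spreads s r \<tau> h"
  shows "1 / max 2 (max s r) \<le> \<tau>"
proof (rule ccontr)
  assume "\<not> 1 / max 2 (max s r) \<le> \<tau>"
  then have \<tau>: "\<tau> < 1 / max 2 (max s r)" by simp
  obtain c where c: "0 < c" "\<And>I B. finite I \<Longrightarrow>
      ennreal (c * real (card I) powr \<tau>) \<le> signed_norm s r h I B"
    using spr unfolding spreads_def by blast
  have "ennreal c \<le> mixed_fnorm s r (h i)" for i
    using c(2)[of "{i}" UNIV] by (simp add: sgn_of_def)
  then have "{i. ennreal c \<le> mixed_fnorm s r (h i)} = UNIV" by auto
  with spreads_small[OF s order_refl r order_refl spr \<tau> c(1)] show False by simp
qed

section \<open>Almost disjoint subsequences\<close>

text \<open>A subsequence with summable norms has a sum of finite norm, so its terms tend to zero almost everywhere.\<close>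

lemma AE_null_subsequence:
  fixes v :: "nat \<Rightarrow> real \<times> real \<Rightarrow> ennreal"
  assumes a: "1 \<le> a" "1 \<le> b" and [measurable]: "\<And>i. v i \<in> borel_measurable borel"
    and small: "\<And>\<delta>. 0 < \<delta> \<Longrightarrow> finite {i. ennreal \<delta> \<le> mixed_norm a b (v i)}"
  obtains \<iota> :: "nat \<Rightarrow> nat" where "inj \<iota>" "AE z in unit_square_measure. (\<lambda>k. v (\<iota> k) z) \<longlonglongrightarrow> 0"
proof -
  interpret N: function_norm unit_square_measure "mixed_norm a b" "min 1 (min a b)"
    using a by (intro function_norm_mixed_norm) auto
  have ex: "\<exists>i>n. mixed_norm a b (v i) < ennreal ((1/2) ^ k)" for n k
  proof -
    have "finite ({i. ennreal ((1/2) ^ k) \<le> mixed_norm a b (v i)} \<union> {..n})" by (simp add: small)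
    then obtain i where "i \<notin> {i. ennreal ((1/2) ^ k) \<le> mixed_norm a b (v i)} \<union> {..n}"
      using ex_new_if_finite[OF infinite_UNIV_nat] by blast
    then show ?thesis by (auto simp: not_le)
  qed
  have "\<exists>\<iota>. \<forall>k. mixed_norm a b (v (\<iota> k)) < ennreal ((1/2) ^ k) \<and> \<iota> k < \<iota> (Suc k)"
  proof (rule dependent_nat_choice)
    show "\<exists>i. mixed_norm a b (v i) < ennreal ((1/2) ^ 0)" using ex by blast
    show "\<exists>j. mixed_norm a b (v j) < ennreal ((1/2) ^ Suc k) \<and> i < j" for i k using ex by blast
  qed
  then obtain \<iota> where \<iota>: "\<And>k. mixed_norm a b (v (\<iota> k)) < ennreal ((1/2) ^ k)" "\<And>k. \<iota> k < \<iota> (Suc k)" by blast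
  have "enn_powr (mixed_norm a b (\<lambda>z. \<Sum>k. v (\<iota> k) z)) (min 1 (min a b))
      \<le> (\<Sum>k. enn_powr (mixed_norm a b (v (\<iota> k))) (min 1 (min a b)))"
    by (rule N.N_suminf_le) simp
  also have "\<dots> = (\<Sum>k. mixed_norm a b (v (\<iota> k)))" using a by (simp add: min_def)
  also have "\<dots> \<le> (\<Sum>k. ennreal ((1/2) ^ k))" using \<iota>(1) by (intro suminf_le) (auto intro: less_imp_le)
  also have "\<dots> = ennreal (\<Sum>k. (1/2) ^ k)" by (intro suminf_ennreal2) auto
  finally have "enn_powr (mixed_norm a b (\<lambda>z. \<Sum>k. v (\<iota> k) z)) (min 1 (min a b)) < top"
    by (rule le_less_trans) simp
  then have "mixed_norm a b (\<lambda>z. \<Sum>k. v (\<iota> k) z) < top" by simp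
  then have "AE z in unit_square_measure. (\<Sum>k. v (\<iota> k) z) < top"
    by (intro N.N_finite_AE) auto
  then have "AE z in unit_square_measure. (\<lambda>k. v (\<iota> k) z) \<longlonglongrightarrow> 0"
  proof eventually_elim
    case (elim z)
    have le: "v (\<iota> k) z \<le> (\<Sum>k. v (\<iota> k) z)" for k
      using sum_le_suminf[of "\<lambda>k. v (\<iota> k) z" "{k}"] by simp
    have eq: "ennreal (enn2real (v (\<iota> k) z)) = v (\<iota> k) z" for k
      using le_less_trans[OF le elim] by simp
    have "(\<Sum>k. ennreal (enn2real (v (\<iota> k) z))) \<noteq> top"
      using elim by (simp add: eq less_top)
    then have "summable (\<lambda>k. enn2real (v (\<iota> k) z))"
      by (intro summable_suminf_not_top) auto
    then have "(\<lambda>k. ennreal (enn2real (v (\<iota> k) z))) \<longlonglongrightarrow> ennreal 0"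
      by (intro tendsto_ennrealI summable_LIMSEQ_zero)
    then show ?case by (simp add: eq)
  qed
  moreover have "inj \<iota>" using \<iota>(2) by (intro strict_mono_imp_inj_on) (simp add: strict_mono_Suc_iff)
  ultimately show thesis by (intro that)
qed

text \<open>The gliding hump. A function that tends to zero almost everywhere meets any fixed finite sum \<open>G\<close>
  in \<open>min (u i) G\<close>, which has small norm by dominated convergence. Up to such errors the sum of the chosen
  functions is their maximum, and the maximum is bounded by the \<open>m\<close>-th power mean, as for disjoint functions.\<close>

lemma gliding_hump:
  fixes u :: "nat \<Rightarrow> real \<times> real \<Rightarrow> ennreal"
  assumes s: "1 \<le> s" and r: "1 \<le> r" and [measurable]: "\<And>i. u i \<in> borel_measurable borel"
    and bound: "\<And>i. mixed_norm s r (u i) \<le> ennreal C" and C: "0 \<le> C"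
    and null: "AE z in unit_square_measure. (\<lambda>i. u i z) \<longlonglongrightarrow> 0"
  shows "\<exists>S. finite S \<and> card S = n \<and> mixed_norm s r (\<lambda>z. \<Sum>i\<in>S. u i z) \<le> ennreal (C * real n powr (1 / min s r) + 1)"
proof -
  define m where "m = min s r"
  have m: "0 < m" "1 \<le> s / m" "1 \<le> r / m" "0 < s / m" "0 < r / m" using s r by (auto simp: m_def)
  have add: "mixed_norm s r (\<lambda>z. f z + g z) \<le> mixed_norm s r f + mixed_norm s r g"
    if "f \<in> borel_measurable borel" "g \<in> borel_measurable borel" for f g :: "real \<times> real \<Rightarrow> ennreal"
    using mixed_norm_rho_add[of 1 s r f g] that s r by simp
  define mean where "mean S z = enn_powr (\<Sum>i\<in>S. enn_powr (u i z) m) (1 / m)" for S z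
  have [measurable]: "mean S \<in> borel_measurable borel" for S 
  proof -
    have "0 < 1 / m" using m by simp
    then show ?thesis unfolding mean_def using m by measurable
  qed
  have "\<exists>S D. finite S \<and> card S = n \<and> D \<in> borel_measurable borel \<and> mixed_norm s r D \<le> of_nat n * ennreal e \<and>
      (\<forall>z. (\<Sum>i\<in>S. u i z) \<le> mean S z + D z)" if e: "0 < e" for n e
  proof (induction n)
    case 0
    show ?case by (intro exI[of _ "{}"] exI[of _ "\<lambda>z. 0"]) simp
  next
    case (Suc n)
    then obtain S D where S: "finite S" "card S = n" and [measurable]: "D \<in> borel_measurable borel"
      and D: "mixed_norm s r D \<le> of_nat n * ennreal e" and le: "\<And>z. (\<Sum>i\<in>S. u i z) \<le> mean S z + D z" by blast
    define G where "G z = (\<Sum>i\<in>S. u i z)" for z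
    have [measurable]: "G \<in> borel_measurable borel" unfolding G_def by measurable
    have "mixed_norm s r G \<le> (\<Sum>i\<in>S. mixed_norm s r (u i))"
      unfolding G_def using s r by (intro mixed_norm_sum_le) auto
    also have "\<dots> < top" using S le_less_trans[OF bound ennreal_less_top] by simp
    finally have G_fin: "mixed_norm s r G < top" .
    have "(\<lambda>i. mixed_norm s r (\<lambda>z. min (u i z) (G z))) \<longlonglongrightarrow> 0"
    proof (rule mixed_norm_dominated_0[OF _ _ _ _ _ G_fin])
      show "AE z in unit_square_measure. (\<lambda>i. min (u i z) (G z)) \<longlonglongrightarrow> 0"
        using null
      proof eventually_elim
        case (elim z)
        show ?case by (rule tendsto_sandwich[OF _ _ tendsto_const elim]) auto
      qed
    qed (use s r in auto)
    then have "\<forall>\<^sub>F i in sequentially. mixed_norm s r (\<lambda>z. min (u i z) (G z)) < ennreal e"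
      using e by (intro order_tendstoD) auto
    moreover have "\<forall>\<^sub>F i in sequentially. i \<notin> S"
      using S(1) by (auto simp: eventually_sequentially finite_nat_set_iff_bounded) (metis leD)
    ultimately have "\<forall>\<^sub>F i in sequentially. mixed_norm s r (\<lambda>z. min (u i z) (G z)) < ennreal e \<and> i \<notin> S"
      by (rule eventually_conj)
    then obtain i where i: "mixed_norm s r (\<lambda>z. min (u i z) (G z)) < ennreal e" "i \<notin> S"
      using eventually_happens'[OF sequentially_bot] by blast
    have "(\<Sum>j\<in>insert i S. u j z) \<le> mean (insert i S) z + (D z + min (u i z) (G z))" for z
    proof -
      have "u i z \<le> mean (insert i S) z"
        using m S i unfolding mean_def by (simp add: le_enn_powr_swap)
      moreover have "mean S z \<le> mean (insert i S) z"
        using m S i unfolding mean_def by (intro enn_powr_mono) auto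
      then have "G z \<le> mean (insert i S) z + D z"
        unfolding G_def using le[of z] by (meson add_right_mono order_trans)
      ultimately have "max (u i z) (G z) \<le> mean (insert i S) z + D z"
        by (simp add: add_increasing2)
      moreover have "(\<Sum>j\<in>insert i S. u j z) = max (u i z) (G z) + min (u i z) (G z)"
        using S i by (auto simp: G_def max_def min_def add.commute)
      ultimately show ?thesis by (metis add.assoc add_right_mono)
    qed
    moreover have "mixed_norm s r (\<lambda>z. D z + min (u i z) (G z)) \<le> of_nat (Suc n) * ennreal e"
    proof -
      have "mixed_norm s r (\<lambda>z. D z + min (u i z) (G z)) \<le> mixed_norm s r D + mixed_norm s r (\<lambda>z. min (u i z) (G z))"
        by (rule add) auto
      also have "\<dots> \<le> of_nat n * ennreal e + ennreal e" using D i by (intro add_mono) auto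
      finally show ?thesis by (simp add: distrib_right add.commute)
    qed
    ultimately show ?case
      using S i by (intro exI[of _ "insert i S"] exI[of _ "\<lambda>z. D z + min (u i z) (G z)"]) auto
  qed
  \<comment> \<open>the errors add up to less than \<open>n * e\<close>, so \<open>e\<close> is chosen after \<open>n\<close>\<close>
  from this[of "1 / (real n + 1)" n] obtain S D where S: "finite S" "card S = n" and [measurable]: "D \<in> borel_measurable borel"
      and D: "mixed_norm s r D \<le> of_nat n * ennreal (1 / (real n + 1))" and le: "\<And>z. (\<Sum>i\<in>S. u i z) \<le> mean S z + D z" by auto
  have "mixed_norm s r (mean S) \<le> ennreal (C * real n powr (1 / m))"
  proof -
    have "mixed_norm s r (mean S) = enn_powr (mixed_norm (s / m) (r / m) (\<lambda>z. \<Sum>i\<in>S. enn_powr (u i z) m)) (1 / m)"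
      unfolding mean_def using m s r by (simp add: mixed_norm_enn_powr)
    also have "\<dots> \<le> enn_powr (\<Sum>i\<in>S. mixed_norm (s / m) (r / m) (\<lambda>z. enn_powr (u i z) m)) (1 / m)"
      using m by (intro enn_powr_mono mixed_norm_sum_le) auto
    also have "\<dots> = enn_powr (\<Sum>i\<in>S. enn_powr (mixed_norm s r (u i)) m) (1 / m)"
      using m by (simp add: mixed_norm_enn_powr)
    also have "\<dots> \<le> enn_powr (\<Sum>i\<in>S. enn_powr (ennreal C) m) (1 / m)"
      using m bound by (intro enn_powr_mono sum_mono) auto
    also have "\<dots> = enn_powr (ennreal (real n * C powr m)) (1 / m)"
      using S C by (simp add: ennreal_mult ennreal_of_nat_eq_real_of_nat)
    also have "\<dots> = ennreal (C * real n powr (1 / m))"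
      using m C by (simp add: powr_mult powr_powr mult.commute)
    finally show ?thesis .
  qed
  moreover have "mixed_norm s r D \<le> ennreal 1"
  proof -
    have "of_nat n * ennreal (1 / (real n + 1)) = ennreal (real n * (1 / (real n + 1)))"
      by (subst ennreal_mult) (auto simp: ennreal_of_nat_eq_real_of_nat)
    also have "\<dots> \<le> ennreal 1" by (intro ennreal_leI) (simp add: field_simps)
    finally show ?thesis using D by (rule order_trans[rotated])
  qed
  moreover have "mixed_norm s r (\<lambda>z. \<Sum>i\<in>S. u i z) \<le> mixed_norm s r (mean S) + mixed_norm s r D"
    using s r le by (intro order_trans[OF mixed_norm_mono[of s r _ "\<lambda>z. mean S z + D z"] add]) auto
  ultimately have "mixed_norm s r (\<lambda>z. \<Sum>i\<in>S. u i z) \<le> ennreal (C * real n powr (1 / m)) + ennreal 1"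
    by (meson add_mono order_trans)
  then show ?thesis using S C by (auto simp: m_def ennreal_plus intro!: exI[of _ S])
qed

text \<open>If \<open>2 < p < min s r\<close>, the functions tend to zero in \<open>L\<^sub>2\<close>, so some are almost disjoint. Their sums then
  grow at most like \<open>n powr (1 / min s r)\<close>.\<close>

lemma spreads_gap_both:
  fixes h :: "nat \<Rightarrow> real \<times> real \<Rightarrow> 'k::euclidean_space"
  assumes sr: "2 \<le> s" "2 \<le> r" and spr: "spreads s r \<tau> h" and \<tau>: "\<tau> < 1 / 2"
  shows "\<tau> \<le> 1 / min s r"
proof (rule ccontr)
  assume "\<not> \<tau> \<le> 1 / min s r"
  then have gap: "1 / min s r < \<tau>" by simp
  have \<tau>0: "0 < \<tau>" using gap sr by (smt (verit) divide_nonneg_nonneg)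
  have [measurable]: "\<And>i. h i \<in> borel_measurable borel" using spr by (simp add: spreads_def)
  obtain \<iota> where \<iota>: "inj \<iota>" "AE z in unit_square_measure. (\<lambda>k. ennreal (norm (h (\<iota> k) z))) \<longlonglongrightarrow> 0"
  proof (rule AE_null_subsequence[of 2 2 "\<lambda>i z. ennreal (norm (h i z))"])
    show "finite {i. ennreal \<delta> \<le> mixed_fnorm 2 2 (h i)}" if "0 < \<delta>" for \<delta>
      using \<tau> sr by (intro spreads_small[OF _ _ _ _ spr _ that]) auto
  qed auto
  obtain c where c: "0 < c" "\<And>I B. finite I \<Longrightarrow>
      ennreal (c * real (card I) powr \<tau>) \<le> signed_norm s r h I B"
    using spr unfolding spreads_def by blast
  obtain C where C: "0 < C" "\<And>i. mixed_fnorm s r (h i) \<le> ennreal C"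
    by (rule spreads_single[OF spr]) (rule that)
  have "c * real n powr \<tau> \<le> C * real n powr (1 / min s r) + 1" for n
  proof -
    obtain S where S: "finite S" "card S = n"
      "mixed_norm s r (\<lambda>z. \<Sum>k\<in>S. ennreal (norm (h (\<iota> k) z))) \<le> ennreal (C * real n powr (1 / min s r) + 1)"
      using gliding_hump[of s r "\<lambda>k z. ennreal (norm (h (\<iota> k) z))" C n] sr C \<iota>(2) by auto
    have card: "card (\<iota> ` S) = n" using S \<iota>(1) by (simp add: card_image inj_on_subset)
    have "ennreal (c * real n powr \<tau>) \<le> signed_norm s r h (\<iota> ` S) UNIV"
      using c(2)[of "\<iota> ` S" UNIV] S card by simp
    also have "\<dots> \<le> mixed_norm s r (\<lambda>z. \<Sum>k\<in>S. ennreal (norm (h (\<iota> k) z)))"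
    proof (rule mixed_norm_mono)
      fix z
      have "norm (\<Sum>i\<in>\<iota> ` S. sgn_of UNIV i *\<^sub>R h i z) \<le> (\<Sum>i\<in>\<iota> ` S. norm (h i z))"
        by (rule sum_norm_le) simp
      also have "\<dots> = (\<Sum>k\<in>S. norm (h (\<iota> k) z))"
        using \<iota>(1) by (simp add: sum.reindex inj_on_subset)
      finally show "ennreal (norm (\<Sum>i\<in>\<iota> ` S. sgn_of UNIV i *\<^sub>R h i z)) \<le> (\<Sum>k\<in>S. ennreal (norm (h (\<iota> k) z)))"
        by (simp add: ennreal_leI)
    qed (use sr in auto)
    also note S(3)
    finally have "ennreal (c * real n powr \<tau>) \<le> ennreal (C * real n powr (1 / min s r) + 1)" .
    then show ?thesis using C by (subst (asm) ennreal_le_iff) auto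
  qed
  then show False by (rule powr_growth[OF gap \<tau>0 c(1)])
qed

text \<open>If \<open>max 2 r < p < s\<close>, the functions tend to zero in \<open>L\<^sub>q(L\<^sub>r)\<close> with \<open>q = max 2 r\<close>, so for some of them
  the norms of their sections are almost disjoint as functions of \<open>x\<close>.\<close>

lemma spreads_gap_outer:
  fixes h :: "nat \<Rightarrow> real \<times> real \<Rightarrow> 'k::euclidean_space"
  assumes r: "0 < r" and sr: "2 \<le> s" "r \<le> s" and spr: "spreads s r \<tau> h" and \<tau>: "\<tau> < 1 / max 2 r"
  shows "\<tau> \<le> 1 / s"
proof (rule ccontr)
  assume "\<not> \<tau> \<le> 1 / s"
  then have gap: "1 / s < \<tau>" by simp
  define q where "q = max 2 r"
  define \<rho> where "\<rho> = min 1 r"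
  have q: "1 \<le> q" "q \<le> s" "0 < q" "max 2 (max q r) = q" using sr by (auto simp: q_def)
  have \<rho>: "0 < \<rho>" "\<rho> \<le> 1" "\<rho> \<le> r" "1 \<le> s / \<rho>" "0 < s / \<rho>" using r sr by (auto simp: \<rho>_def)
  have gap': "\<rho> / s < \<tau> * \<rho>" "0 < \<tau> * \<rho>"
  proof -
    show "\<rho> / s < \<tau> * \<rho>" using mult_strict_right_mono[OF gap \<rho>(1)] by simp
    then show "0 < \<tau> * \<rho>" using \<rho> sr by (smt (verit) divide_nonneg_nonneg)
  qed
  have [measurable]: "\<And>i. h i \<in> borel_measurable borel" using spr by (simp add: spreads_def)
  define \<phi> where "\<phi> i x = Lnorm unit_measure r (\<lambda>y. ennreal (norm (h i (x, y))))" for i x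
  have \<phi> [measurable]: "\<phi> i \<in> borel_measurable borel" for i
    unfolding \<phi>_def using r by measurable
  have fst_meas [measurable]: "(\<lambda>z. f (fst z)) \<in> borel_measurable borel"
    if "f \<in> borel_measurable borel" for f :: "real \<Rightarrow> ennreal"
    using that by (rule measurable_compose[rotated]) (intro borel_measurable_continuous_onI continuous_intros)
  have fst_norm: "mixed_norm a b (\<lambda>z. f (fst z)) = Lnorm unit_measure a f" if "0 < b" for a b and f :: "real \<Rightarrow> ennreal"
    using that by (simp add: mixed_norm_def Lnorm_const)
  obtain \<iota> where \<iota>: "inj \<iota>" "AE z in unit_square_measure. (\<lambda>k. \<phi> (\<iota> k) (fst z)) \<longlonglongrightarrow> 0"
  proof (rule AE_null_subsequence[of q q "\<lambda>i z. \<phi> i (fst z)"])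
    show "finite {i. ennreal \<delta> \<le> mixed_norm q q (\<lambda>z. \<phi> i (fst z))}" if "0 < \<delta>" for \<delta>
    proof -
      have "mixed_norm q q (\<lambda>z. \<phi> i (fst z)) = mixed_fnorm q r (h i)" for i
        using q by (simp add: fst_norm) (simp add: \<phi>_def[abs_def] mixed_norm_def)
      then show ?thesis
        using spreads_small[OF q(3,2) r order_refl spr _ that] \<tau> q by (simp add: q_def)
    qed
  qed (use q in auto)
  obtain c where c: "0 < c" "\<And>I B. finite I \<Longrightarrow>
      ennreal (c * real (card I) powr \<tau>) \<le> signed_norm s r h I B"
    using spr unfolding spreads_def by blast
  obtain C where C: "0 < C" "\<And>i. mixed_fnorm s r (h i) \<le> ennreal C"
    by (rule spreads_single[OF spr]) (rule that)
  have "c powr \<rho> * real n powr (\<tau> * \<rho>) \<le> C powr \<rho> * real n powr (\<rho> / s) + 1" for n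
  proof -
    let ?u = "\<lambda>k z. enn_powr (\<phi> (\<iota> k) (fst z)) \<rho>"
    have "\<exists>S. finite S \<and> card S = n \<and>
      mixed_norm (s / \<rho>) (s / \<rho>) (\<lambda>z. \<Sum>k\<in>S. ?u k z) \<le> ennreal (C powr \<rho> * real n powr (1 / min (s / \<rho>) (s / \<rho>)) + 1)"
    proof (rule gliding_hump)
      show "mixed_norm (s / \<rho>) (s / \<rho>) (?u k) \<le> ennreal (C powr \<rho>)" for k
      proof -
        have "mixed_norm (s / \<rho>) (s / \<rho>) (?u k) = enn_powr (mixed_norm s s (\<lambda>z. \<phi> (\<iota> k) (fst z))) \<rho>"
          using \<rho> by (simp add: mixed_norm_enn_powr)
        also have "\<dots> = enn_powr (mixed_fnorm s r (h (\<iota> k))) \<rho>"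
          using sr by (simp add: fst_norm) (simp add: \<phi>_def[abs_def] mixed_norm_def)
        also have "\<dots> \<le> enn_powr (ennreal C) \<rho>" using \<rho> C by (intro enn_powr_mono) auto
        finally show ?thesis using C by simp
      qed
      show "AE z in unit_square_measure. (\<lambda>k. ?u k z) \<longlonglongrightarrow> 0"
        using \<iota>(2) by eventually_elim (rule tendsto_enn_powr_0[OF _ \<rho>(1)])
    qed (use \<rho> in auto)
    then obtain S where S: "finite S" "card S = n"
      "mixed_norm (s / \<rho>) (s / \<rho>) (\<lambda>z. \<Sum>k\<in>S. ?u k z) \<le> ennreal (C powr \<rho> * real n powr (\<rho> / s) + 1)" by auto
    have card: "card (\<iota> ` S) = n" using S \<iota>(1) by (simp add: card_image inj_on_subset)
    have "enn_powr (ennreal (c * real n powr \<tau>)) \<rho>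
        \<le> enn_powr (signed_norm s r h (\<iota> ` S) UNIV) \<rho>"
      using c(2)[of "\<iota> ` S" UNIV] S card \<rho> by (intro enn_powr_mono) auto
    also have "\<dots> = Lnorm unit_measure (s / \<rho>)
        (\<lambda>x. enn_powr (Lnorm unit_measure r (\<lambda>y. ennreal (norm (\<Sum>i\<in>\<iota> ` S. sgn_of UNIV i *\<^sub>R h i (x, y))))) \<rho>)"
      using \<rho> by (simp add: mixed_norm_def Lnorm_enn_powr)
    also have "\<dots> \<le> Lnorm unit_measure (s / \<rho>) (\<lambda>x. \<Sum>k\<in>S. enn_powr (\<phi> (\<iota> k) x) \<rho>)"
    proof (rule Lnorm_mono[OF \<rho>(5)])
      fix x
      interpret r: function_norm unit_measure "Lnorm unit_measure r" \<rho>
        unfolding \<rho>_def by (rule function_norm_Lnorm[OF r]) simp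
      have "enn_powr (Lnorm unit_measure r (\<lambda>y. ennreal (norm (\<Sum>i\<in>\<iota> ` S. sgn_of UNIV i *\<^sub>R h i (x, y))))) \<rho>
          \<le> enn_powr (Lnorm unit_measure r (\<lambda>y. \<Sum>k\<in>S. ennreal (norm (h (\<iota> k) (x, y))))) \<rho>"
      proof (intro enn_powr_mono Lnorm_mono r)
        fix y
        have "norm (\<Sum>i\<in>\<iota> ` S. sgn_of UNIV i *\<^sub>R h i (x, y)) \<le> (\<Sum>i\<in>\<iota> ` S. norm (h i (x, y)))"
          by (rule sum_norm_le) simp
        also have "\<dots> = (\<Sum>k\<in>S. norm (h (\<iota> k) (x, y)))"
          using \<iota>(1) by (simp add: sum.reindex inj_on_subset)
        finally show "ennreal (norm (\<Sum>i\<in>\<iota> ` S. sgn_of UNIV i *\<^sub>R h i (x, y))) \<le> (\<Sum>k\<in>S. ennreal (norm (h (\<iota> k) (x, y))))"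
          by (simp add: ennreal_leI)
      qed (use \<rho> in auto)
      also have "\<dots> \<le> (\<Sum>k\<in>S. enn_powr (\<phi> (\<iota> k) x) \<rho>)"
        unfolding \<phi>_def by (rule r.N_sum_le) simp
      finally show "enn_powr (Lnorm unit_measure r (\<lambda>y. ennreal (norm (\<Sum>i\<in>\<iota> ` S. sgn_of UNIV i *\<^sub>R h i (x, y))))) \<rho>
          \<le> (\<Sum>k\<in>S. enn_powr (\<phi> (\<iota> k) x) \<rho>)" .
    qed
    also have "\<dots> = mixed_norm (s / \<rho>) (s / \<rho>) (\<lambda>z. \<Sum>k\<in>S. ?u k z)"
      using fst_norm[OF \<rho>(5), of "s / \<rho>" "\<lambda>x. \<Sum>k\<in>S. enn_powr (\<phi> (\<iota> k) x) \<rho>"] by simp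
    also note S(3)
    finally have "ennreal ((c * real n powr \<tau>) powr \<rho>) \<le> ennreal (C powr \<rho> * real n powr (\<rho> / s) + 1)"
      using c(1) by (subst (asm) enn_powr_ennreal) auto
    then show ?thesis using c(1) by (subst (asm) ennreal_le_iff) (auto simp: powr_mult powr_powr)
  qed
  moreover have "0 < c powr \<rho>" using c(1) by simp
  ultimately show False using powr_growth[OF gap'] by blast
qed

section \<open>Disjoint bumps\<close>

text \<open>Functions on disjoint dyadic intervals, normalised in \<open>L\<^sub>r\<close>.\<close>

definition bump :: "real \<Rightarrow> nat \<Rightarrow> real \<Rightarrow> real" where
  "bump r n x = 2 powr (real (Suc n) / r) * indicator {(1/2) ^ Suc n <..< (1/2) ^ n} x"

lemma bump_nonneg [simp]: "0 \<le> bump r n x"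
  by (simp add: bump_def)

lemma borel_measurable_bump [measurable]: "bump r n \<in> borel_measurable borel"
  unfolding bump_def by measurable

lemma bump_disjoint:
  assumes "bump r i x \<noteq> 0" "bump r j x \<noteq> 0"
  shows "i = j"
proof -
  have *: False if "i < j" "bump r i x \<noteq> 0" "bump r j x \<noteq> 0" for i j
  proof -
    have "x < (1/2) ^ j" "(1/2) ^ Suc i < x" using that by (auto simp: bump_def split: split_indicator_asm)
    moreover have "(1/2::real) ^ j \<le> (1/2) ^ Suc i" using that by (intro power_decreasing) auto
    ultimately show False by simp
  qed
  show ?thesis using *[of i j] *[of j i] assms by (cases i j rule: linorder_cases) auto
qed

text \<open>If at most one term is nonzero, sums commute with every function that vanishes at zero.\<close>

lemma sum_at_most_one:
  fixes f :: "nat \<Rightarrow> 'b::comm_monoid_add" and \<Phi> :: "'b \<Rightarrow> 'c::comm_monoid_add"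
  assumes one: "\<And>i j. f i \<noteq> 0 \<Longrightarrow> f j \<noteq> 0 \<Longrightarrow> i = j" and zero: "\<Phi> 0 = 0" and I: "finite I"
  shows "\<Phi> (\<Sum>n\<in>I. f n) = (\<Sum>n\<in>I. \<Phi> (f n))"
proof (cases "\<exists>k\<in>I. f k \<noteq> 0")
  case True
  then obtain k where k: "k \<in> I" "f k \<noteq> 0" by auto
  then have "f n = 0" if "n \<noteq> k" for n using one that by blast
  then show ?thesis using k I zero by (simp add: sum.remove[OF I k(1)])
qed (simp add: zero)

lemma emeasure_unit_measure_interval:
  "0 \<le> a \<Longrightarrow> a \<le> b \<Longrightarrow> b \<le> 1 \<Longrightarrow> emeasure unit_measure {a<..<b} = ennreal (b - a)"
proof -
  assume ab: "0 \<le> a" "a \<le> b" "b \<le> 1"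
  have "emeasure unit_measure {a<..<b} = (\<integral>\<^sup>+x. indicator {0..1} x * indicator {a<..<b} x \<partial>lborel)"
    by (simp add: unit_measure_def emeasure_density)
  also have "\<dots> = (\<integral>\<^sup>+x. indicator {a<..<b} x \<partial>lborel)"
    using ab by (intro nn_integral_cong) (auto split: split_indicator)
  finally show ?thesis using ab by simp
qed

lemma power2_ennreal: "(2::ennreal) ^ n = ennreal (2 ^ n)"
  using ennreal_power[of 2 n] by simp

lemma Lnorm_bump:
  assumes r: "0 < r"
  shows "Lnorm unit_measure r (\<lambda>y. \<Sum>n<m. b n * ennreal (bump r n y)) = enn_powr (\<Sum>n<m. enn_powr (b n) r) (1 / r)"
proof -
  have pow: "enn_powr (ennreal (bump r n y)) r = 2 ^ Suc n * indicator {(1/2) ^ Suc n <..< (1/2) ^ n} y" for n y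
  proof -
    have "(2::ennreal) ^ Suc n = ennreal (2 powr real (Suc n))"
      by (subst powr_realpow) (auto simp only: power2_ennreal)
    moreover have "(2 powr (real (Suc n) / r)) powr r = 2 powr real (Suc n)" using r by (simp add: powr_powr)
    ultimately show ?thesis by (auto simp: bump_def split: split_indicator)
  qed
  have int: "2 ^ Suc n * emeasure unit_measure {(1/2) ^ Suc n <..< (1/2) ^ n} = 1" for n
  proof -
    have "emeasure unit_measure {(1/2) ^ Suc n <..< (1/2) ^ n} = ennreal ((1/2) ^ n - (1/2) ^ Suc n)"
      by (rule emeasure_unit_measure_interval) (auto simp: power_le_one)
    then have "2 ^ Suc n * emeasure unit_measure {(1/2) ^ Suc n <..< (1/2) ^ n}
        = ennreal (2 ^ Suc n) * ennreal ((1/2) ^ n - (1/2) ^ Suc n)"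
      by (simp only: power2_ennreal)
    also have "\<dots> = ennreal (2 ^ Suc n * ((1/2) ^ n - (1/2) ^ Suc n))"
      by (rule ennreal_mult'[symmetric]) simp
    also have "(2::real) ^ Suc n * ((1/2) ^ n - (1/2) ^ Suc n) = 1"
      by (simp add: algebra_simps flip: power_mult_distrib)
    finally show ?thesis by simp
  qed
  have "enn_powr (\<Sum>n<m. b n * ennreal (bump r n y)) r
      = (\<Sum>n<m. enn_powr (b n) r * (2 ^ Suc n * indicator {(1/2) ^ Suc n <..< (1/2) ^ n} y))" for y
  proof -
    have "enn_powr (\<Sum>n<m. b n * ennreal (bump r n y)) r = (\<Sum>n<m. enn_powr (b n * ennreal (bump r n y)) r)"
    proof (rule sum_at_most_one)
      fix i j assume "b i * ennreal (bump r i y) \<noteq> 0" "b j * ennreal (bump r j y) \<noteq> 0"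
      then have "bump r i y \<noteq> 0" "bump r j y \<noteq> 0" by auto
      then show "i = j" by (rule bump_disjoint)
    qed auto
    then show ?thesis by (simp only: enn_powr_mult pow)
  qed
  then have "(\<integral>\<^sup>+y. enn_powr (\<Sum>n<m. b n * ennreal (bump r n y)) r \<partial>unit_measure)
      = (\<Sum>n<m. enn_powr (b n) r * (2 ^ Suc n * emeasure unit_measure {(1/2) ^ Suc n <..< (1/2) ^ n}))"
    by (simp only:) (simp add: nn_integral_sum nn_integral_cmult)
  also have "\<dots> = (\<Sum>n<m. enn_powr (b n) r)"
    by (simp only: int mult_1_right)
  finally show ?thesis by (simp add: Lnorm_def)
qed

lemma ennreal_norm_bump_sum:
  fixes a :: "nat \<Rightarrow> 'k::real_normed_field"
  assumes "\<And>n. 0 \<le> c n"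
  shows "ennreal (norm (\<Sum>n<m. a n * of_real (c n * bump r n y)))
    = (\<Sum>n<m. ennreal (norm (a n) * c n) * ennreal (bump r n y))"
proof -
  have "ennreal (norm (\<Sum>n<m. a n * of_real (c n * bump r n y))) = (\<Sum>n<m. ennreal (norm (a n * of_real (c n * bump r n y))))"
  proof (rule sum_at_most_one[where \<Phi> = "\<lambda>v. ennreal (norm v)"])
    fix i j assume "a i * of_real (c i * bump r i y) \<noteq> 0" "a j * of_real (c j * bump r j y) \<noteq> 0"
    then have "bump r i y \<noteq> 0" "bump r j y \<noteq> 0" by auto
    then show "i = j" by (rule bump_disjoint)
  qed auto
  then show ?thesis using assms by (simp add: norm_mult mult.assoc flip: ennreal_mult)
qed

lemma of_real_fst_measurable [measurable]:
  "(\<lambda>z :: real \<times> real. f (fst z)) \<in> borel_measurable borel"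
  "(\<lambda>z :: real \<times> real. f (snd z)) \<in> borel_measurable borel"
  if "f \<in> borel_measurable borel" for f :: "real \<Rightarrow> 'b::topological_space"
  by (rule measurable_compose[OF _ that], intro borel_measurable_continuous_onI continuous_intros)+

lemma embeds_ell_inner:
  assumes s: "0 < s" and r: "0 < r"
  shows "embeds_isomorphically (ell_space r :: ('k::{real_normed_field, euclidean_space}, _) qn_space) (mixed_L s r)"
proof (rule embeds_if_finite_sums[OF s r r zero_less_one zero_less_one, of "\<lambda>n z. of_real (bump r n (snd z))"])
  have eq: "mixed_fnorm s r (\<lambda>z. \<Sum>n<m. a n * of_real (bump r n (snd z)))
      = ennreal ((\<Sum>n<m. norm (a n) powr r) powr (1 / r))" for a :: "nat \<Rightarrow> 'k" and m
    using s r ennreal_norm_bump_sum[of "\<lambda>_. 1" a r]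
    by (simp add: mixed_norm_def Lnorm_bump Lnorm_const sum_nonneg)
  show "ennreal (1 * (\<Sum>n<m. norm (a n) powr r) powr (1 / r)) \<le> mixed_fnorm s r (\<lambda>z. \<Sum>n<m. a n * of_real (bump r n (snd z)))"
    "mixed_fnorm s r (\<lambda>z. \<Sum>n<m. a n * of_real (bump r n (snd z))) \<le> ennreal (1 * (\<Sum>n<m. norm (a n) powr r) powr (1 / r))"
    for a :: "nat \<Rightarrow> 'k" and m by (simp_all add: eq)
qed measurable

lemma embeds_ell_outer:
  assumes s: "0 < s" and r: "0 < r"
  shows "embeds_isomorphically (ell_space s :: ('k::{real_normed_field, euclidean_space}, _) qn_space) (mixed_L s r)"
proof (rule embeds_if_finite_sums[OF s r s zero_less_one zero_less_one, of "\<lambda>n z. of_real (bump s n (fst z))"])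
  have eq: "mixed_fnorm s r (\<lambda>z. \<Sum>n<m. a n * of_real (bump s n (fst z)))
      = ennreal ((\<Sum>n<m. norm (a n) powr s) powr (1 / s))" for a :: "nat \<Rightarrow> 'k" and m
    using s r ennreal_norm_bump_sum[of "\<lambda>_. 1" a s]
    by (simp add: mixed_norm_def Lnorm_bump Lnorm_const sum_nonneg)
  show "ennreal (1 * (\<Sum>n<m. norm (a n) powr s) powr (1 / s)) \<le> mixed_fnorm s r (\<lambda>z. \<Sum>n<m. a n * of_real (bump s n (fst z)))"
    "mixed_fnorm s r (\<lambda>z. \<Sum>n<m. a n * of_real (bump s n (fst z))) \<le> ennreal (1 * (\<Sum>n<m. norm (a n) powr s) powr (1 / s))"
    for a :: "nat \<Rightarrow> 'k" and m by (simp_all add: eq)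
qed measurable

section \<open>Rademacher functions\<close>

definition rademacher :: "nat \<Rightarrow> real \<Rightarrow> real" where
  "rademacher n x = sgn_of (bits x) n"

lemma rademacher_sgn_of: "n < m \<Longrightarrow> rademacher n x = sgn_of (bits x \<inter> {..<m}) n"
  by (simp add: rademacher_def sgn_of_def)

lemma rademacher_sum: "(\<Sum>n<m. rademacher n x *\<^sub>R a n) = (\<Sum>n<m. sgn_of (bits x \<inter> {..<m}) n *\<^sub>R a n)"
  by (intro sum.cong refl) (simp add: rademacher_sgn_of[of _ m])

lemma borel_measurable_rademacher [measurable]: "rademacher n \<in> borel_measurable borel"
proof -
  have "rademacher n = (\<lambda>x. sgn_of (bits x \<inter> {..<Suc n}) n)"
    by (simp add: fun_eq_iff rademacher_sgn_of[of n "Suc n"])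
  then show ?thesis using measurable_bits[of "\<lambda>A. sgn_of A n" "Suc n"] by simp
qed

text \<open>Integrals that depend on \<open>x\<close> through the first \<open>m\<close> Rademacher functions are averages over signs.\<close>

lemma Lnorm_signs:
  assumes "0 < r"
  shows "enn_powr (Lnorm unit_measure r (\<lambda>x. \<Phi> (bits x \<inter> {..<m}))) r = (\<Sum>A\<in>Pow {..<m}. enn_powr (\<Phi> A) r) / 2 ^ m"
  using assms nn_integral_bits[of "\<lambda>A. enn_powr (\<Phi> A) r" m] by (simp add: enn_powr_Lnorm)

lemma ennreal_le_divide_power2: "a / 2 ^ m \<le> (b::ennreal) \<longleftrightarrow> a \<le> 2 ^ m * b"
proof -
  have "2 ^ m * (a / 2 ^ m) = a" by (simp add: ennreal_times_divide mult.commute[of "2 ^ m"] ennreal_mult_divide_eq)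
  then show ?thesis using ennreal_mult_le_mult_iff[of "2 ^ m" "a / 2 ^ m" b] by simp
qed

lemma Lnorm_rademacher:
  assumes r: "0 < r"
  obtains k K where "0 < k" "0 < K" "\<And>m (a :: nat \<Rightarrow> 'k::euclidean_space).
      ennreal k * enn_powr (\<Sum>n<m. enn_powr (ennreal (norm (a n))) 2) (1 / 2)
        \<le> Lnorm unit_measure r (\<lambda>x. ennreal (norm (\<Sum>n<m. rademacher n x *\<^sub>R a n))) \<and>
      Lnorm unit_measure r (\<lambda>x. ennreal (norm (\<Sum>n<m. rademacher n x *\<^sub>R a n)))
        \<le> ennreal K * enn_powr (\<Sum>n<m. enn_powr (ennreal (norm (a n))) 2) (1 / 2)"
proof -
  obtain K where K: "0 < K" and up: "\<And>(I :: nat set) (a :: nat \<Rightarrow> 'k). finite I \<Longrightarrow>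
    (\<Sum>A\<in>Pow I. enn_powr (ennreal (norm (\<Sum>i\<in>I. sgn_of A i *\<^sub>R a i))) r)
      \<le> ennreal (2 ^ card I * K) * enn_powr (\<Sum>i\<in>I. enn_powr (ennreal (norm (a i))) 2) (r / 2)"
    by (rule khinchine_upper_ennreal[OF r]) auto
  obtain k where k: "0 < k" and low: "\<And>(I :: nat set) (a :: nat \<Rightarrow> 'k). finite I \<Longrightarrow>
    2 ^ card I * enn_powr (\<Sum>i\<in>I. enn_powr (ennreal (norm (a i))) 2) (r / 2)
      \<le> ennreal k * (\<Sum>A\<in>Pow I. enn_powr (ennreal (norm (\<Sum>i\<in>I. sgn_of A i *\<^sub>R a i))) r)"
    by (rule khinchine_lower_ennreal[OF r]) auto
  show thesis
  proof (rule that[of "1 / k powr (1 / r)" "K powr (1 / r)"])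
    show "0 < 1 / k powr (1 / r)" "0 < K powr (1 / r)" using k K by auto
    fix m and a :: "nat \<Rightarrow> 'k"
    let ?L = "Lnorm unit_measure r (\<lambda>x. ennreal (norm (\<Sum>n<m. rademacher n x *\<^sub>R a n)))"
    let ?S = "\<Sum>A\<in>Pow {..<m}. enn_powr (ennreal (norm (\<Sum>n<m. sgn_of A n *\<^sub>R a n))) r"
    define Q where "Q = (\<Sum>n<m. enn_powr (ennreal (norm (a n))) 2)"
    have L: "enn_powr ?L r = ?S / 2 ^ m"
      unfolding rademacher_sum by (rule Lnorm_signs[OF r])
    have "?S \<le> 2 ^ m * (ennreal K * enn_powr Q (r / 2))"
      using up[of "{..<m}" a] K by (simp add: Q_def power2_ennreal ennreal_mult mult.assoc)
    then have "enn_powr ?L r \<le> ennreal K * enn_powr Q (r / 2)"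
      unfolding L ennreal_le_divide_power2 .
    then have "enn_powr (enn_powr ?L r) (1 / r) \<le> enn_powr (ennreal K * enn_powr Q (r / 2)) (1 / r)"
      using r by (intro enn_powr_mono) auto
    then have 1: "?L \<le> ennreal (K powr (1 / r)) * enn_powr Q (1 / 2)"
      using r K by (simp add: enn_powr_enn_powr enn_powr_mult)
    have "2 ^ m * (?S / 2 ^ m) = ?S"
      by (simp add: ennreal_times_divide mult.commute[of "2 ^ m"] ennreal_mult_divide_eq)
    then have "2 ^ m * enn_powr Q (r / 2) \<le> ennreal k * (2 ^ m * enn_powr ?L r)"
      using low[of "{..<m}" a] by (simp add: Q_def L)
    then have "2 ^ m * enn_powr Q (r / 2) \<le> 2 ^ m * (ennreal k * enn_powr ?L r)"
      by (simp add: mult.left_commute)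
    then have "enn_powr Q (r / 2) \<le> ennreal k * enn_powr ?L r"
      by (subst (asm) ennreal_mult_le_mult_iff) auto
    then have "enn_powr (enn_powr Q (r / 2)) (1 / r) \<le> enn_powr (ennreal k * enn_powr ?L r) (1 / r)"
      using r by (intro enn_powr_mono) auto
    then have "enn_powr Q (1 / 2) \<le> ennreal (k powr (1 / r)) * ?L"
      using r k by (simp add: enn_powr_enn_powr enn_powr_mult)
    then have "ennreal (1 / k powr (1 / r)) * enn_powr Q (1 / 2) \<le> ennreal (1 / k powr (1 / r)) * (ennreal (k powr (1 / r)) * ?L)"
      by (rule mult_left_mono) simp
    also have "\<dots> = ?L" using k by (simp flip: mult.assoc ennreal_mult)
    finally have 2: "ennreal (1 / k powr (1 / r)) * enn_powr Q (1 / 2) \<le> ?L" .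
    show "ennreal (1 / k powr (1 / r)) * enn_powr (\<Sum>n<m. enn_powr (ennreal (norm (a n))) 2) (1 / 2) \<le> ?L \<and>
      ?L \<le> ennreal (K powr (1 / r)) * enn_powr (\<Sum>n<m. enn_powr (ennreal (norm (a n))) 2) (1 / 2)"
      using 1 2 unfolding Q_def by simp
  qed
qed

lemma scale_rademacher: "a * of_real (rademacher n x) = rademacher n x *\<^sub>R (a :: 'k::real_normed_field)"
  by (simp add: scaleR_conv_of_real mult.commute)

lemma embeds_ell_2:
  assumes s: "0 < s" and r: "0 < r"
  shows "embeds_isomorphically (ell_space 2 :: ('k::{real_normed_field, euclidean_space}, _) qn_space) (mixed_L s r)"
proof -
  obtain k K where kK: "0 < k" "0 < K" and bounds: "\<And>m (a :: nat \<Rightarrow> 'k).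
      ennreal k * enn_powr (\<Sum>n<m. enn_powr (ennreal (norm (a n))) 2) (1 / 2)
        \<le> Lnorm unit_measure r (\<lambda>x. ennreal (norm (\<Sum>n<m. rademacher n x *\<^sub>R a n))) \<and>
      Lnorm unit_measure r (\<lambda>x. ennreal (norm (\<Sum>n<m. rademacher n x *\<^sub>R a n)))
        \<le> ennreal K * enn_powr (\<Sum>n<m. enn_powr (ennreal (norm (a n))) 2) (1 / 2)"
    by (rule Lnorm_rademacher[OF r]) auto
  have eq: "mixed_fnorm s r (\<lambda>z. \<Sum>n<m. a n * of_real (rademacher n (snd z)))
      = Lnorm unit_measure r (\<lambda>x. ennreal (norm (\<Sum>n<m. rademacher n x *\<^sub>R a n)))" for a :: "nat \<Rightarrow> 'k" and m
    using s by (simp add: mixed_norm_def Lnorm_const scale_rademacher)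
  have sq: "ennreal c * enn_powr (\<Sum>n<m. enn_powr (ennreal (norm (a n))) 2) (1 / 2)
      = ennreal (c * (\<Sum>n<m. norm (a n) powr 2) powr (1 / 2))" if "0 < c" for c m and a :: "nat \<Rightarrow> 'k"
    using that by (simp add: sum_nonneg ennreal_mult)
  show ?thesis
  proof (rule embeds_if_finite_sums[OF s r _ kK, of _ "\<lambda>n z. of_real (rademacher n (snd z))"])
    fix a :: "nat \<Rightarrow> 'k" and m
    show "ennreal (k * (\<Sum>n<m. norm (a n) powr 2) powr (1 / 2))
        \<le> mixed_fnorm s r (\<lambda>z. \<Sum>n<m. a n * of_real (rademacher n (snd z)))"
      "mixed_fnorm s r (\<lambda>z. \<Sum>n<m. a n * of_real (rademacher n (snd z)))
        \<le> ennreal (K * (\<Sum>n<m. norm (a n) powr 2) powr (1 / 2))"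
      using bounds[where m = m and a = a] unfolding eq sq[OF kK(1)] sq[OF kK(2)] by auto
  qed (simp, measurable)
qed

section \<open>Stable sequences\<close>

text \<open>These functions are uniformly distributed. The squares \<open>(n + 2)\<^sup>2\<close> and \<open>(n + 3)\<^sup>2\<close> differ by at least \<open>n + 2\<close>, so
  the functions \<open>unif j\<close> with \<open>n < j\<close> ignore the first \<open>n + 2\<close> of the digits that determine \<open>unif n\<close>. Hence the events
  \<open>unif n x < (1/2) ^ k\<close> with \<open>k \<le> n + 2\<close> are pairwise independent (\<open>unif_pair\<close>). Only such \<open>k\<close> matter:
  in a sum of numbers \<open>t n\<close> with total \<open>1\<close>, the terms with \<open>t n < (1/2) ^ (n + 2)\<close> amount to at most \<open>1/2\<close>.\<close>

definition unif :: "nat \<Rightarrow> real \<Rightarrow> real" where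
  "unif n x = frac (2 ^ ((n + 2)\<^sup>2) * x)"

lemma borel_measurable_unif [measurable]: "unif n \<in> borel_measurable borel"
  unfolding unif_def by measurable

lemma unif_bounds: "0 \<le> unif n x" "unif n x < 1"
  by (auto simp: unif_def frac_lt_1)

lemma nn_integral_unif:
  "f \<in> borel_measurable borel \<Longrightarrow> (\<integral>\<^sup>+x. f (unif n x) \<partial>unit_measure) = (\<integral>\<^sup>+x. f x \<partial>unit_measure)"
  unfolding unif_def by (rule nn_integral_frac_power2)

text \<open>The first \<open>k\<close> digits of \<open>x\<close> are independent of the digits that determine \<open>frac (2 ^ (k + l) * x)\<close>.\<close>

lemma nn_integral_initial_digits:
  fixes f :: "real \<Rightarrow> ennreal"
  assumes f [measurable]: "f \<in> borel_measurable borel"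
  shows "(\<integral>\<^sup>+x. indicator {..<(1/2) ^ k} x * f (frac (2 ^ (k + l) * x)) \<partial>unit_measure) = (\<integral>\<^sup>+x. f x \<partial>unit_measure) / 2 ^ k"
proof (induction k)
  case 0
  have "(\<integral>\<^sup>+x. indicator {..<(1/2) ^ 0} x * f (frac (2 ^ (0 + l) * x)) \<partial>unit_measure)
      = (\<integral>\<^sup>+x. f (frac (2 ^ l * x)) \<partial>unit_measure)"
    by (rule nn_integral_cong_AE, use AE_unit_measure in eventually_elim) auto
  then show ?case by (simp add: nn_integral_frac_power2 divide_ennreal_def)
next
  case (Suc k)
  let ?f = "\<lambda>x. indicator {..<(1/2) ^ Suc k} x * f (frac (2 ^ (Suc k + l) * x))"
  have "(\<integral>\<^sup>+x. ?f x \<partial>unit_measure) = ((\<integral>\<^sup>+x. ?f (x / 2) \<partial>unit_measure) + (\<integral>\<^sup>+x. ?f ((x + 1) / 2) \<partial>unit_measure)) / 2"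
    by (rule nn_integral_halves) measurable
  also have "(\<integral>\<^sup>+x. ?f (x / 2) \<partial>unit_measure) = (\<integral>\<^sup>+x. indicator {..<(1/2) ^ k} x * f (frac (2 ^ (k + l) * x)) \<partial>unit_measure)"
    by (intro nn_integral_cong) (auto split: split_indicator)
  also have "(\<integral>\<^sup>+x. ?f ((x + 1) / 2) \<partial>unit_measure) = (\<integral>\<^sup>+x. 0 \<partial>unit_measure)"
  proof (rule nn_integral_cong_AE, use AE_unit_measure in eventually_elim)
    fix x :: real assume "0 < x \<and> x < 1"
    moreover have "(1/2::real) ^ Suc k \<le> 1 / 2" by (simp add: power_le_one)
    ultimately show "?f ((x + 1) / 2) = 0" by (auto split: split_indicator)
  qed
  finally show ?case
    using Suc by (simp add: divide_ennreal_def ennreal_inverse_mult' mult.assoc mult.commute[of "inverse 2"])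
qed

lemma frac_power2_frac: "frac (2 ^ d * frac x) = frac (2 ^ d * x)" for x :: real
proof -
  have "2 ^ d * x = 2 ^ d * frac x + of_int (2 ^ d * \<lfloor>x\<rfloor>)"
    by (simp add: frac_def algebra_simps)
  moreover have "frac (y + of_int i) = frac y" for y :: real and i
    by (simp add: frac_def)
  ultimately show ?thesis by metis
qed

lemma unif_pair:
  assumes ij: "i < j" and k: "k \<le> i + 2"
  shows "(\<integral>\<^sup>+x. indicator {..<(1/2) ^ k} (unif i x) * indicator {..<(1/2) ^ l} (unif j x) \<partial>unit_measure)
    = ennreal ((1/2) ^ k * (1/2) ^ l)"
proof -
  have "(i + 2)\<^sup>2 + (i + 2) \<le> (i + 3)\<^sup>2" by (simp add: power2_eq_square algebra_simps)
  also have "\<dots> \<le> (j + 2)\<^sup>2" using ij by (intro power_mono) auto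
  finally have "(i + 2)\<^sup>2 + k \<le> (j + 2)\<^sup>2" using k by simp
  then obtain d where d: "(j + 2)\<^sup>2 = (i + 2)\<^sup>2 + (k + d)" by (metis add.assoc le_iff_add)
  have split: "2 ^ ((j + 2)\<^sup>2) * x = 2 ^ (k + d) * (2 ^ ((i + 2)\<^sup>2) * x)" for x :: real
    unfolding d by (simp only: power_add mult_ac)
  have uj: "unif j x = frac (2 ^ (k + d) * unif i x)" for x
    unfolding unif_def frac_power2_frac by (simp only: split)
  have one: "(\<integral>\<^sup>+x. indicator {..<(1/2) ^ l} x \<partial>unit_measure) = ennreal ((1/2) ^ l)" for l
    using nn_integral_initial_digits[of "\<lambda>x. 1" l 0]
    by (simp add: divide_ennreal_def power2_ennreal inverse_ennreal power_one_over inverse_eq_divide)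
  have "(\<integral>\<^sup>+x. indicator {..<(1/2) ^ k} (unif i x) * indicator {..<(1/2) ^ l} (unif j x) \<partial>unit_measure)
      = (\<integral>\<^sup>+x. indicator {..<(1/2) ^ k} x * indicator {..<(1/2) ^ l} (frac (2 ^ (k + d) * x)) \<partial>unit_measure)"
    unfolding uj by (rule nn_integral_unif) measurable
  also have "\<dots> = ennreal ((1/2) ^ l) / 2 ^ k"
    by (subst nn_integral_initial_digits) (simp_all add: one)
  also have "\<dots> = ennreal ((1/2) ^ k * (1/2) ^ l)"
    by (simp add: power2_ennreal divide_ennreal power_one_over)
  finally show ?thesis .
qed

lemma unif_single:
  "(\<integral>\<^sup>+x. indicator {..<(1/2) ^ k} (unif i x) \<partial>unit_measure) = ennreal ((1/2) ^ k)"
proof -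
  have "(\<integral>\<^sup>+x. indicator {..<(1/2) ^ k} (unif i x) \<partial>unit_measure) = (\<integral>\<^sup>+x. indicator {..<(1/2) ^ k} x \<partial>unit_measure)"
    by (rule nn_integral_unif) measurable
  also have "\<dots> = ennreal ((1/2) ^ k)"
    using nn_integral_initial_digits[of "\<lambda>x. 1" k 0]
    by (simp add: divide_ennreal_def power2_ennreal inverse_ennreal power_one_over inverse_eq_divide)
  finally show ?thesis .
qed

text \<open>For \<open>g = u powr (- 1 / \<alpha>)\<close> with \<open>u\<close> uniform, the part of \<open>t * g\<close> below \<open>1\<close> and the \<open>\<beta>\<close>-th power of the
  part above \<open>1\<close> both have integral of order \<open>t powr \<alpha>\<close>.\<close>

lemma truncated_moment:
  assumes \<alpha>\<beta>: "0 < \<beta>" "\<beta> < \<alpha>" "\<alpha> < 1" and t: "0 \<le> t"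
  shows "(\<integral>\<^sup>+u. ennreal (if t * u powr (- 1 / \<alpha>) \<le> 1 then t * u powr (- 1 / \<alpha>) else (t * u powr (- 1 / \<alpha>)) powr \<beta>) \<partial>unit_measure)
    \<le> ennreal ((1 / (1 - \<beta> / \<alpha>) + 1 / (1 / \<alpha> - 1)) * t powr \<alpha>)"
proof (cases "t = 0")
  case False
  with t have t: "0 < t" by simp
  have \<alpha>: "0 < \<alpha>" using \<alpha>\<beta> by simp
  let ?w = "\<lambda>u. t * u powr (- 1 / \<alpha>)"
  have q: "\<beta> / \<alpha> < 1" "1 < 1 / \<alpha>" "0 < 1 - \<beta> / \<alpha>" "0 < 1 / \<alpha> - 1" using \<alpha>\<beta> by auto
  have low: "(\<integral>\<^sup>+u. indicator {0..t powr \<alpha>} u * ennreal (u powr (- \<beta> / \<alpha>)) \<partial>lborel) = ennreal (t powr (\<alpha> - \<beta>) / (1 - \<beta> / \<alpha>))"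
  proof -
    have "((\<lambda>u. u powr (- \<beta> / \<alpha>)) has_integral ((t powr \<alpha>) powr (- \<beta> / \<alpha> + 1) / (- \<beta> / \<alpha> + 1))) {0..t powr \<alpha>}"
      using q by (intro has_integral_powr_from_0) auto
    from nn_integral_has_integral_lebesgue[OF _ this]
    have "(\<integral>\<^sup>+u. indicator {0..t powr \<alpha>} u * ennreal (u powr (- \<beta> / \<alpha>)) \<partial>lborel) = ennreal ((t powr \<alpha>) powr (- \<beta> / \<alpha> + 1) / (- \<beta> / \<alpha> + 1))"
      by (simp add: nn_integral_completion ennreal_indicator ennreal_mult')
    also have "ennreal ((t powr \<alpha>) powr (- \<beta> / \<alpha> + 1) / (- \<beta> / \<alpha> + 1)) = ennreal (t powr (\<alpha> - \<beta>) / (1 - \<beta> / \<alpha>))"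
    proof -
    have "\<alpha> * (- \<beta> / \<alpha> + 1) = \<alpha> - \<beta>" using \<alpha> by (simp add: field_simps)
    then have "(t powr \<alpha>) powr (- \<beta> / \<alpha> + 1) = t powr (\<alpha> - \<beta>)" by (simp only: powr_powr)
      then show ?thesis by (simp add: add.commute)
    qed
    finally show ?thesis .
  qed
  have high: "(\<integral>\<^sup>+u. indicator {t powr \<alpha>..} u * ennreal (u powr (- 1 / \<alpha>)) \<partial>lborel) = ennreal (t powr (\<alpha> - 1) / (1 / \<alpha> - 1))"
  proof -
    have "((\<lambda>u. u powr (- 1 / \<alpha>)) has_integral (- ((t powr \<alpha>) powr (- 1 / \<alpha> + 1)) / (- 1 / \<alpha> + 1))) {t powr \<alpha>..}"
      using q t by (intro has_integral_powr_to_inf) auto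
    from nn_integral_has_integral_lebesgue[OF _ this]
    have "(\<integral>\<^sup>+u. indicator {t powr \<alpha>..} u * ennreal (u powr (- 1 / \<alpha>)) \<partial>lborel) = ennreal (- ((t powr \<alpha>) powr (- 1 / \<alpha> + 1)) / (- 1 / \<alpha> + 1))"
      by (simp add: nn_integral_completion ennreal_indicator ennreal_mult')
    also have "- ((t powr \<alpha>) powr (- 1 / \<alpha> + 1)) / (- 1 / \<alpha> + 1) = t powr (\<alpha> - 1) / (1 / \<alpha> - 1)"
    proof -
    have "\<alpha> * (- 1 / \<alpha> + 1) = \<alpha> - 1" using \<alpha> by (simp add: field_simps)
    then have "(t powr \<alpha>) powr (- 1 / \<alpha> + 1) = t powr (\<alpha> - 1)" by (simp only: powr_powr)
    moreover have "- 1 / \<alpha> + 1 = - (1 / \<alpha> - 1)" by simp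
    then have "- y / (- 1 / \<alpha> + 1) = y / (1 / \<alpha> - 1)" for y
      by (simp only: minus_divide_divide)
    ultimately show ?thesis by (simp only:)
    qed
    finally show ?thesis .
  qed
  have pointwise: "ennreal (if ?w u \<le> 1 then ?w u else ?w u powr \<beta>) * indicator {0..1} u
      \<le> ennreal (t powr \<beta>) * (indicator {0..t powr \<alpha>} u * ennreal (u powr (- \<beta> / \<alpha>)))
        + ennreal t * (indicator {t powr \<alpha>..} u * ennreal (u powr (- 1 / \<alpha>)))" for u :: real
  proof (cases "0 < u")
    case True
    have w: "?w u powr \<beta> = t powr \<beta> * u powr (- \<beta> / \<alpha>)" using t True by (simp add: powr_mult powr_powr)
    show ?thesis
    proof (cases "t powr \<alpha> \<le> u")
      case le: True
      have "u powr (- 1 / \<alpha>) \<le> (t powr \<alpha>) powr (- 1 / \<alpha>)" using le t \<alpha> by (intro powr_mono2') auto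
      also have "\<dots> = 1 / t" using t \<alpha> by (simp add: powr_powr powr_minus_divide)
      finally have "?w u \<le> 1" using t by (simp add: field_simps)
      then show ?thesis using le t True by (auto simp: ennreal_mult split: split_indicator)
    next
      case False
      have "(t powr \<alpha>) powr (- 1 / \<alpha>) < u powr (- 1 / \<alpha>)" using False True t \<alpha> by (intro powr_less_mono2_neg) auto
      moreover have "(t powr \<alpha>) powr (- 1 / \<alpha>) = 1 / t" using t \<alpha> by (simp add: powr_powr powr_minus_divide)
      ultimately have "1 / t < u powr (- 1 / \<alpha>)" by (simp only:)
      from mult_strict_left_mono[OF this t] have "1 < ?w u" using t by simp
      moreover have "(t * u powr - (1 / \<alpha>)) powr \<beta> = t powr \<beta> * u powr - (\<beta> / \<alpha>)" using w by simp
      ultimately show ?thesis using False t True by (auto simp: ennreal_mult split: split_indicator)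
    qed
  qed (use t in \<open>auto split: split_indicator\<close>)
  have "(\<integral>\<^sup>+u. ennreal (if ?w u \<le> 1 then ?w u else ?w u powr \<beta>) \<partial>unit_measure)
      = (\<integral>\<^sup>+u. ennreal (if ?w u \<le> 1 then ?w u else ?w u powr \<beta>) * indicator {0..1} u \<partial>lborel)"
    by (rule nn_integral_unit_measure) measurable
  also have "\<dots> \<le> (\<integral>\<^sup>+u. ennreal (t powr \<beta>) * (indicator {0..t powr \<alpha>} u * ennreal (u powr (- \<beta> / \<alpha>)))
        + ennreal t * (indicator {t powr \<alpha>..} u * ennreal (u powr (- 1 / \<alpha>))) \<partial>lborel)"
    by (intro nn_integral_mono pointwise)
  also have "\<dots> = ennreal (t powr \<beta>) * ennreal (t powr (\<alpha> - \<beta>) / (1 - \<beta> / \<alpha>)) + ennreal t * ennreal (t powr (\<alpha> - 1) / (1 / \<alpha> - 1))"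
    using low high by (subst nn_integral_add) (simp_all add: nn_integral_cmult)
  also have "\<dots> = ennreal (t powr \<beta> * (t powr (\<alpha> - \<beta>) / (1 - \<beta> / \<alpha>)) + t * (t powr (\<alpha> - 1) / (1 / \<alpha> - 1)))"
    using t q by (simp flip: ennreal_mult ennreal_plus)
  also have "t powr \<beta> * (t powr (\<alpha> - \<beta>) / (1 - \<beta> / \<alpha>)) = t powr \<alpha> / (1 - \<beta> / \<alpha>)"
    using t by (simp flip: powr_add)
  also have "t * (t powr (\<alpha> - 1) / (1 / \<alpha> - 1)) = t powr \<alpha> / (1 / \<alpha> - 1)"
    using t by (simp add: powr_diff)
  finally show ?thesis by (simp add: algebra_simps)
qed simp

text \<open>The distribution function of these functions is that of a Pareto law with \<open>P(g > t) = t powr (- \<alpha>)\<close> for \<open>t \<ge> 1\<close>, so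
  they have the tails of a positive \<open>\<alpha>\<close>-stable variable.\<close>

definition stable_fun :: "real \<Rightarrow> nat \<Rightarrow> real \<Rightarrow> real" where
  "stable_fun \<alpha> n x = unif n x powr (- 1 / \<alpha>)"

lemma stable_nonneg [simp]: "0 \<le> stable_fun \<alpha> n x"
  by (simp add: stable_fun_def)

lemma borel_measurable_stable [measurable]: "stable_fun \<alpha> n \<in> borel_measurable borel"
  unfolding stable_fun_def by measurable

text \<open>The terms are truncated at \<open>1\<close>. The small parts are summed in \<open>L\<^sub>1\<close>, and the large parts by
  subadditivity of the \<open>\<beta>\<close>-th power.\<close>

lemma stable_upper:
  assumes \<alpha>\<beta>: "0 < \<beta>" "\<beta> < \<alpha>" "\<alpha> < 1" and b: "\<And>n. 0 \<le> b n" and one: "(\<Sum>n<m. b n powr \<alpha>) = 1"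
  shows "Lnorm unit_measure \<beta> (\<lambda>x. \<Sum>n<m. ennreal (b n * stable_fun \<alpha> n x))
    \<le> ennreal ((1 + (1 / (1 - \<beta> / \<alpha>) + 1 / (1 / \<alpha> - 1))) powr (1 / \<beta>))"
proof -
  define C where "C = 1 / (1 - \<beta> / \<alpha>) + 1 / (1 / \<alpha> - 1)"
  have "0 < 1 / (1 - \<beta> / \<alpha>)" "0 < 1 / (1 / \<alpha> - 1)" using \<alpha>\<beta> by auto
  from add_pos_pos[OF this] have C: "0 < C" unfolding C_def .
  define \<psi> where "\<psi> v = (if v \<le> 1 then v else v powr \<beta>)" for v :: real
  have pointwise: "enn_powr (\<Sum>n<m. ennreal (w n)) \<beta> \<le> 1 + (\<Sum>n<m. ennreal (\<psi> (w n)))" if w: "\<And>n. 0 \<le> w n" for w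
  proof -
    let ?y = "\<lambda>n. ennreal (if w n \<le> 1 then w n else 0)" and ?z = "\<lambda>n. ennreal (if w n \<le> 1 then 0 else w n)"
    have "(\<Sum>n<m. ennreal (w n)) = (\<Sum>n<m. ?y n) + (\<Sum>n<m. ?z n)"
      unfolding sum.distrib[symmetric] by (intro sum.cong) auto
    then have "enn_powr (\<Sum>n<m. ennreal (w n)) \<beta> \<le> enn_powr (\<Sum>n<m. ?y n) \<beta> + enn_powr (\<Sum>n<m. ?z n) \<beta>"
      using enn_powr_add_le[of \<beta> "\<Sum>n<m. ?y n" "\<Sum>n<m. ?z n"] \<alpha>\<beta> by (simp only:)
    also have "enn_powr v \<beta> \<le> 1 + v" for v
    proof (cases "v \<le> 1")
      case True
      then have "enn_powr v \<beta> \<le> enn_powr 1 \<beta>" using \<alpha>\<beta> by (intro enn_powr_mono) auto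
      then show ?thesis by (simp add: add_increasing2)
    next
      case False
      have "enn_powr v \<beta> \<le> v"
      proof (cases v)
        case (real u)
        with False have "1 \<le> u" by simp
        then have "u powr \<beta> \<le> u powr 1" using \<alpha>\<beta> by (intro powr_mono) auto
        then show ?thesis using real \<open>1 \<le> u\<close> by simp
      qed simp
      then show ?thesis by (simp add: add_increasing)
    qed
    then have "enn_powr (\<Sum>n<m. ?y n) \<beta> + enn_powr (\<Sum>n<m. ?z n) \<beta> \<le> (1 + (\<Sum>n<m. ?y n)) + (\<Sum>n<m. enn_powr (?z n) \<beta>)"
      using \<alpha>\<beta> by (intro add_mono enn_powr_sum_le) auto
    also have "\<dots> = 1 + (\<Sum>n<m. ennreal (\<psi> (w n)))"
      unfolding add.assoc sum.distrib[symmetric] by (intro arg_cong2[where f = plus] sum.cong refl) (auto simp: \<psi>_def w)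
    finally show ?thesis .
  qed
  have "(\<integral>\<^sup>+x. enn_powr (\<Sum>n<m. ennreal (b n * stable_fun \<alpha> n x)) \<beta> \<partial>unit_measure)
      \<le> (\<integral>\<^sup>+x. 1 + (\<Sum>n<m. ennreal (\<psi> (b n * stable_fun \<alpha> n x))) \<partial>unit_measure)"
    by (intro nn_integral_mono pointwise) (simp add: b)
  also have "\<dots> = 1 + (\<Sum>n<m. \<integral>\<^sup>+x. ennreal (\<psi> (b n * stable_fun \<alpha> n x)) \<partial>unit_measure)"
    unfolding \<psi>_def by (simp add: nn_integral_add nn_integral_sum)
  also have "\<dots> \<le> 1 + (\<Sum>n<m. ennreal (C * b n powr \<alpha>))"
  proof (intro add_left_mono sum_mono)
    fix n
    have "(\<integral>\<^sup>+x. ennreal (\<psi> (b n * stable_fun \<alpha> n x)) \<partial>unit_measure) = (\<integral>\<^sup>+u. ennreal (\<psi> (b n * u powr (- 1 / \<alpha>))) \<partial>unit_measure)"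
      unfolding stable_fun_def by (rule nn_integral_unif[where f = "\<lambda>u. ennreal (\<psi> (b n * u powr (- 1 / \<alpha>)))"]) (simp add: \<psi>_def)
    also have "\<dots> \<le> ennreal (C * b n powr \<alpha>)"
      unfolding \<psi>_def C_def by (rule truncated_moment[OF \<alpha>\<beta> b])
    finally show "(\<integral>\<^sup>+x. ennreal (\<psi> (b n * stable_fun \<alpha> n x)) \<partial>unit_measure) \<le> ennreal (C * b n powr \<alpha>)" .
  qed
  also have "(\<Sum>n<m. ennreal (C * b n powr \<alpha>)) = ennreal C"
    using C one by (simp flip: sum_distrib_left)
  also have "1 + ennreal C = ennreal (1 + C)" using C by (simp add: ennreal_plus)
  also have "\<dots> = enn_powr (ennreal ((1 + C) powr (1 / \<beta>))) \<beta>" using \<alpha>\<beta> C by (simp add: powr_powr)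
  finally show ?thesis using \<alpha>\<beta> by (simp add: Lnorm_le_iff C_def)
qed

text \<open>The sum is at least \<open>1\<close> as soon as one of the events \<open>unif n x < b n powr \<alpha>\<close> occurs. Rounding \<open>b n powr \<alpha>\<close> down to
  a power \<open>(1/2) ^ k\<close>, and omitting the \<open>n\<close> with \<open>b n powr \<alpha> < (1/2) ^ (n + 2)\<close>, leaves pairwise independent events
  whose probabilities have a sum \<open>T\<close> between \<open>1/4\<close> and \<open>1\<close>. By the second moment method their union has
  probability at least \<open>1/8\<close>.\<close>

lemma stable_lower:
  assumes \<alpha>\<beta>: "0 < \<beta>" "\<beta> < \<alpha>" "\<alpha> < 1" and b: "\<And>n. 0 \<le> b n" and one: "(\<Sum>n<m. b n powr \<alpha>) = 1"
  shows "ennreal ((1/8) powr (1 / \<beta>)) \<le> Lnorm unit_measure \<beta> (\<lambda>x. \<Sum>n<m. ennreal (b n * stable_fun \<alpha> n x))"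
proof -
  have \<alpha>: "0 < \<alpha>" using \<alpha>\<beta> by simp
  define t where "t n = b n powr \<alpha>" for n
  define J where "J = {n. n < m \<and> (1/2) ^ (n + 2) \<le> t n}"
  define k where "k n = (LEAST k. (1/2) ^ k \<le> t n)" for n
  have J: "finite J" by (simp add: J_def)
  have t1: "t n \<le> 1" if "n < m" for n
    unfolding t_def one[symmetric] using that by (intro member_le_sum) auto
  have k: "(1/2) ^ k n \<le> t n" "k n \<le> n + 2" "t n \<le> 2 * (1/2) ^ k n" if n: "n \<in> J" for n
  proof -
    have ex: "(1/2) ^ (n + 2) \<le> t n" using n by (simp add: J_def)
    show "(1/2) ^ k n \<le> t n" unfolding k_def by (rule LeastI[of "\<lambda>k. (1/2) ^ k \<le> t n", OF ex])
    show "k n \<le> n + 2" unfolding k_def by (rule Least_le[of "\<lambda>k. (1/2) ^ k \<le> t n", OF ex])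
    show "t n \<le> 2 * (1/2) ^ k n"
    proof (cases "k n")
      case 0
      then show ?thesis using t1[of n] n by (simp add: J_def)
    next
      case (Suc l)
      then have "\<not> (1/2) ^ l \<le> t n" using not_less_Least[of l "\<lambda>k. (1/2) ^ k \<le> t n"] by (simp add: k_def)
      then show ?thesis using Suc by simp
    qed
  qed
  define q where "q n = (1/2::real) ^ k n" for n
  define T where "T = (\<Sum>n\<in>J. q n)"
  have q: "0 < q n" for n by (simp add: q_def)
  have T: "1/4 \<le> T" "T \<le> 1"
  proof -
    have "T \<le> (\<Sum>n\<in>J. t n)" unfolding T_def q_def using k by (intro sum_mono) auto
    also have "\<dots> \<le> (\<Sum>n<m. t n)" by (intro sum_mono2) (auto simp: J_def t_def)
    finally show "T \<le> 1" using one by (simp add: t_def)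
    have geo: "(\<Sum>n<m. (1/2::real) ^ (n + 2)) = 1/2 - (1/2) ^ (m + 1)" for m
      by (induction m) auto
    have "(1::real) = (\<Sum>n<m. t n)" using one by (simp add: t_def)
    also have "\<dots> = (\<Sum>n\<in>J. t n) + (\<Sum>n\<in>{..<m} - J. t n)"
      by (subst sum.subset_diff[of J]) (auto simp: J_def)
    also have "(\<Sum>n\<in>{..<m} - J. t n) \<le> (\<Sum>n\<in>{..<m} - J. (1/2) ^ (n + 2))"
      by (intro sum_mono) (auto simp: J_def)
    also have "\<dots> \<le> (\<Sum>n<m. (1/2) ^ (n + 2))" by (intro sum_mono2) auto
    also have "\<dots> \<le> 1/2" unfolding geo by simp
    also have "(\<Sum>n\<in>J. t n) \<le> (\<Sum>n\<in>J. 2 * q n)" unfolding q_def using k by (intro sum_mono) auto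
    also have "\<dots> = 2 * T" by (simp add: T_def sum_distrib_left)
    finally show "1/4 \<le> T" by simp
  qed
  define B where "B n x = (indicator {..<q n} (unif n x) :: ennreal)" for n x
  have [measurable]: "B n \<in> borel_measurable borel" for n unfolding B_def by measurable
  define f where "f x = (\<Sum>n\<in>J. B n x)" for x
  have int_f: "(\<integral>\<^sup>+x. f x \<partial>unit_measure) = ennreal T"
    unfolding f_def T_def by (simp add: nn_integral_sum B_def q_def unif_single sum_ennreal)
  have pair: "(\<integral>\<^sup>+x. B i x * B j x \<partial>unit_measure) \<le> ennreal ((if i = j then q i else 0) + q i * q j)" if ij: "i \<in> J" "j \<in> J" for i j
  proof (cases i j rule: linorder_cases)
    case equal
    then have "(\<integral>\<^sup>+x. B i x * B j x \<partial>unit_measure) = (\<integral>\<^sup>+x. B i x \<partial>unit_measure)"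
      by (intro nn_integral_cong) (auto simp: B_def split: split_indicator)
    then show ?thesis using equal q[of i] by (auto simp: B_def q_def unif_single intro!: ennreal_leI)
  next
    case less
    then show ?thesis using unif_pair[OF less k(2)[OF ij(1)], of "k j"] by (simp add: B_def q_def)
  next
    case greater
    then show ?thesis using unif_pair[OF greater k(2)[OF ij(2)], of "k i"] by (simp add: B_def q_def mult.commute)
  qed
  have int_f2: "(\<integral>\<^sup>+x. f x * f x \<partial>unit_measure) \<le> ennreal (T + T * T)"
  proof -
    have "(\<integral>\<^sup>+x. f x * f x \<partial>unit_measure) = (\<Sum>i\<in>J. \<Sum>j\<in>J. \<integral>\<^sup>+x. B i x * B j x \<partial>unit_measure)"
      unfolding f_def sum_product by (simp add: nn_integral_sum)
    also have "\<dots> \<le> (\<Sum>i\<in>J. \<Sum>j\<in>J. ennreal ((if i = j then q i else 0) + q i * q j))"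
      by (intro sum_mono pair)
    also have "\<dots> = ennreal (\<Sum>i\<in>J. \<Sum>j\<in>J. (if i = j then q i else 0) + q i * q j)"
    proof -
      have "0 \<le> (if i = j then q i else 0) + q i * q j" for i j
        using less_imp_le[OF q] by (cases "i = j") (simp_all add: add_nonneg_nonneg)
      then show ?thesis by (simp add: sum_ennreal sum_nonneg del: ennreal_plus)
    qed
    also have "(\<Sum>i\<in>J. \<Sum>j\<in>J. (if i = j then q i else 0) + q i * q j) = T + T * T"
      using J by (simp add: sum.distrib T_def sum_product)
    finally show ?thesis .
  qed
  define H where "H x = enn_powr (\<Sum>n<m. ennreal (b n * stable_fun \<alpha> n x)) \<beta>" for x
  have [measurable]: "H \<in> borel_measurable borel"
    unfolding H_def using \<alpha>\<beta>(1) by (intro borel_measurable_enn_powr) measurable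
  have unif_pos: "AE x in unit_measure. 0 < unif n x" for n
  proof -
    have "(\<integral>\<^sup>+x. indicator {0} (unif n x) \<partial>unit_measure) = (\<integral>\<^sup>+x. indicator {0} x \<partial>unit_measure)"
      by (rule nn_integral_unif) simp
    also have "\<dots> = (\<integral>\<^sup>+x. 0 \<partial>unit_measure)"
      by (rule nn_integral_cong_AE, use AE_unit_measure in eventually_elim) auto
    also have "\<dots> = 0" by simp
    finally have "AE x in unit_measure. indicator {0} (unif n x) = (0::ennreal)"
      by (rule nn_integral_0_iff_AE[THEN iffD1, rotated]) simp
    then show ?thesis
      by eventually_elim (use unif_bounds(1) in \<open>auto simp: less_le split: split_indicator_asm\<close>)
  qed
  \<comment> \<open>the number \<open>N\<close> of events that occur satisfies \<open>N \<le> 1 + N\<^sup>2 / 4\<close>, and \<open>H x \<ge> 1\<close> if \<open>N > 0\<close>\<close>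
  have "AE x in unit_measure. f x \<le> H x + ennreal (1/4) * (f x * f x)"
  proof -
    have "AE x in unit_measure. \<forall>n. 0 < unif n x" using unif_pos by (simp add: AE_all_countable)
    then show ?thesis
    proof eventually_elim
      case (elim x)
      define N where "N = card {n \<in> J. unif n x < q n}"
      have fN: "f x = ennreal (real N)"
      proof -
        have "f x = (\<Sum>n\<in>J. if unif n x < q n then 1 else 0)"
          unfolding f_def B_def by (intro sum.cong) auto
        also have "\<dots> = of_nat N" using J by (simp add: N_def sum.If_cases Int_def)
        finally show ?thesis by (simp add: ennreal_of_nat_eq_real_of_nat)
      qed
      show ?case
      proof (cases "N = 0")
        case False
        then obtain n where n: "n \<in> J" "unif n x < q n" unfolding N_def by (metis (mono_tags, lifting) Collect_empty_eq card.empty)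
        then have less: "unif n x < t n" using k(1)[OF n(1)] by (simp add: q_def)
        have bn: "0 < b n" using less elim[rule_format, of n] b[of n] by (cases "b n = 0") (auto simp: t_def)
        have "(t n) powr (- 1 / \<alpha>) \<le> stable_fun \<alpha> n x"
          unfolding stable_fun_def using less elim[rule_format, of n] \<alpha> by (intro powr_mono2') auto
        moreover have "(t n) powr (- 1 / \<alpha>) = 1 / b n" using bn \<alpha> by (simp add: t_def powr_powr powr_minus_divide)
        ultimately have "1 / b n \<le> stable_fun \<alpha> n x" by (simp only:)
        from mult_left_mono[OF this less_imp_le[OF bn]] have "1 \<le> b n * stable_fun \<alpha> n x" using bn by simp
        then have "ennreal 1 \<le> ennreal (b n * stable_fun \<alpha> n x)" by (rule ennreal_leI)
        also have "\<dots> \<le> (\<Sum>n<m. ennreal (b n * stable_fun \<alpha> n x))"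
          using n by (intro member_le_sum) (auto simp: J_def)
        finally have "enn_powr 1 \<beta> \<le> H x" unfolding H_def using \<alpha>\<beta> by (intro enn_powr_mono) auto
        then have "1 + ennreal (1/4) * (f x * f x) \<le> H x + ennreal (1/4) * (f x * f x)" by (simp add: add_right_mono)
        moreover have "f x \<le> 1 + ennreal (1/4) * (f x * f x)"
        proof -
          have "0 \<le> (real N / 2 - 1)\<^sup>2" by simp
          then have "real N \<le> 1 + 1/4 * (real N * real N)" by (simp add: power2_eq_square algebra_simps)
          then have "ennreal (real N) \<le> ennreal (1 + 1/4 * (real N * real N))" by (rule ennreal_leI)
          also have "\<dots> = 1 + ennreal (1/4) * (ennreal (real N) * ennreal (real N))"
            by (subst ennreal_plus) (auto simp: ennreal_mult[symmetric] simp del: ennreal_plus)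
          finally show ?thesis unfolding fN .
        qed
        ultimately show ?thesis by (rule order_trans[rotated])
      qed (simp add: fN)
    qed
  qed
  then have "(\<integral>\<^sup>+x. f x \<partial>unit_measure) \<le> (\<integral>\<^sup>+x. H x + ennreal (1/4) * (f x * f x) \<partial>unit_measure)"
    by (rule nn_integral_mono_AE)
  also have "\<dots> = (\<integral>\<^sup>+x. H x \<partial>unit_measure) + ennreal (1/4) * (\<integral>\<^sup>+x. f x * f x \<partial>unit_measure)"
    unfolding f_def by (subst nn_integral_add) (auto simp: nn_integral_cmult)
  also have "\<dots> \<le> (\<integral>\<^sup>+x. H x \<partial>unit_measure) + ennreal (1/4) * ennreal (T + T * T)"
    by (intro add_left_mono mult_left_mono int_f2) simp
  also have "ennreal (1/4) * ennreal (T + T * T) = ennreal ((T + T * T) / 4)"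
    using ennreal_mult'[of "1/4" "T + T * T"] by simp
  finally have main: "ennreal T \<le> (\<integral>\<^sup>+x. H x \<partial>unit_measure) + ennreal ((T + T * T) / 4)"
    unfolding int_f .
  have "ennreal (1/8) \<le> (\<integral>\<^sup>+x. H x \<partial>unit_measure)"
  proof (cases "\<integral>\<^sup>+x. H x \<partial>unit_measure")
    case (real h)
    have "ennreal T \<le> ennreal (h + (T + T * T) / 4)" using main real T by (simp add: ennreal_plus)
    then have "T \<le> h + (T + T * T) / 4" using real T by (subst (asm) ennreal_le_iff) auto
    then have "3 * T \<le> T * T + 4 * h" by (simp add: field_simps)
    moreover have "T * T \<le> T" using mult_left_mono[of T 1 T] T by simp
    ultimately have "1/8 \<le> h" using T(1) by linarith
    then show ?thesis unfolding real by (rule ennreal_leI)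
  qed (simp only: top_greatest)
  moreover have "enn_powr (ennreal ((1/8) powr (1 / \<beta>))) \<beta> = ennreal (1/8)" using \<alpha>\<beta> by (simp add: powr_powr)
  ultimately show ?thesis using \<alpha>\<beta> by (simp only: le_Lnorm_iff H_def)
qed

text \<open>By homogeneity it suffices to consider sequences \<open>b\<close> with \<open>(\<Sum>n<m. b n powr \<alpha>) = 1\<close>.\<close>

lemma stable_equivalence:
  assumes \<alpha>\<beta>: "0 < \<beta>" "\<beta> < \<alpha>" "\<alpha> < 1"
  obtains c C where "0 < c" "0 < C" "\<And>m b. (\<And>n. 0 \<le> b n) \<Longrightarrow>
      ennreal (c * (\<Sum>n<m. b n powr \<alpha>) powr (1 / \<alpha>)) \<le> Lnorm unit_measure \<beta> (\<lambda>x. \<Sum>n<m. ennreal (b n * stable_fun \<alpha> n x)) \<and>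
      Lnorm unit_measure \<beta> (\<lambda>x. \<Sum>n<m. ennreal (b n * stable_fun \<alpha> n x)) \<le> ennreal (C * (\<Sum>n<m. b n powr \<alpha>) powr (1 / \<alpha>))"
proof -
  define C where "C = (1 + (1 / (1 - \<beta> / \<alpha>) + 1 / (1 / \<alpha> - 1))) powr (1 / \<beta>)"
  have \<alpha>: "0 < \<alpha>" using \<alpha>\<beta> by simp
  have "0 < 1 / (1 - \<beta> / \<alpha>)" "0 < 1 / (1 / \<alpha> - 1)" using \<alpha>\<beta> by auto
  from add_pos_pos[OF this] have "0 < 1 + (1 / (1 - \<beta> / \<alpha>) + 1 / (1 / \<alpha> - 1))" by linarith
  then have C: "0 < C" unfolding C_def by (simp only: powr_gt_zero)
  show thesis
  proof (rule that[of "(1/8) powr (1 / \<beta>)" C])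
    show "0 < (1/8::real) powr (1 / \<beta>)" "0 < C" using C by auto
    fix m and b :: "nat \<Rightarrow> real" assume b: "\<And>n. 0 \<le> b n"
    define S where "S = (\<Sum>n<m. b n powr \<alpha>)"
    let ?L = "Lnorm unit_measure \<beta> (\<lambda>x. \<Sum>n<m. ennreal (b n * stable_fun \<alpha> n x))"
    show "ennreal ((1/8) powr (1 / \<beta>) * (\<Sum>n<m. b n powr \<alpha>) powr (1 / \<alpha>)) \<le> ?L \<and>
        ?L \<le> ennreal (C * (\<Sum>n<m. b n powr \<alpha>) powr (1 / \<alpha>))"
    proof (cases "S = 0")
      case True
      then have "\<forall>n\<in>{..<m}. b n powr \<alpha> = 0" unfolding S_def by (subst (asm) sum_nonneg_eq_0_iff) auto
      then have "(\<Sum>n<m. ennreal (b n * stable_fun \<alpha> n x)) = 0" for x by (intro sum.neutral) auto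
      then show ?thesis using True by (simp add: S_def)
    next
      case False
      have "0 \<le> S" unfolding S_def by (intro sum_nonneg) simp
      with False have S: "0 < S" by simp
      define d where "d n = b n / S powr (1 / \<alpha>)" for n
      have d: "0 \<le> d n" for n using b by (simp add: d_def)
      have d1: "(\<Sum>n<m. d n powr \<alpha>) = 1"
      proof -
        have "d n powr \<alpha> = b n powr \<alpha> / S" for n using S b \<alpha> by (simp add: d_def powr_divide powr_powr)
        then show ?thesis using S by (simp add: S_def flip: sum_divide_distrib)
      qed
      have scale: "?L = ennreal (S powr (1 / \<alpha>)) * Lnorm unit_measure \<beta> (\<lambda>x. \<Sum>n<m. ennreal (d n * stable_fun \<alpha> n x))"
      proof -
        have "(\<Sum>n<m. ennreal (b n * stable_fun \<alpha> n x)) = ennreal (S powr (1 / \<alpha>)) * (\<Sum>n<m. ennreal (d n * stable_fun \<alpha> n x))" for x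
          unfolding sum_distrib_left
        proof (rule sum.cong[OF refl])
          fix n
          have "b n * stable_fun \<alpha> n x = S powr (1 / \<alpha>) * (d n * stable_fun \<alpha> n x)" using S by (simp add: d_def)
          then have "ennreal (b n * stable_fun \<alpha> n x) = ennreal (S powr (1 / \<alpha>) * (d n * stable_fun \<alpha> n x))"
            by (rule arg_cong)
          also have "\<dots> = ennreal (S powr (1 / \<alpha>)) * ennreal (d n * stable_fun \<alpha> n x)"
            by (rule ennreal_mult') simp
          finally show "ennreal (b n * stable_fun \<alpha> n x) = ennreal (S powr (1 / \<alpha>)) * ennreal (d n * stable_fun \<alpha> n x)" .
        qed
        then show ?thesis using \<alpha>\<beta>(1) by (simp only: Lnorm_cmult) (simp add: Lnorm_cmult)
      qed
      have "ennreal (S powr (1 / \<alpha>)) * ennreal ((1/8) powr (1 / \<beta>)) \<le> ?L"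
        unfolding scale by (intro mult_left_mono stable_lower[OF \<alpha>\<beta> d d1]) simp
      moreover have "?L \<le> ennreal (S powr (1 / \<alpha>)) * ennreal C"
        unfolding scale C_def by (intro mult_left_mono stable_upper[OF \<alpha>\<beta> d d1]) simp
      ultimately show ?thesis using C by (simp add: S_def[symmetric] mult.commute flip: ennreal_mult)
    qed
  qed
qed

section \<open>Embeddings by stable sequences\<close>

text \<open>For \<open>s < p < r\<close>, disjoint supports in \<open>y\<close> produce the \<open>r\<close>-th power mean of the coefficients times the
  values in \<open>x\<close>, whose \<open>L\<^sub>s\<close> norm is a multiple of the \<open>\<ell>\<^sub>p\<close> norm if these are stable.\<close>

lemma embeds_ell_between:
  assumes s: "0 < s" "s < p" "p < r"
  shows "embeds_isomorphically (ell_space p :: ('k::{real_normed_field, euclidean_space}, _) qn_space) (mixed_L s r)"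
proof -
  have r: "0 < r" and p: "0 < p" using s by auto
  obtain c C where cC: "0 < c" "0 < C" and bounds: "\<And>m b. (\<And>n. 0 \<le> b n) \<Longrightarrow>
      ennreal (c * (\<Sum>n<m. b n powr (p / r)) powr (1 / (p / r))) \<le> Lnorm unit_measure (s / r) (\<lambda>x. \<Sum>n<m. ennreal (b n * stable_fun (p / r) n x)) \<and>
      Lnorm unit_measure (s / r) (\<lambda>x. \<Sum>n<m. ennreal (b n * stable_fun (p / r) n x)) \<le> ennreal (C * (\<Sum>n<m. b n powr (p / r)) powr (1 / (p / r)))"
  proof (rule stable_equivalence[of "s / r" "p / r"])
    show "0 < s / r" "s / r < p / r" "p / r < 1" using s r by (auto simp: divide_strict_right_mono)
  qed auto
  let ?g = "\<lambda>n x. stable_fun (p / r) n x powr (1 / r)"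
  let ?h = "\<lambda>n z. of_real (?g n (fst z) * bump r n (snd z)) :: 'k"
  have eq: "mixed_fnorm s r (\<lambda>z. \<Sum>n<m. a n * ?h n z)
      = enn_powr (Lnorm unit_measure (s / r) (\<lambda>x. \<Sum>n<m. ennreal (norm (a n) powr r * stable_fun (p / r) n x))) (1 / r)"
    for a :: "nat \<Rightarrow> 'k" and m
  proof -
    have "Lnorm unit_measure r (\<lambda>y. ennreal (norm (\<Sum>n<m. a n * ?h n (x, y))))
        = enn_powr (\<Sum>n<m. ennreal (norm (a n) powr r * stable_fun (p / r) n x)) (1 / r)" for x
    proof -
      have "enn_powr (ennreal (norm (a n) * ?g n x)) r = ennreal (norm (a n) powr r * stable_fun (p / r) n x)" for n
        using r by (simp add: powr_mult powr_powr)
      then show ?thesis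
        using ennreal_norm_bump_sum[of "\<lambda>n. ?g n x" a r] Lnorm_bump[OF r, where m = m and b = "\<lambda>n. ennreal (norm (a n) * ?g n x)"]
        by simp
    qed
    then show ?thesis
      using s r unfolding mixed_norm_def by (simp add: Lnorm_enn_powr)
  qed
  have pow: "(\<Sum>n<m. (norm (a n) powr r) powr (p / r)) = (\<Sum>n<m. norm (a n) powr p)" for m and a :: "nat \<Rightarrow> 'k"
    using r by (simp add: powr_powr)
  have root: "enn_powr (ennreal (d * S powr (1 / (p / r)))) (1 / r) = ennreal (d powr (1 / r) * S powr (1 / p))"
    if "0 < d" for d S :: real using that r by (simp add: powr_mult powr_powr)
  show ?thesis
  proof (rule embeds_if_finite_sums[OF s(1) r p, of "c powr (1 / r)" "C powr (1 / r)" ?h])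
    fix a :: "nat \<Rightarrow> 'k" and m
    have b: "\<And>n. 0 \<le> norm (a n) powr r" by simp
    note B = bounds[where b = "\<lambda>n. norm (a n) powr r" and m = m, OF b, unfolded pow]
    show "ennreal (c powr (1 / r) * (\<Sum>n<m. norm (a n) powr p) powr (1 / p)) \<le> mixed_fnorm s r (\<lambda>z. \<Sum>n<m. a n * ?h n z)"
      unfolding eq root[OF cC(1), symmetric] using B r by (intro enn_powr_mono) auto
    show "mixed_fnorm s r (\<lambda>z. \<Sum>n<m. a n * ?h n z) \<le> ennreal (C powr (1 / r) * (\<Sum>n<m. norm (a n) powr p) powr (1 / p))"
      unfolding eq root[OF cC(2), symmetric] using B r by (intro enn_powr_mono) auto
  qed (use cC in \<open>simp_all\<close>)
qed

lemma rademacher_square_sum: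
  fixes a :: "nat \<Rightarrow> 'k::real_normed_field"
  assumes "\<And>n. 0 \<le> g n"
  shows "(\<Sum>n<m. enn_powr (ennreal (norm (a n * of_real (g n powr (1 / 2))))) 2) = (\<Sum>n<m. ennreal ((norm (a n))\<^sup>2 * g n))"
  using assms by (intro sum.cong refl) (simp add: norm_mult powr_mult powr_powr powr_numeral)

lemma square_powr_half: "((norm a)\<^sup>2) powr (p / 2) = norm a powr p"
  by (cases "a = 0") (auto simp: powr_powr simp flip: powr_numeral)

text \<open>For \<open>s < p < 2\<close>, Rademacher functions in \<open>y\<close> take over the role of the disjoint functions.\<close>

lemma embeds_ell_below_2_outer:
  assumes s: "0 < s" "s < p" "p < 2" and r: "0 < r"
  shows "embeds_isomorphically (ell_space p :: ('k::{real_normed_field, euclidean_space}, _) qn_space) (mixed_L s r)"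
proof -
  have p: "0 < p" using s by auto
  obtain c C where cC: "0 < c" "0 < C" and bounds: "\<And>m b. (\<And>n. 0 \<le> b n) \<Longrightarrow>
      ennreal (c * (\<Sum>n<m. b n powr (p / 2)) powr (1 / (p / 2))) \<le> Lnorm unit_measure (s / 2) (\<lambda>x. \<Sum>n<m. ennreal (b n * stable_fun (p / 2) n x)) \<and>
      Lnorm unit_measure (s / 2) (\<lambda>x. \<Sum>n<m. ennreal (b n * stable_fun (p / 2) n x)) \<le> ennreal (C * (\<Sum>n<m. b n powr (p / 2)) powr (1 / (p / 2)))"
    by (rule stable_equivalence[of "s / 2" "p / 2"]) (use s in auto)
  obtain k K where kK: "0 < k" "0 < K" and rad: "\<And>m (a :: nat \<Rightarrow> 'k).
      ennreal k * enn_powr (\<Sum>n<m. enn_powr (ennreal (norm (a n))) 2) (1 / 2)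
        \<le> Lnorm unit_measure r (\<lambda>x. ennreal (norm (\<Sum>n<m. rademacher n x *\<^sub>R a n))) \<and>
      Lnorm unit_measure r (\<lambda>x. ennreal (norm (\<Sum>n<m. rademacher n x *\<^sub>R a n)))
        \<le> ennreal K * enn_powr (\<Sum>n<m. enn_powr (ennreal (norm (a n))) 2) (1 / 2)"
    by (rule Lnorm_rademacher[OF r]) auto
  let ?g = "\<lambda>n x. stable_fun (p / 2) n x powr (1 / 2)"
  let ?h = "\<lambda>n z. of_real (?g n (fst z) * rademacher n (snd z)) :: 'k"
  define Q where "Q m a x = (\<Sum>n<m. ennreal ((norm (a n))\<^sup>2 * stable_fun (p / 2) n x))" for m and a :: "nat \<Rightarrow> 'k" and x
  have [measurable]: "Q m a \<in> borel_measurable borel" for m a unfolding Q_def by measurable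
  have swap: "a * (of_real u * of_real v) = v *\<^sub>R (a * of_real u)" for a :: 'k and u v :: real
    by (simp add: scaleR_conv_of_real mult_ac)
  have inner: "ennreal k * enn_powr (Q m a x) (1 / 2) \<le> Lnorm unit_measure r (\<lambda>y. ennreal (norm (\<Sum>n<m. a n * ?h n (x, y))))"
    "Lnorm unit_measure r (\<lambda>y. ennreal (norm (\<Sum>n<m. a n * ?h n (x, y)))) \<le> ennreal K * enn_powr (Q m a x) (1 / 2)" for m a x
    using rad[where m = m and a = "\<lambda>n. a n * of_real (?g n x)"] rademacher_square_sum[of "\<lambda>n. stable_fun (p / 2) n x" a m]
    by (simp_all add: swap Q_def)
  have outer: "Lnorm unit_measure s (\<lambda>x. ennreal d * enn_powr (Q m a x) (1 / 2)) = ennreal d * enn_powr (Lnorm unit_measure (s / 2) (Q m a)) (1 / 2)" for d m a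
    using s by (simp add: Lnorm_cmult Lnorm_enn_powr)
  have root: "ennreal d * enn_powr (ennreal (e * S powr (1 / (p / 2)))) (1 / 2) = ennreal (d * e powr (1 / 2) * S powr (1 / p))"
    if "0 < d" "0 < e" for d e S :: real using that by (simp add: powr_mult powr_powr mult.assoc flip: ennreal_mult)
  show ?thesis
  proof (rule embeds_if_finite_sums[OF s(1) r p, of "k * c powr (1 / 2)" "K * C powr (1 / 2)" ?h])
    fix a :: "nat \<Rightarrow> 'k" and m
    have b: "\<And>n. 0 \<le> (norm (a n))\<^sup>2" by simp
    note B = bounds[where b = "\<lambda>n. (norm (a n))\<^sup>2" and m = m, OF b, unfolded square_powr_half, folded Q_def]
    show "ennreal (k * c powr (1 / 2) * (\<Sum>n<m. norm (a n) powr p) powr (1 / p)) \<le> mixed_fnorm s r (\<lambda>z. \<Sum>n<m. a n * ?h n z)"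
    proof -
      have "ennreal (k * c powr (1 / 2) * (\<Sum>n<m. norm (a n) powr p) powr (1 / p)) \<le> ennreal k * enn_powr (Lnorm unit_measure (s / 2) (Q m a)) (1 / 2)"
        unfolding root[OF kK(1) cC(1), symmetric] using B by (intro mult_left_mono enn_powr_mono) auto
      also have "\<dots> \<le> mixed_fnorm s r (\<lambda>z. \<Sum>n<m. a n * ?h n z)"
        unfolding mixed_norm_def outer[symmetric] by (intro Lnorm_mono s inner)
      finally show ?thesis .
    qed
    show "mixed_fnorm s r (\<lambda>z. \<Sum>n<m. a n * ?h n z) \<le> ennreal (K * C powr (1 / 2) * (\<Sum>n<m. norm (a n) powr p) powr (1 / p))"
    proof -
      have "mixed_fnorm s r (\<lambda>z. \<Sum>n<m. a n * ?h n z) \<le> ennreal K * enn_powr (Lnorm unit_measure (s / 2) (Q m a)) (1 / 2)"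
        unfolding mixed_norm_def outer[symmetric] by (intro Lnorm_mono s inner)
      also have "\<dots> \<le> ennreal (K * C powr (1 / 2) * (\<Sum>n<m. norm (a n) powr p) powr (1 / p))"
        unfolding root[OF kK(2) cC(2), symmetric] using B by (intro mult_left_mono enn_powr_mono) auto
      finally show ?thesis .
    qed
  qed (use cC kK in \<open>simp_all\<close>)
qed

text \<open>For \<open>r < p < 2\<close> and \<open>r \<le> s\<close> the two variables exchange their roles. For the upper estimate, Minkowski's inequality
  with exponent \<open>r / s \<le> 1\<close> moves the average over signs inside the integral over \<open>y\<close>; for the lower one, \<open>s\<close> is
  replaced by \<open>r\<close>, after which the two integrals may be interchanged.\<close>

lemma embeds_ell_below_2_inner:
  assumes r: "0 < r" "r < p" "p < 2" and rs: "r \<le> s"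
  shows "embeds_isomorphically (ell_space p :: ('k::{real_normed_field, euclidean_space}, _) qn_space) (mixed_L s r)"
proof -
  have p: "0 < p" and s: "0 < s" using r rs by auto
  obtain c C where cC: "0 < c" "0 < C" and bounds: "\<And>m b. (\<And>n. 0 \<le> b n) \<Longrightarrow>
      ennreal (c * (\<Sum>n<m. b n powr (p / 2)) powr (1 / (p / 2))) \<le> Lnorm unit_measure (r / 2) (\<lambda>x. \<Sum>n<m. ennreal (b n * stable_fun (p / 2) n x)) \<and>
      Lnorm unit_measure (r / 2) (\<lambda>x. \<Sum>n<m. ennreal (b n * stable_fun (p / 2) n x)) \<le> ennreal (C * (\<Sum>n<m. b n powr (p / 2)) powr (1 / (p / 2)))"
    by (rule stable_equivalence[of "r / 2" "p / 2"]) (use r in auto)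
  obtain K where K: "0 < K" and up: "\<And>(I :: nat set) (a :: nat \<Rightarrow> 'k). finite I \<Longrightarrow>
    (\<Sum>A\<in>Pow I. enn_powr (ennreal (norm (\<Sum>i\<in>I. sgn_of A i *\<^sub>R a i))) s)
      \<le> ennreal (2 ^ card I * K) * enn_powr (\<Sum>i\<in>I. enn_powr (ennreal (norm (a i))) 2) (s / 2)"
    by (rule khinchine_upper_ennreal[OF s]) auto
  obtain k where k: "0 < k" and low: "\<And>(I :: nat set) (a :: nat \<Rightarrow> 'k). finite I \<Longrightarrow>
    2 ^ card I * enn_powr (\<Sum>i\<in>I. enn_powr (ennreal (norm (a i))) 2) (r / 2)
      \<le> ennreal k * (\<Sum>A\<in>Pow I. enn_powr (ennreal (norm (\<Sum>i\<in>I. sgn_of A i *\<^sub>R a i))) r)"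
    by (rule khinchine_lower_ennreal[OF r(1)]) auto
  let ?g = "\<lambda>n y. stable_fun (p / 2) n y powr (1 / 2)"
  let ?h = "\<lambda>n z. of_real (?g n (snd z) * rademacher n (fst z)) :: 'k"
  define Q where "Q m a x = (\<Sum>n<m. ennreal ((norm (a n))\<^sup>2 * stable_fun (p / 2) n x))" for m and a :: "nat \<Rightarrow> 'k" and x
  have [measurable]: "Q m a \<in> borel_measurable borel" for m a unfolding Q_def by measurable
  define S where "S m a A y = ennreal (norm (\<Sum>n<m. sgn_of A n *\<^sub>R (a n * of_real (?g n y))))" for m and a :: "nat \<Rightarrow> 'k" and A y
  have [measurable]: "S m a A \<in> borel_measurable borel" for m a A unfolding S_def by measurable
  have Q_eq: "(\<Sum>n<m. enn_powr (ennreal (norm (a n * of_real (?g n y)))) 2) = Q m a y" for m a y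
    unfolding Q_def by (rule rademacher_square_sum) simp
  have S_up: "(\<Sum>A\<in>Pow {..<m}. enn_powr (S m a A y) s) \<le> ennreal (2 ^ m * K) * enn_powr (Q m a y) (s / 2)" for m a y
    using up[of "{..<m}" "\<lambda>n. a n * of_real (?g n y)"] unfolding Q_eq by (simp add: S_def)
  have S_low: "2 ^ m * enn_powr (Q m a y) (r / 2) \<le> ennreal k * (\<Sum>A\<in>Pow {..<m}. enn_powr (S m a A y) r)" for m a y
    using low[of "{..<m}" "\<lambda>n. a n * of_real (?g n y)"] unfolding Q_eq by (simp add: S_def)
  have swap: "a * (of_real u * of_real v) = v *\<^sub>R (a * of_real u)" for a :: 'k and u v :: real
    by (simp add: scaleR_conv_of_real mult_ac)
  have norm_eq: "ennreal (norm (\<Sum>n<m. a n * ?h n (x, y))) = S m a (bits x \<inter> {..<m}) y" for m a x y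
    unfolding S_def by (simp add: swap rademacher_sum)
  have mixed: "enn_powr (mixed_fnorm t r (\<lambda>z. \<Sum>n<m. a n * ?h n z)) t
      = (\<Sum>A\<in>Pow {..<m}. enn_powr (Lnorm unit_measure r (S m a A)) t) / 2 ^ m" if "0 < t" for t m a
    unfolding mixed_norm_def norm_eq by (rule Lnorm_signs[OF that])
  show ?thesis
  proof (rule embeds_if_finite_sums[OF s r(1) p, of "(1 / k) powr (1 / r) * c powr (1 / 2)" "K powr (1 / s) * C powr (1 / 2)" ?h])
    fix a :: "nat \<Rightarrow> 'k" and m
    have b: "\<And>n. 0 \<le> (norm (a n))\<^sup>2" by simp
    note B = bounds[where b = "\<lambda>n. (norm (a n))\<^sup>2" and m = m, OF b, unfolded square_powr_half, folded Q_def]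
    let ?W = "Lnorm unit_measure (r / 2) (Q m a)" and ?S = "(\<Sum>n<m. norm (a n) powr p)"
    let ?N = "\<lambda>t. mixed_fnorm t r (\<lambda>z. \<Sum>n<m. a n * ?h n z)"
    have root: "ennreal d * enn_powr (ennreal (e * ?S powr (1 / (p / 2)))) (1 / 2) = ennreal (d * e powr (1 / 2) * ?S powr (1 / p))"
      if "0 < d" "0 < e" for d e :: real using that by (simp add: powr_mult powr_powr mult.assoc flip: ennreal_mult)
    show "ennreal ((1 / k) powr (1 / r) * c powr (1 / 2) * ?S powr (1 / p)) \<le> ?N s"
    proof -
      have "2 ^ m * enn_powr ?W (r / 2) = (\<integral>\<^sup>+y. 2 ^ m * enn_powr (Q m a y) (r / 2) \<partial>unit_measure)"
        using enn_powr_Lnorm[of "r / 2" unit_measure "Q m a"] r by (simp add: nn_integral_cmult)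
      also have "\<dots> \<le> (\<integral>\<^sup>+y. ennreal k * (\<Sum>A\<in>Pow {..<m}. enn_powr (S m a A y) r) \<partial>unit_measure)"
        by (intro nn_integral_mono S_low)
      also have "\<dots> = ennreal k * (\<Sum>A\<in>Pow {..<m}. enn_powr (Lnorm unit_measure r (S m a A)) r)"
        using r(1) by (simp add: nn_integral_cmult nn_integral_sum enn_powr_Lnorm)
      also have "(\<Sum>A\<in>Pow {..<m}. enn_powr (Lnorm unit_measure r (S m a A)) r) = 2 ^ m * enn_powr (?N r) r"
        unfolding mixed[OF r(1)]
        by (simp add: ennreal_times_divide mult.commute[of "2 ^ m"] ennreal_mult_divide_eq)
      also have "ennreal k * (2 ^ m * enn_powr (?N r) r) = 2 ^ m * (ennreal k * enn_powr (?N r) r)"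
        by (rule mult.left_commute)
      finally have "enn_powr ?W (r / 2) \<le> ennreal k * enn_powr (?N r) r"
        by (subst (asm) ennreal_mult_le_mult_iff) auto
      then have "ennreal (1 / k) * enn_powr ?W (r / 2) \<le> ennreal (1 / k) * (ennreal k * enn_powr (?N r) r)"
        by (rule mult_left_mono) simp
      also have "\<dots> = enn_powr (?N r) r" using k by (simp flip: mult.assoc ennreal_mult)
      finally have "enn_powr (ennreal (1 / k) * enn_powr ?W (r / 2)) (1 / r) \<le> enn_powr (enn_powr (?N r) r) (1 / r)"
        using r by (intro enn_powr_mono) auto
      then have low: "ennreal ((1 / k) powr (1 / r)) * enn_powr ?W (1 / 2) \<le> ?N r"
        using r k by (simp add: enn_powr_mult enn_powr_enn_powr)
      have "ennreal ((1 / k) powr (1 / r) * c powr (1 / 2) * ?S powr (1 / p)) \<le> ennreal ((1 / k) powr (1 / r)) * enn_powr ?W (1 / 2)"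
      proof -
        have pos: "0 < (1 / k) powr (1 / r)" using k by simp
        show ?thesis
          unfolding root[OF pos cC(1), symmetric] using B by (intro mult_left_mono enn_powr_mono) auto
      qed
      also note low
      also have "?N r \<le> ?N s" using r rs by (intro mixed_norm_exponent_mono) auto
      finally show ?thesis .
    qed
    show "?N s \<le> ennreal (K powr (1 / s) * C powr (1 / 2) * ?S powr (1 / p))"
    proof -
      have "(\<Sum>A\<in>Pow {..<m}. enn_powr (Lnorm unit_measure r (S m a A)) s)
          = (\<Sum>A\<in>Pow {..<m}. Lnorm unit_measure (r / s) (\<lambda>y. enn_powr (S m a A y) s))"
        using r(1) s by (simp add: Lnorm_enn_powr)
      also have "\<dots> \<le> Lnorm unit_measure (r / s) (\<lambda>y. \<Sum>A\<in>Pow {..<m}. enn_powr (S m a A y) s)"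
        using r(1) rs s by (intro Lnorm_sum_ge) auto
      also have "\<dots> \<le> Lnorm unit_measure (r / s) (\<lambda>y. ennreal (2 ^ m * K) * enn_powr (Q m a y) (s / 2))"
        using r(1) s by (intro Lnorm_mono S_up) auto
      also have "\<dots> = ennreal (2 ^ m * K) * enn_powr ?W (s / 2)"
        using r(1) s by (simp add: Lnorm_cmult Lnorm_enn_powr)
      also have "\<dots> = 2 ^ m * (ennreal K * enn_powr ?W (s / 2))"
        using K by (simp add: power2_ennreal ennreal_mult mult.assoc)
      finally have "enn_powr (?N s) s \<le> ennreal K * enn_powr ?W (s / 2)"
        unfolding mixed[OF s] ennreal_le_divide_power2 .
      then have "enn_powr (enn_powr (?N s) s) (1 / s) \<le> enn_powr (ennreal K * enn_powr ?W (s / 2)) (1 / s)"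
        using s by (intro enn_powr_mono) auto
      then have "?N s \<le> ennreal (K powr (1 / s)) * enn_powr ?W (1 / 2)"
        using s K by (simp add: enn_powr_mult enn_powr_enn_powr)
      also have "\<dots> \<le> ennreal (K powr (1 / s) * C powr (1 / 2) * ?S powr (1 / p))"
      proof -
        have pos: "0 < K powr (1 / s)" using K by simp
        show ?thesis
          unfolding root[OF pos cC(2), symmetric] using B by (intro mult_left_mono enn_powr_mono) auto
      qed
      finally show ?thesis .
    qed
  qed (use cC k K in \<open>simp_all\<close>)
qed

section \<open>The set \<open>\<Lambda>(L\<^sub>s(L\<^sub>r))\<close>\<close>

lemma Lambda_mixed_L_restrictions:
  assumes s: "0 < s" and r: "0 < r"
    and p: "p \<in> Lambda (mixed_L s r :: ('k::{real_normed_field, euclidean_space}, (real \<times> real \<Rightarrow> 'k) set) qn_space)"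
  obtains q where "p = ereal q" "min 2 (min s r) \<le> q" "q \<le> max 2 (max s r)"
    "2 \<le> s \<Longrightarrow> 2 \<le> r \<Longrightarrow> q \<le> 2 \<or> min s r \<le> q"
    "2 \<le> s \<Longrightarrow> r \<le> s \<Longrightarrow> q \<le> max 2 r \<or> s \<le> q"
proof -
  have "0 < p" and emb: "embeds_isomorphically (ell p :: ('k, nat \<Rightarrow> 'k) qn_space) (mixed_L s r)"
    using p by (auto simp: Lambda_def)
  then obtain h :: "nat \<Rightarrow> real \<times> real \<Rightarrow> 'k" where
    h: "spreads s r (if p = \<infinity> then 0 else 1 / real_of_ereal p) h"
    by (rule embedding_imp_spreads[OF s r])
  have m: "0 < min 2 (min s r)" "0 < max 2 (max s r)" "0 < max 2 r" using s r by auto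
  have "p \<noteq> \<infinity>"
  proof
    assume "p = \<infinity>"
    then have "1 / max 2 (max s r) \<le> 0" using spreads_cotype[OF s r h] by simp
    then show False using m by (simp add: divide_le_0_iff)
  qed
  with \<open>0 < p\<close> obtain q where q: "p = ereal q" "0 < q" by (cases p) auto
  with h have h: "spreads s r (1 / q) h" by simp
  have le: "1 / q \<le> 1 / a \<longleftrightarrow> a \<le> q" "1 / q < 1 / a \<longleftrightarrow> a < q" "1 / a \<le> 1 / q \<longleftrightarrow> q \<le> a" if "0 < a" for a
    using that q by (auto simp: field_simps)
  show thesis
  proof (rule that[OF q(1)])
    show "min 2 (min s r) \<le> q" using spreads_type[OF s r h] by (simp only: le(1)[OF m(1)])
    show "q \<le> max 2 (max s r)" using spreads_cotype[OF s r h] by (simp only: le(3)[OF m(2)])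
    show "q \<le> 2 \<or> min s r \<le> q" if "2 \<le> s" "2 \<le> r"
      using spreads_gap_both[OF that h] le(2)[of 2] le(1)[of "min s r"] that by auto
    show "q \<le> max 2 r \<or> s \<le> q" if "2 \<le> s" "r \<le> s"
      using spreads_gap_outer[OF r that h] le(2)[OF m(3)] le(1)[OF s] by linarith
  qed
qed

lemma Lambda_mixed_L_mem:
  assumes s: "0 < s" and r: "0 < r"
    and q: "q = s \<or> q = r \<or> q = 2 \<or> (s < q \<and> q < r) \<or> (s < q \<and> q < 2) \<or> (r < q \<and> q < 2 \<and> r \<le> s)"
  shows "ereal q \<in> Lambda (mixed_L s r :: ('k::{real_normed_field, euclidean_space}, (real \<times> real \<Rightarrow> 'k) set) qn_space)"
proof -
  have "embeds_isomorphically (ell_space q :: ('k, nat \<Rightarrow> 'k) qn_space) (mixed_L s r)"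
    using q embeds_ell_outer[OF s r] embeds_ell_inner[OF s r] embeds_ell_2[OF s r] embeds_ell_between[of s q r]
      embeds_ell_below_2_outer[of s q r] embeds_ell_below_2_inner[of r q s] s r by blast
  moreover have "0 < q" using q s r by auto
  ultimately show ?thesis by (simp add: Lambda_def ell_def)
qed

lemma Lambda_mixed_L:
  fixes r s :: real
  assumes r: "0 < r" and s: "0 < s"
  defines "\<Lambda> \<equiv> Lambda (mixed_L s r :: ('k::{real_normed_field, euclidean_space}, (real \<times> real \<Rightarrow> 'k) set) qn_space)"
  shows "r \<le> s \<Longrightarrow> s \<le> 2 \<Longrightarrow> \<Lambda> = {ereal r..2}"
    and "r \<le> 2 \<Longrightarrow> 2 \<le> s \<Longrightarrow> \<Lambda> = {ereal r..2} \<union> {ereal s}"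
    and "2 \<le> r \<Longrightarrow> r \<le> s \<Longrightarrow> \<Lambda> = {2, ereal r, ereal s}"
    and "s \<le> min 2 r \<Longrightarrow> \<Lambda> = {ereal s..ereal (max 2 r)}"
    and "2 < s \<Longrightarrow> s \<le> r \<Longrightarrow> \<Lambda> = {2} \<union> {ereal s..ereal r}"
proof -
  have two: "2 = ereal 2" by simp
  have eqI: "\<Lambda> = S" if sub: "\<And>q. 0 < q \<Longrightarrow> min 2 (min s r) \<le> q \<Longrightarrow> q \<le> max 2 (max s r) \<Longrightarrow>
      (2 \<le> s \<Longrightarrow> 2 \<le> r \<Longrightarrow> q \<le> 2 \<or> min s r \<le> q) \<Longrightarrow> (2 \<le> s \<Longrightarrow> r \<le> s \<Longrightarrow> q \<le> max 2 r \<or> s \<le> q) \<Longrightarrow> ereal q \<in> S"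
    and sup: "\<And>p. p \<in> S \<Longrightarrow> \<exists>q. p = ereal q \<and> (q = s \<or> q = r \<or> q = 2 \<or> (s < q \<and> q < r) \<or> (s < q \<and> q < 2) \<or> (r < q \<and> q < 2 \<and> r \<le> s))"
    for S
  proof (intro equalityI subsetI)
    fix p assume "p \<in> \<Lambda>"
    then show "p \<in> S"
      unfolding \<Lambda>_def
    proof (rule Lambda_mixed_L_restrictions[OF s r])
      fix q assume "p = ereal q" and q: "min 2 (min s r) \<le> q" "q \<le> max 2 (max s r)"
        "2 \<le> s \<Longrightarrow> 2 \<le> r \<Longrightarrow> q \<le> 2 \<or> min s r \<le> q" "2 \<le> s \<Longrightarrow> r \<le> s \<Longrightarrow> q \<le> max 2 r \<or> s \<le> q"
      moreover have "0 < q" using q(1) s r by linarith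
      ultimately show "p \<in> S" using sub by blast
    qed
  next
    fix p assume "p \<in> S"
    then show "p \<in> \<Lambda>" using sup Lambda_mixed_L_mem[OF s r, where 'k = 'k] unfolding \<Lambda>_def by blast
  qed
  have interval: "{ereal a..ereal b} = ereal ` {a..b}" for a b
  proof (intro equalityI subsetI)
    show "p \<in> ereal ` {a..b}" if "p \<in> {ereal a..ereal b}" for p using that by (cases p) auto
  qed auto
  show "\<Lambda> = {ereal r..2}" if "r \<le> s" "s \<le> 2"
    unfolding two interval by (rule eqI) (use that in auto)
  show "\<Lambda> = {ereal r..2} \<union> {ereal s}" if "r \<le> 2" "2 \<le> s"
    unfolding two interval by (rule eqI) (use that in auto)
  show "\<Lambda> = {2, ereal r, ereal s}" if "2 \<le> r" "r \<le> s"
    unfolding two interval by (rule eqI) (use that in auto)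
  show "\<Lambda> = {ereal s..ereal (max 2 r)}" if "s \<le> min 2 r"
  proof -
    define M where "M = max 2 r"
    have M: "2 \<le> M" "r \<le> M" "M = 2 \<or> M = r" by (auto simp: M_def)
    show ?thesis
      unfolding M_def[symmetric] interval by (rule eqI) (use that M in auto)
  qed
  show "\<Lambda> = {2} \<union> {ereal s..ereal r}" if "2 < s" "s \<le> r"
    unfolding two interval by (rule eqI) (use that in auto)
qed

theorem theorem3p5:
  fixes r s :: real
  assumes "0 < r" and "0 < s"
  shows
    "(r \<le> s \<and> s \<le> 2 \<longrightarrow>
        Lambda (mixed_L_real s r) = {ereal r..2} \<and>
        Lambda (mixed_L_complex s r) = {ereal r..2}) \<and>
     (r \<le> 2 \<and> 2 \<le> s \<longrightarrow>
        Lambda (mixed_L_real s r) = {ereal r..2} \<union> {ereal s} \<and>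
        Lambda (mixed_L_complex s r) = {ereal r..2} \<union> {ereal s}) \<and>
     (2 \<le> r \<and> r \<le> s \<longrightarrow>
        Lambda (mixed_L_real s r) = {2, ereal r, ereal s} \<and>
        Lambda (mixed_L_complex s r) = {2, ereal r, ereal s}) \<and>
     (s \<le> min 2 r \<longrightarrow>
        Lambda (mixed_L_real s r) = {ereal s..ereal (max 2 r)} \<and>
        Lambda (mixed_L_complex s r) = {ereal s..ereal (max 2 r)}) \<and>
     (2 < s \<and> s \<le> r \<longrightarrow>
        Lambda (mixed_L_real s r) = {2} \<union> {ereal s..ereal r} \<and>
        Lambda (mixed_L_complex s r) = {2} \<union> {ereal s..ereal r})"
  by (intro conjI impI; (elim conjE)?; rule Lambda_mixed_L[OF assms]; assumption)

end
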